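(* Let $G$ be a graph with $n\ge 3$ vertices. Then the constant coefficients of $\phi^G\pmod 2$ and $\phi^{\overline{G}}\pmod 2$, as well as $W^G\pmod 2$ and the top $n$ coefficients of $\phi^{\overline{G}}\pmod 4$, can be reconstructed from the polynomial deck of $G$. That is: let $n\ge 3$ and let $G,H$ be graphs on $[n]$ with $\phi^{G\setminus i}=\phi^{H\setminus i}$ for every $i\in[n]$. Then (i) $\phi^G(0)\equiv\phi^H(0)\pmod 2$; (ii) $\phi^{\overline{G}}(0)\equiv\phi^{\overline{H}}(0)\pmod 2$; (iii) $W^G\equiv W^H\pmod 2$ entrywise; (iv) for every $j\in\{1,\dots,n\}$ the coefficients of $x^j$ in $\phi^{\overline{G}}$ and $\phi^{\overline{H}}$ are congruent modulo $4$.
   Context: Graphs are finite, simple and undirected. For a graph $G$ with vertex set $[n]=\{1,\dots,n\}$ and adjacency matrix $A$, the characteristic polynomial is $\phi^G(x)=\det(xI-A)\in\mathbb{Z}[x]$. $\overline{G}$ denotes the complement of $G$ and $G\setminus i$ the graph obtained by deleting vertex $i$. The polynomial deck of $G$ is the multiset $\{\phi^{G\setminus i}\}_{i\in[n]}$. The walk matrix is $W^G=(\mathbf{1}\ \ A\mathbf{1}\ \ \cdots\ \ A^{n-1}\mathbf{1})$, where $\mathbf{1}$ is the all-ones vector; its $i$-th row corresponds to vertex $i$. Since the rows of $W^G$ are indexed by vertices, $W^G\pmod 2$ is reconstructed with its $i$-th row matched to the deck element $\phi^{G\setminus i}$; equality of decks as multisets becomes $\phi^{G\setminus i}=\phi^{H\setminus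 i}$ for all $i$ after relabelling the vertices of $H$. *)

theory Defs
  imports
    "Graph_Theory.Digraph"
    "Jordan_Normal_Form.Char_Poly"
    "HOL-Number_Theory.Cong"
begin

text \<open>
  A finite simple undirected graph is a \<open>graph\<close> in the sense of \<open>Graph_Theory\<close>: a finite
  symmetric digraph without loops and parallel arcs.  An edge between \<open>u\<close> and \<open>v\<close> is the pair of
  arcs with ends \<open>(u, v)\<close> and \<open>(v, u)\<close>, and vertex deletion is \<open>pre_digraph.del_vert\<close>.

  Matrices are indexed from 0, with the vertices listed in increasing order.  Thus, if the vertex
  set is \<open>{1..n}\<close>, row \<open>i\<close> of a matrix below corresponds to vertex \<open>Suc i\<close>.
\<close>

definition complement :: "('a, 'b) pre_digraph \<Rightarrow> ('a, 'a \<times> 'a) pre_digraph" where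
  "complement G =
    \<lparr> verts = verts G,
      arcs = {(u, v). u \<in> verts G \<and> v \<in> verts G \<and> u \<noteq> v \<and> (u, v) \<notin> arcs_ends G},
      tail = fst, head = snd \<rparr>"

definition adjacency_matrix :: "('a :: linorder, 'b) pre_digraph \<Rightarrow> int mat" where
  "adjacency_matrix G =
    (let vs = sorted_list_of_set (verts G); n = card (verts G)
     in mat n n (\<lambda>(i, j). if (vs ! i, vs ! j) \<in> arcs_ends G then 1 else 0))"

definition graph_char_poly :: "('a :: linorder, 'b) pre_digraph \<Rightarrow> int poly" where
  "graph_char_poly G = char_poly (adjacency_matrix G)"

definition walk_matrix :: "('a :: linorder, 'b) pre_digraph \<Rightarrow> int mat" where
  "walk_matrix G =
    (let n = card (verts G)
     in mat_of_cols n (map (\<lambda>k. (adjacency_matrix G ^\<^sub>m k) *\<^sub>v vec n (\<lambda>_. 1)) [0..<n]))"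

lemma graph_complement:
  assumes "graph G"
  shows "graph (complement G)"
proof -
  interpret graph G by fact
  let ?A = "{(u, v). u \<in> verts G \<and> v \<in> verts G \<and> u \<noteq> v \<and> (u, v) \<notin> arcs_ends G}"
  have [simp]: "verts (complement G) = verts G" "arcs (complement G) = ?A"
    "tail (complement G) = fst" "head (complement G) = snd"
    "arc_to_ends (complement G) = id"
    by (simp_all add: complement_def arc_to_ends_def fun_eq_iff)
  have "finite ?A"
    by (rule finite_subset[of _ "verts G \<times> verts G"]) auto
  moreover have "sym ?A"
    using sym_arcs unfolding symmetric_def sym_def by blast
  then have "symmetric (complement G)"
    by (simp add: symmetric_def arcs_ends_def)
  ultimately show ?thesis
    by unfold_locales (simp_all add: case_prod_beta)
qed

lemma adjacency_matrix_index:
  assumes "verts G = {1..n}" "i < n" "j < n"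
  shows "adjacency_matrix G $$ (i, j) = (if (Suc i, Suc j) \<in> arcs_ends G then 1 else 0)"
proof -
  have "sorted_list_of_set (verts G) = [1..<Suc n]"
    using assms(1) by (metis atLeastLessThanSuc_atLeastAtMost sorted_list_of_set_range)
  then show ?thesis
    using assms by (simp add: adjacency_matrix_def Let_def del: upt_Suc)
qed

end

theory Submission
  imports Defs "HOL-Library.Z2"
begin

text \<open>
  Let \<open>A\<close> be the adjacency matrix, \<open>K = x I - A\<close>, \<open>\<phi> = det K\<close>, and let \<open>a i j\<close> be the entries of the
  adjugate of \<open>K\<close>, \<open>row i\<close> its row sums and \<open>num\<close> the sum of all its entries. The deck consists of the
  diagonal entries \<open>a i i\<close>, whose sum is the derivative of \<open>\<phi>\<close>. So the deck determines \<open>\<phi>\<close> up to its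
  constant term. The entries of the walk matrix can be read off from \<open>row i\<close> and \<open>\<phi>\<close>, and the
  characteristic polynomial of the complement is, up to sign and the substitution of \<open>- 1 - x\<close>
  for \<open>x\<close>, the determinant \<open>\<phi> + num\<close> of \<open>K + J\<close>, where \<open>J\<close> is the all-ones matrix.

  If the constant terms of two such polynomials have the same parity, the rest follows from two
  observations. The quadratic form of \<open>K\<close> is, modulo 2, \<open>x\<close> times a square, which gives
  \<open>\<phi> * a i i = x * (row i)\<^sup>2\<close> (\<open>red_row_square\<close>); hence \<open>row i\<close> is determined modulo 2, and so are
  the numbers of walks (\<open>walks_parity\<close>). Secondly, \<open>num\<close> is the derivative of \<open>\<phi>\<close> plus twice the sum
  of the \<open>a i j\<close> with \<open>j < i\<close>. Modulo 2 the square of this sum is the sum of the squares, which is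
  determined because the trace of the squared adjugate is \<open>\<phi>'\<^sup>2 - \<phi> \<phi>''\<close> (\<open>sum_a_square\<close>). So \<open>num\<close>
  is determined modulo 4 (\<open>num_cong_4\<close>).

  The parity of the constant term (\<open>const_parity\<close>) is the hard part. Modulo 2 a symmetric matrix
  with zero diagonal is skew, so for odd \<open>n\<close> the constant term is even. Let \<open>n = 2 m\<close> and suppose
  that one of the two constant terms is odd and the other one even. Modulo 2 everything is built
  from squares: \<open>\<phi> = q\<^sup>2\<close>, \<open>a i i = x (r i)\<^sup>2\<close>, \<open>a i j = x (r i) (r j) + q (s i j)\<close>. Both graphs have
  the same \<open>r i\<close>, while their polynomials \<open>q\<close> differ by 1. The next binary digits are the
  polynomials \<open>g\<close>, \<open>h\<close>, \<open>f i\<close> with \<open>\<phi> = Q\<^sup>2 + 2 g\<close>, \<open>num = 2 h\<close> and \<open>a i i = x (R i)\<^sup>2 + 2 (f i)\<close>,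
  where \<open>Q\<close> and \<open>R i\<close> are the lifts of \<open>q\<close> and \<open>r i\<close> with coefficients 0 and 1. Jacobi's identity
  \<open>a i i * a j j - (a i j)\<^sup>2 = \<phi> * d\<close>, read modulo 4 both for \<open>K\<close> and for \<open>K + J\<close>, turns into the
  divisibility by \<open>q\<^sup>2\<close> of
  \<open>f i (r j)\<^sup>2 + f j (r i)\<^sup>2 + h (s i j)\<^sup>2 + q (r i) (r j) (s i j)\<close> (\<open>jacobi_difference\<close>).

  These divisibilities hold for both graphs, with the same \<open>f\<close> and \<open>r\<close> and with the coprime moduli
  \<open>q0\<^sup>2\<close> and \<open>q1\<^sup>2\<close>. Summing them over \<open>j\<close> with suitable weights and comparing degrees yields
  \<open>h = q q'\<close>, \<open>q0 = x q0'\<close> and \<open>f i = x\<^sup>2 (r i)\<^sup>2 + q0 q1\<close> (\<open>h0\<close>, \<open>q0_eq\<close>, \<open>f_eq\<close>), where index 0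
  belongs to the graph with even constant term. With these values the divisibility for that graph, weighted by
  \<open>s i j\<close> and summed, is so strong that the square root \<open>p\<close> of \<open>q0'\<close> must divide \<open>x + x\<^sup>2\<close>, and
  at a root of \<open>p\<close> all \<open>r i\<close> vanish. But \<open>q0\<close> and the \<open>r i\<close> generate the unit ideal
  (\<open>contradiction\<close>).
\<close>

section \<open>Polynomials over the field with two elements\<close>

text \<open>
  From here on \<open>smult\<close> is the scalar multiplication of polynomials.
\<close>

hide_const (open) Module.smult

text \<open>
  By default sums and products of bits are rewritten to Boolean operations, which hides the ring
  structure from the simplifier.
\<close>

declare add_bit_eq_xor [simp del] mult_bit_eq_and [simp del] power_bit_unfold [simp del]

lemma bit_add_self [simp]: "a + a = (0 :: bit)"
  by (cases a) (simp_all add: add_bit_eq_xor)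

lemma bit_poly_two [simp]: "(2 :: bit poly) = 0"
  by (simp add: numeral_poly)

lemma bit_poly_add_self [simp]: "p + p = (0 :: bit poly)"
  by (metis mult_2 mult_zero_left bit_poly_two)

lemma bit_poly_uminus [simp]: "- p = (p :: bit poly)"
  by (rule poly_eqI) simp

lemma bit_poly_diff [simp]: "p - q = p + (q :: bit poly)"
  by (rule poly_eqI) simp

lemma bit_poly_add_cancel [simp]: "p + (p + q) = (q :: bit poly)"
  by (simp flip: add.assoc)

lemma bit_poly_add_eq_0_iff: "p + q = 0 \<longleftrightarrow> p = (q :: bit poly)"
  by (metis add_eq_0_iff bit_poly_uminus)

text \<open>
  Squaring is the Frobenius homomorphism.
\<close>

lemma bit_poly_square_add: "(p + q)\<^sup>2 = p\<^sup>2 + (q :: bit poly)\<^sup>2"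
  by (simp add: power2_sum)

lemma bit_poly_square_sum: "(\<Sum>i\<in>I. f i)\<^sup>2 = (\<Sum>i\<in>I. (f i :: bit poly)\<^sup>2)"
  by (induction I rule: infinite_finite_induct) (simp_all add: bit_poly_square_add)

lemma bit_poly_square_eq_iff: "p\<^sup>2 = q\<^sup>2 \<longleftrightarrow> p = (q :: bit poly)"
  by (metis power2_eq_iff bit_poly_uminus)

lemma smult_square_bit: "(smult a p)\<^sup>2 = smult a (p\<^sup>2)" for a :: bit
  by (cases a) (simp_all flip: one_add_one)

lemma of_nat_bit: "(of_nat k :: bit) = of_bool (odd k)"
  by (induction k) auto

lemma pCons_square_bit: "(pCons a p)\<^sup>2 = pCons a (pCons 0 (p\<^sup>2))" for a :: bit
proof -
  have "(pCons a p)\<^sup>2 = ([:a:] + pCons 0 p)\<^sup>2"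
    by simp
  also have "\<dots> = [:a:]\<^sup>2 + (pCons 0 p)\<^sup>2"
    by (rule bit_poly_square_add)
  also have "(pCons 0 p)\<^sup>2 = pCons 0 (pCons 0 (p\<^sup>2))"
    by (simp add: power2_eq_square)
  also have "[:a:]\<^sup>2 = [:a:]"
    by (cases a) (simp_all add: power2_eq_square)
  finally show ?thesis by simp
qed

lemma coeff_bit_poly_square:
  "coeff (p\<^sup>2) k = (if even k then coeff p (k div 2) else (0 :: bit))"
proof (induction p arbitrary: k)
  case 0
  then show ?case by simp
next
  case (pCons a p)
  show ?case
  proof (cases k)
    case (Suc l)
    then show ?thesis
      by (cases l) (simp_all add: pCons_square_bit pCons.IH)
  qed (simp add: pCons_square_bit)
qed

lemma pderiv_bit_poly_square [simp]: "pderiv (p\<^sup>2 :: bit poly) = 0"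
  by (simp add: power2_eq_square pderiv_mult)

text \<open>
  The second derivative brings in the factors \<open>k * (k - 1)\<close>, which are even.
\<close>

lemma pderiv_pderiv_bit [simp]: "pderiv (pderiv (p :: bit poly)) = 0"
  by (rule poly_eqI) (simp add: coeff_pderiv of_nat_bit del: of_nat_Suc)

text \<open>
  If the derivative vanishes, only even exponents occur, and every bit is its own square root.
\<close>

lemma square_if_pderiv_eq_0:
  assumes "pderiv (p :: bit poly) = 0"
  obtains s where "p = s\<^sup>2"
proof
  define s where "s = Poly (map (\<lambda>k. coeff p (2 * k)) [0..<Suc (degree p)])"
  have c: "coeff s k = coeff p (2 * k)" for k
    by (cases "k < Suc (degree p)")
       (auto simp: s_def nth_default_def coeff_eq_0 simp del: upt_Suc)
  show "p = s\<^sup>2"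
  proof (rule poly_eqI)
    fix k
    show "coeff p k = coeff (s\<^sup>2) k"
    proof (cases "even k")
      case True
      then show ?thesis by (simp add: coeff_bit_poly_square c)
    next
      case False
      then obtain l where k: "k = Suc l" "even l"
        by (cases k) auto
      have "coeff (pderiv p) l = 0"
        using assms by simp
      then have "coeff p k = 0"
        using k by (simp add: coeff_pderiv of_nat_bit del: of_nat_Suc)
      then show ?thesis
        using False by (simp add: coeff_bit_poly_square)
    qed
  qed
qed

text \<open>
  A constant rather than an abbreviation, so that products with the indeterminate are not
  multiplied out.
\<close>

definition X :: "bit poly" where
  "X = [:0, 1:]"

lemma X_neq_0 [simp]: "X \<noteq> 0"
  by (simp add: X_def)

lemma degree_X [simp]: "degree X = 1"
  by (simp add: X_def)

lemma pderiv_X [simp]: "pderiv X = 1"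
  by (simp add: X_def pderiv_pCons)

lemma X_plus_X_square: "X + X\<^sup>2 \<noteq> 0" "degree (X + X\<^sup>2) = 2"
  by (simp_all add: X_def power2_eq_square)

lemma pderiv_sum: "pderiv (\<Sum>i\<in>I. f i) = (\<Sum>i\<in>I. pderiv (f i))"
  by (induction I rule: infinite_finite_induct) (simp_all add: pderiv_add)

lemma coeff_X_mult: "coeff (X * p) l = (if l = 0 then 0 else coeff p (l - 1))"
  by (simp add: X_def coeff_pCons split: nat.splits)

lemma coeff_X_square_mult: "coeff (X\<^sup>2 * p) k = (if k < 2 then 0 else coeff p (k - 2))"
  by (auto simp: power2_eq_square mult.assoc coeff_X_mult numeral_2_eq_2)

lemma degree_less_if_coeff_0:
  assumes "\<And>k. k \<ge> d \<Longrightarrow> coeff p k = 0" "0 < d"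
  shows "degree p < d"
  using assms by (metis leading_coeff_0_iff degree_0 not_le)

section \<open>Adjugates\<close>

text \<open>
  The indices are exchanged, so that \<open>adj M\<close> is the adjugate and not the cofactor matrix.
\<close>

definition adj :: "'a :: comm_ring_1 mat \<Rightarrow> nat \<Rightarrow> nat \<Rightarrow> 'a" where
  "adj M i j = cofactor M j i"

lemma adj_right:
  assumes M: "M \<in> carrier_mat n n" and "i < n" "j < n"
  shows "(\<Sum>k<n. M $$ (i, k) * adj M k j) = (if i = j then det M else 0)"
proof -
  have "(M * adj_mat M) $$ (i, j) = (\<Sum>k<n. M $$ (i, k) * adj M k j)"
    using assms adj_mat(1)[OF M]
    by (auto simp: scalar_prod_def adj_def adj_mat_def atLeast0LessThan intro!: sum.cong)
  then show ?thesis
    using adj_mat(2)[OF M] assms by auto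
qed

lemma adj_left:
  assumes M: "M \<in> carrier_mat n n" and "i < n" "j < n"
  shows "(\<Sum>k<n. adj M i k * M $$ (k, j)) = (if i = j then det M else 0)"
proof -
  have "(adj_mat M * M) $$ (i, j) = (\<Sum>k<n. adj M i k * M $$ (k, j))"
    using assms adj_mat(1)[OF M]
    by (auto simp: scalar_prod_def adj_def adj_mat_def atLeast0LessThan intro!: sum.cong)
  then show ?thesis
    using adj_mat(3)[OF M] assms by auto
qed

lemma adj_symmetric:
  assumes M: "M \<in> carrier_mat n n" and sym: "\<And>i j. i < n \<Longrightarrow> j < n \<Longrightarrow> M $$ (i, j) = M $$ (j, i)"
    and ij: "i < n" "j < n"
  shows "adj M i j = adj M j i"
proof -
  have "mat_delete M j i = transpose_mat (mat_delete M i j)"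
    using M ij by (auto intro!: eq_matI sym simp: mat_delete_def)
  moreover have "mat_delete M i j \<in> carrier_mat (n - 1) (n - 1)"
    by (rule mat_delete_carrier[OF M])
  ultimately show ?thesis
    by (simp add: adj_def cofactor_def det_transpose add.commute)
qed

text \<open>
  Both sides are \<open>adj N * (N * c)\<close>. The lemma is applied to columns \<open>c\<close> for which \<open>N * c\<close> is
  known, mostly because \<open>N\<close> is a small perturbation of a matrix with adjugate column \<open>c\<close>.
\<close>

lemma adj_adj:
  assumes N: "N \<in> carrier_mat n n" and "i < n" "l < n"
  shows "(\<Sum>k<n. adj N i k * (\<Sum>p<n. N $$ (k, p) * c p)) = det N * c i"
proof -
  have "(\<Sum>k<n. adj N i k * (\<Sum>p<n. N $$ (k, p) * c p)) =
      (\<Sum>k<n. \<Sum>p<n. adj N i k * N $$ (k, p) * c p)"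
    by (simp add: sum_distrib_left mult.assoc)
  also have "\<dots> = (\<Sum>p<n. (\<Sum>k<n. adj N i k * N $$ (k, p)) * c p)"
    by (subst sum.swap) (simp add: sum_distrib_right)
  also have "\<dots> = (\<Sum>p<n. (if i = p then det N else 0) * c p)"
    using assms by (intro sum.cong) (simp_all add: adj_left[OF N])
  also have "\<dots> = (\<Sum>p<n. if i = p then det N * c p else 0)"
    by (intro sum.cong) auto
  also have "\<dots> = det N * c i"
    using assms by simp
  finally show ?thesis .
qed

definition add_entry :: "'a :: comm_ring_1 mat \<Rightarrow> nat \<Rightarrow> 'a mat" where
  "add_entry M j = mat (dim_row M) (dim_col M) (\<lambda>(k, l). M $$ (k, l) + (if k = j \<and> l = j then 1 else 0))"

lemma det_add_entry:
  assumes M: "M \<in> carrier_mat n n" and j: "j < n"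
  shows "det (add_entry M j) = det M + adj M j j"
proof -
  let ?N = "add_entry M j"
  have N: "?N \<in> carrier_mat n n"
    using M by (simp add: add_entry_def)
  have del: "mat_delete ?N k j = mat_delete M k j" for k
    using M by (auto simp: add_entry_def mat_delete_def intro!: eq_matI)
  have "det ?N = (\<Sum>k<n. ?N $$ (k, j) * cofactor ?N k j)"
    by (rule laplace_expansion_column[OF N j])
  also have "\<dots> = (\<Sum>k<n. M $$ (k, j) * cofactor M k j + (if k = j then cofactor M j j else 0))"
  proof (rule sum.cong)
    fix k assume "k \<in> {..<n}"
    then have "?N $$ (k, j) = M $$ (k, j) + (if k = j then 1 else 0)"
      using M j by (simp add: add_entry_def)
    moreover have "cofactor ?N k j = cofactor M k j"
      by (simp add: cofactor_def del)
    ultimately show "?N $$ (k, j) * cofactor ?N k j =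
        M $$ (k, j) * cofactor M k j + (if k = j then cofactor M j j else 0)"
      by (simp add: distrib_right)
  qed simp
  also have "\<dots> = det M + adj M j j"
    using j by (simp add: sum.distrib laplace_expansion_column[OF M j] adj_def)
  finally show ?thesis .
qed

text \<open>
  Jacobi's identity for \<open>2 \<times> 2\<close> minors of the adjugate, without naming the complementary minor.
  Let \<open>N = M + E\<close>, where \<open>E\<close> has the single entry 1 at \<open>(j, j)\<close>. Then \<open>N * adj M\<close> differs from
  \<open>det M * I\<close> only in row \<open>j\<close>, which is increased by row \<open>j\<close> of \<open>adj M\<close>. Multiplication by
  \<open>adj N\<close> gives linear relations between the entries of \<open>adj N\<close> and \<open>adj M\<close>; the relation in
  column \<open>j\<close> shows \<open>adj N i j = adj M i j\<close>, and then the one in column \<open>i\<close> is the claim with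
  \<open>d = adj N i i - adj M i i\<close>.
\<close>

lemma jacobi_complementary_minor:
  fixes M :: "'a :: idom mat"
  assumes M: "M \<in> carrier_mat n n" and ij: "i < n" "j < n"
    and "det M + adj M j j \<noteq> 0"
  obtains d where "det M * d = adj M i i * adj M j j - adj M i j * adj M j i"
proof (cases "i = j")
  case True
  with that[of 0] show thesis by simp
next
  case False
  let ?N = "add_entry M j"
  have N: "?N \<in> carrier_mat n n"
    using M by (simp add: add_entry_def)
  have det_N: "det ?N = det M + adj M j j"
    by (rule det_add_entry[OF M ij(2)])
  have prod: "(\<Sum>p<n. ?N $$ (k, p) * adj M p l) = (if k = l then det M else 0) + (if k = j then adj M j l else 0)"
    if kl: "k < n" "l < n" for k l
  proof -
    have "(\<Sum>p<n. ?N $$ (k, p) * adj M p l) =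
        (\<Sum>p<n. M $$ (k, p) * adj M p l + (if p = j then (if k = j then adj M j l else 0) else 0))"
      using M kl by (intro sum.cong) (auto simp: add_entry_def distrib_right)
    then show ?thesis
      using kl ij by (simp add: sum.distrib adj_right[OF M])
  qed
  have key: "adj ?N i l * det M + adj ?N i j * adj M j l = (det M + adj M j j) * adj M i l" if l: "l < n" for l
  proof -
    have "(det M + adj M j j) * adj M i l = (\<Sum>k<n. adj ?N i k * (\<Sum>p<n. ?N $$ (k, p) * adj M p l))"
      using adj_adj[OF N ij(1) l, of "\<lambda>p. adj M p l"] by (simp add: det_N)
    also have "\<dots> = (\<Sum>k<n. adj ?N i k * ((if k = l then det M else 0) + (if k = j then adj M j l else 0)))"
      using l by (intro sum.cong) (simp_all add: prod)
    also have "\<dots> = (\<Sum>k<n. (if k = l then adj ?N i l * det M else 0) + (if k = j then adj ?N i j * adj M j l else 0))"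
      by (intro sum.cong) (auto simp: distrib_left)
    also have "\<dots> = adj ?N i l * det M + adj ?N i j * adj M j l"
      using l ij by (simp add: sum.distrib)
    finally show ?thesis by simp
  qed
  have "(det M + adj M j j) * adj ?N i j = (det M + adj M j j) * adj M i j"
    using key[OF ij(2)] by (simp add: algebra_simps)
  then have "adj ?N i j = adj M i j"
    using assms(4) by simp
  then have "det M * (adj ?N i i - adj M i i) = adj M i i * adj M j j - adj M i j * adj M j i"
    using key[OF ij(1)] by (simp add: algebra_simps)
  then show thesis by (rule that)
qed

definition add_ones :: "'a :: comm_ring_1 mat \<Rightarrow> 'a mat" where
  "add_ones M = mat (dim_row M) (dim_col M) (\<lambda>(k, l). M $$ (k, l) + 1)"

definition add_ones_rows :: "nat \<Rightarrow> 'a :: comm_ring_1 mat \<Rightarrow> 'a mat" where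
  "add_ones_rows k M = mat (dim_row M) (dim_col M) (\<lambda>(i, l). M $$ (i, l) + (if i < k then 1 else 0))"

text \<open>
  The sum of the cofactors along row \<open>k\<close> is the determinant after row \<open>k\<close> is replaced by ones,
  and adding a row of ones to other rows does not change that determinant.
\<close>

lemma sum_cofactor_add_ones_rows:
  assumes M: "M \<in> carrier_mat n n" and k: "k < n"
  shows "(\<Sum>l<n. cofactor (add_ones_rows k M) k l) = (\<Sum>l<n. cofactor M k l)"
proof -
  define ones where "ones B = mat n n (\<lambda>(i, l). if i = k then 1 else B $$ (i, l))" for B :: "'a mat"
  have det_ones: "det (ones B) = (\<Sum>l<n. cofactor B k l)" if B: "B \<in> carrier_mat n n" for B
  proof -
    have del: "mat_delete (ones B) k l = mat_delete B k l" for l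
      using B k by (auto simp: ones_def mat_delete_def intro!: eq_matI)
    have "ones B \<in> carrier_mat n n"
      by (simp add: ones_def)
    then have "det (ones B) = (\<Sum>l<n. ones B $$ (k, l) * cofactor (ones B) k l)"
      by (rule laplace_expansion_row) (rule k)
    also have "\<dots> = (\<Sum>l<n. cofactor B k l)"
    proof (rule sum.cong)
      fix l assume "l \<in> {..<n}"
      then have "ones B $$ (k, l) = 1"
        using k by (simp add: ones_def)
      then show "ones B $$ (k, l) * cofactor (ones B) k l = cofactor B k l"
        by (simp add: cofactor_def del)
    qed simp
    finally show ?thesis .
  qed
  \<comment> \<open>Adding the \<open>k\<close>-th row, which consists of ones, to the rows above it.\<close>
  define T where "T = mat n n (\<lambda>(i, l). if i = l then 1 else if i < k \<and> l = k then 1 else (0 :: 'a))"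
  have T: "T \<in> carrier_mat n n"
    by (simp add: T_def)
  have "det T = prod_list (diag_mat T)"
    by (rule det_upper_triangular[OF _ T]) (auto simp: T_def)
  also have "diag_mat T = map (\<lambda>i. 1) [0..<n]"
    by (auto simp: diag_mat_def T_def intro!: map_cong)
  also have "prod_list \<dots> = 1"
    by (induction n) simp_all
  finally have det_T: "det T = 1" .
  have "ones (add_ones_rows k M) = T * ones M"
  proof (rule eq_matI)
    fix i l assume "i < dim_row (T * ones M)" "l < dim_col (T * ones M)"
    then have il: "i < n" "l < n"
      by (simp_all add: T_def ones_def)
    have "(T * ones M) $$ (i, l) = (\<Sum>p<n. T $$ (i, p) * ones M $$ (p, l))"
      using il T by (auto simp: scalar_prod_def ones_def atLeast0LessThan intro!: sum.cong)
    also have "\<dots> = (\<Sum>p<n. (if p = i then ones M $$ (i, l) else 0) + (if p = k then (if i < k then 1 else 0) else 0))"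
      using il k by (intro sum.cong) (auto simp: T_def ones_def)
    also have "\<dots> = ones M $$ (i, l) + (if i < k then 1 else 0)"
      using il k by (simp add: sum.distrib)
    also have "\<dots> = ones (add_ones_rows k M) $$ (i, l)"
      using il M by (auto simp: ones_def add_ones_rows_def)
    finally show "ones (add_ones_rows k M) $$ (i, l) = (T * ones M) $$ (i, l)" ..
  qed (simp_all add: ones_def T_def)
  then have "det (ones (add_ones_rows k M)) = det (ones M)"
    using det_mult[OF T, of "ones M"] det_T by (simp add: ones_def)
  moreover have "add_ones_rows k M \<in> carrier_mat n n"
    using M by (simp add: add_ones_rows_def)
  ultimately show ?thesis
    using M by (simp add: det_ones)
qed

text \<open>
  The ones are added row by row; each row contributes the sum of its cofactors.
\<close>

lemma det_add_ones:
  assumes M: "M \<in> carrier_mat n n"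
  shows "det (add_ones M) = det M + (\<Sum>i<n. \<Sum>j<n. adj M i j)"
proof -
  have C: "add_ones_rows k M \<in> carrier_mat n n" for k
    using M by (simp add: add_ones_rows_def)
  have "det (add_ones_rows k M) = det M + (\<Sum>i<k. \<Sum>j<n. cofactor M i j)" if "k \<le> n" for k
    using that
  proof (induction k)
    case 0
    have "add_ones_rows 0 M = M"
      using M by (auto simp: add_ones_rows_def)
    then show ?case by simp
  next
    case (Suc k)
    have k: "k < n" using Suc by simp
    let ?B = "add_ones_rows k M" and ?B' = "add_ones_rows (Suc k) M"
    have del: "mat_delete ?B' k l = mat_delete ?B k l" for l
      using M k by (auto simp: add_ones_rows_def mat_delete_def intro!: eq_matI)
    have "det ?B' = (\<Sum>l<n. ?B' $$ (k, l) * cofactor ?B' k l)"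
      by (rule laplace_expansion_row[OF C k])
    also have "\<dots> = (\<Sum>l<n. ?B $$ (k, l) * cofactor ?B k l + cofactor ?B k l)"
    proof (rule sum.cong)
      fix l assume "l \<in> {..<n}"
      then have "?B' $$ (k, l) = ?B $$ (k, l) + 1"
        using M k by (simp add: add_ones_rows_def)
      moreover have "cofactor ?B' k l = cofactor ?B k l"
        by (simp add: cofactor_def del)
      ultimately show "?B' $$ (k, l) * cofactor ?B' k l = ?B $$ (k, l) * cofactor ?B k l + cofactor ?B k l"
        by (simp add: distrib_right)
    qed simp
    also have "\<dots> = det ?B + (\<Sum>l<n. cofactor M k l)"
      by (simp add: sum.distrib laplace_expansion_row[OF C k] sum_cofactor_add_ones_rows[OF M k])
    finally show ?case
      using Suc by simp
  qed
  from this[of n] have "det (add_ones_rows n M) = det M + (\<Sum>i<n. \<Sum>j<n. adj M j i)"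
    by (simp add: adj_def)
  moreover have "add_ones_rows n M = add_ones M"
    using M by (auto simp: add_ones_rows_def add_ones_def)
  ultimately show ?thesis
    by (subst sum.swap) simp
qed

text \<open>
  With \<open>N = M + J\<close> one has \<open>N * adj M = det M * I + 1 r\<^sup>T\<close>, where \<open>r\<close> is the vector of row sums of
  \<open>adj M\<close>. Multiplication by \<open>adj N\<close> gives the claim with the row sums of \<open>adj N\<close> in place of
  those of \<open>adj M\<close>; summing over the columns shows that the two row sums agree.
\<close>

lemma adj_add_ones:
  fixes M :: "'a :: idom mat"
  assumes M: "M \<in> carrier_mat n n"
    and sym: "\<And>i j. i < n \<Longrightarrow> j < n \<Longrightarrow> M $$ (i, j) = M $$ (j, i)"
    and "det (add_ones M) \<noteq> 0" and ij: "i < n" "j < n"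
  shows "det M * adj (add_ones M) i j =
    det (add_ones M) * adj M i j - (\<Sum>k<n. adj M i k) * (\<Sum>k<n. adj M j k)"
proof -
  let ?N = "add_ones M"
  define row where "row l = (\<Sum>k<n. adj M l k)" for l
  have row': "(\<Sum>k<n. adj M k l) = row l" if "l < n" for l
    unfolding row_def using adj_symmetric[OF M sym] that by (intro sum.cong) simp_all
  have N: "?N \<in> carrier_mat n n"
    using M by (simp add: add_ones_def)
  have prod: "(\<Sum>p<n. ?N $$ (k, p) * adj M p l) = (if k = l then det M else 0) + row l"
    if kl: "k < n" "l < n" for k l
  proof -
    have "(\<Sum>p<n. ?N $$ (k, p) * adj M p l) = (\<Sum>p<n. M $$ (k, p) * adj M p l + adj M p l)"
      using M kl by (intro sum.cong) (auto simp: add_ones_def distrib_right)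
    then show ?thesis
      using kl by (simp add: sum.distrib adj_right[OF M] row')
  qed
  have key: "det M * adj ?N i l + (\<Sum>k<n. adj ?N i k) * row l = det ?N * adj M i l" if l: "l < n" for l
  proof -
    have "det ?N * adj M i l = (\<Sum>k<n. adj ?N i k * (\<Sum>p<n. ?N $$ (k, p) * adj M p l))"
      using adj_adj[OF N ij(1) l, of "\<lambda>p. adj M p l"] by simp
    also have "\<dots> = (\<Sum>k<n. (if k = l then det M * adj ?N i l else 0) + adj ?N i k * row l)"
      using l by (intro sum.cong) (auto simp: prod distrib_left)
    also have "\<dots> = det M * adj ?N i l + (\<Sum>k<n. adj ?N i k) * row l"
      using l by (simp add: sum.distrib sum_distrib_right)
    finally show ?thesis by simp
  qed
  have "(\<Sum>l<n. det M * adj ?N i l + (\<Sum>k<n. adj ?N i k) * row l) = (\<Sum>l<n. det ?N * adj M i l)"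
    by (intro sum.cong) (simp_all add: key)
  then have "(\<Sum>k<n. adj ?N i k) * (det M + (\<Sum>l<n. row l)) = det ?N * row i"
    by (simp add: sum.distrib row_def[of i] algebra_simps flip: sum_distrib_left sum_distrib_right)
  then have "(\<Sum>k<n. adj ?N i k) * det ?N = row i * det ?N"
    by (simp add: det_add_ones[OF M] row_def mult.commute)
  then have "(\<Sum>k<n. adj ?N i k) = row i"
    using assms(3) by simp
  then show ?thesis
    using key[OF ij(2)] by (simp add: row_def algebra_simps)
qed

section \<open>Reduction of integer polynomials modulo 2\<close>

definition red :: "int poly \<Rightarrow> bit poly" where
  "red p = map_poly of_int p"

lemma of_int_bit: "(of_int a :: bit) = of_bool (odd a)"
proof (cases "even a")
  case True
  then show ?thesis by (auto elim!: evenE)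
next
  case False
  then show ?thesis by (auto elim!: oddE)
qed

lemma coeff_red: "coeff (red p) k = of_bool (odd (coeff p k))"
  by (simp add: red_def coeff_map_poly of_int_bit)

lemma red_add [simp]: "red (p + q) = red p + red q"
  by (simp add: red_def of_int_poly_hom.hom_add)

lemma red_mult [simp]: "red (p * q) = red p * red q"
  by (simp add: red_def of_int_poly_hom.hom_mult)

lemma red_0 [simp]: "red 0 = 0"
  by (simp add: red_def)

lemma red_1 [simp]: "red 1 = 1"
  by (simp add: red_def)

lemma red_diff [simp]: "red (p - q) = red p + red q"
  by (rule poly_eqI) (auto simp: coeff_red)

lemma red_sum [simp]: "red (\<Sum>i\<in>I. p i) = (\<Sum>i\<in>I. red (p i))"
  by (induction I rule: infinite_finite_induct) simp_all

lemma red_power [simp]: "red (p ^ k) = red p ^ k"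
  by (induction k) simp_all

lemma red_two [simp]: "red 2 = 0"
  by (rule poly_eqI) (simp add: coeff_red numeral_poly coeff_pCons split: nat.split)

lemma red_pCons [simp]: "red (pCons a p) = pCons (of_int a) (red p)"
  by (rule poly_eqI) (simp add: coeff_red coeff_pCons of_int_bit split: nat.split)

lemma red_smult [simp]: "red (smult a p) = smult (of_int a) (red p)"
  by (rule poly_eqI) (simp add: coeff_red of_int_bit)

lemma red_pderiv: "red (pderiv p) = pderiv (red p)"
  by (rule poly_eqI) (simp add: coeff_red coeff_pderiv of_nat_bit del: of_nat_Suc)

lemma two_mult_poly: "2 * p = smult 2 (p :: int poly)"
  by (simp add: numeral_poly)

lemma red_eq_iff: "red p = red q \<longleftrightarrow> (\<exists>g. p = q + 2 * g)"
proof
  assume eq: "red p = red q"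
  have "\<exists>g. p - q = smult 2 g"
  proof -
    have "2 dvd coeff (p - q) k" for k
      using arg_cong[OF eq, of "\<lambda>t. coeff t k"] by (auto simp: coeff_red of_bool_def split: if_splits)
    then have "[:2:] dvd p - q"
      by (simp add: const_poly_dvd_iff)
    then show ?thesis
      by (auto elim!: dvdE)
  qed
  then show "\<exists>g. p = q + 2 * g"
    by (metis add.commute diff_add_cancel two_mult_poly)
qed auto

lemma degree_red_le: "degree (red p) \<le> degree p"
  by (rule degree_le) (simp add: coeff_red coeff_eq_0)

text \<open>
  A section of \<open>red\<close> that does not raise degrees.
\<close>

definition lift :: "bit poly \<Rightarrow> int poly" where
  "lift p = map_poly (\<lambda>b. of_bool (b = 1)) p"

lemma coeff_lift: "coeff (lift p) k = of_bool (coeff p k = 1)"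
  by (simp add: lift_def coeff_map_poly)

lemma red_lift [simp]: "red (lift p) = p"
  by (rule poly_eqI) (auto simp: coeff_red coeff_lift)

lemma degree_lift: "degree (lift p) \<le> degree p"
  by (rule degree_le) (simp add: coeff_lift coeff_eq_0)

section \<open>Symmetric matrices with zero diagonal\<close>

lemma sum_symmetric:
  fixes u :: "nat \<Rightarrow> nat \<Rightarrow> 'a :: comm_semiring_1"
  assumes "\<And>i j. i < n \<Longrightarrow> j < n \<Longrightarrow> u i j = u j i"
  shows "(\<Sum>i<n. \<Sum>j<n. u i j) = (\<Sum>i<n. u i i) + 2 * (\<Sum>i<n. \<Sum>j<i. u i j)"
  using assms
proof (induction n)
  case (Suc n)
  have "(\<Sum>i<n. u i n) = (\<Sum>j<n. u n j)"
    using Suc.prems by (intro sum.cong) auto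
  then show ?case
    using Suc by (simp add: sum.distrib algebra_simps mult_2)
qed simp

text \<open>
  Adjacency matrices of graphs enter only through these properties, together with the polynomials
  attached to them: \<open>K\<close> is the characteristic matrix and \<open>a\<close> its adjugate, so that \<open>a i i\<close> are the
  polynomials of the deck; \<open>num\<close> is the numerator of the generating function of all walks.
\<close>

locale hollow_symmetric =
  fixes A :: "int mat" and n :: nat
  assumes A: "A \<in> carrier_mat n n"
    and A_sym: "\<And>i j. i < n \<Longrightarrow> j < n \<Longrightarrow> A $$ (i, j) = A $$ (j, i)"
    and A_diag: "\<And>i. i < n \<Longrightarrow> A $$ (i, i) = 0"
begin

definition K :: "int poly mat" where "K = char_poly_matrix A"
definition \<phi> :: "int poly" where "\<phi> = char_poly A"
definition a :: "nat \<Rightarrow> nat \<Rightarrow> int poly" where "a i j = adj K i j"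
definition row :: "nat \<Rightarrow> int poly" where "row i = (\<Sum>j<n. a i j)"
definition num :: "int poly" where "num = (\<Sum>i<n. row i)"

lemma K: "K \<in> carrier_mat n n"
  using A by (simp add: K_def)

lemma det_K: "det K = \<phi>"
  by (simp add: K_def \<phi>_def char_poly_def)

lemma K_index: "i < n \<Longrightarrow> j < n \<Longrightarrow> K $$ (i, j) = (if i = j then [:0, 1:] else 0) - [:A $$ (i, j):]"
  using A by (simp add: K_def char_poly_matrix_def)

lemma K_sym: "i < n \<Longrightarrow> j < n \<Longrightarrow> K $$ (i, j) = K $$ (j, i)"
  by (simp add: K_index A_sym)

lemma K_apply:
  assumes "i < n"
  shows "(\<Sum>k<n. K $$ (i, k) * v k) = pCons 0 (v i) - (\<Sum>k<n. smult (A $$ (i, k)) (v k))"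
proof -
  have "(\<Sum>k<n. K $$ (i, k) * v k) =
      (\<Sum>k<n. (if k = i then pCons 0 (v i) else 0) - smult (A $$ (i, k)) (v k))"
    using assms by (intro sum.cong) (auto simp: K_index algebra_simps)
  then show ?thesis
    using assms by (simp add: sum_subtractf)
qed

lemma a_sym: "i < n \<Longrightarrow> j < n \<Longrightarrow> a i j = a j i"
  unfolding a_def by (rule adj_symmetric[OF K K_sym])

lemma sum_a_left: "j < n \<Longrightarrow> (\<Sum>i<n. a i j) = row j"
  unfolding row_def by (intro sum.cong) (auto simp: a_sym)

lemma K_a: "i < n \<Longrightarrow> j < n \<Longrightarrow> (\<Sum>k<n. K $$ (i, k) * a k j) = (if i = j then \<phi> else 0)"
  unfolding a_def by (simp add: adj_right[OF K] det_K)

lemma a_rec: "i < n \<Longrightarrow> j < n \<Longrightarrow>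
    pCons 0 (a i j) = (\<Sum>k<n. smult (A $$ (i, k)) (a k j)) + (if i = j then \<phi> else 0)"
  using K_a[of i j] K_apply[of i "\<lambda>k. a k j"] by (simp add: algebra_simps)

lemma row_rec:
  assumes i: "i < n"
  shows "pCons 0 (row i) = (\<Sum>k<n. smult (A $$ (i, k)) (row k)) + \<phi>"
proof -
  have pC: "pCons 0 (\<Sum>j\<in>J. f j) = (\<Sum>j\<in>J. pCons 0 (f j))" for f :: "nat \<Rightarrow> int poly" and J
  proof (induction J rule: infinite_finite_induct)
    case (insert x F)
    then show ?case
      using add_pCons[of 0 "f x" 0 "sum f F"] by simp
  qed simp_all
  have "pCons 0 (row i) = (\<Sum>j<n. (\<Sum>k<n. smult (A $$ (i, k)) (a k j)) + (if i = j then \<phi> else 0))"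
    unfolding row_def pC using i by (intro sum.cong) (simp_all add: a_rec)
  also have "\<dots> = (\<Sum>j<n. \<Sum>k<n. smult (A $$ (i, k)) (a k j)) + \<phi>"
    using i by (simp add: sum.distrib)
  also have "(\<Sum>j<n. \<Sum>k<n. smult (A $$ (i, k)) (a k j)) = (\<Sum>k<n. smult (A $$ (i, k)) (row k))"
    by (subst sum.swap) (simp add: row_def smult_sum2)
  finally show ?thesis .
qed

lemma a_diag: "i < n \<Longrightarrow> a i i = char_poly (mat_delete A i i)"
proof -
  assume i: "i < n"
  have "mat_delete K i i = char_poly_matrix (mat_delete A i i)"
    using A i by (auto simp: K_def char_poly_matrix_def mat_delete_def intro!: eq_matI)
  then show ?thesis
    by (simp add: a_def adj_def cofactor_def char_poly_def)
qed

lemma degree_\<phi>: "degree \<phi> = n" and lead_\<phi>: "coeff \<phi> n = 1"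
  using degree_monic_char_poly[OF A] by (simp_all add: \<phi>_def)

lemma \<phi>_neq_0: "\<phi> \<noteq> 0"
  using lead_\<phi> by auto

lemma degree_a_diag: "i < n \<Longrightarrow> degree (a i i) = n - 1"
  and lead_a_diag: "i < n \<Longrightarrow> coeff (a i i) (n - 1) = 1"
  using degree_monic_char_poly[of "mat_delete A i i" "n - 1"] mat_delete_carrier[OF A, of i i]
  by (simp_all add: a_diag)

lemma degree_a: "i < n \<Longrightarrow> j < n \<Longrightarrow> degree (a i j) \<le> n - 1"
proof -
  assume ij: "i < n" "j < n"
  have D: "mat_delete K j i \<in> carrier_mat (n - 1) (n - 1)"
    by (rule mat_delete_carrier[OF K])
  have "degree (det (mat_delete K j i)) \<le> 1 * (n - 1)"
  proof (rule degree_det_le[OF _ D])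
    fix k l assume "k < n - 1" "l < n - 1"
    then show "degree (mat_delete K j i $$ (k, l)) \<le> 1"
      using K ij by (simp add: mat_delete_def K_index degree_diff_le)
  qed
  then show ?thesis
    by (simp add: a_def adj_def cofactor_def degree_mult_le minus_one_power_iff)
qed

text \<open>
  By \<open>a_rec\<close>, \<open>x\<close> times the entry is a sum of multiples of entries, of degree less than \<open>n\<close>.
\<close>

lemma degree_a_off_diag:
  assumes "i < n" "j < n" "i \<noteq> j"
  shows "coeff (a i j) (n - 1) = 0"
proof -
  have "coeff (a i j) (n - 1) = coeff (pCons 0 (a i j)) n"
    using assms by (cases n) simp_all
  also have "\<dots> = coeff (\<Sum>k<n. smult (A $$ (i, k)) (a k j)) n"
    using assms by (simp add: a_rec)
  also have "\<dots> = 0"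
  proof -
    have "coeff (a k j) n = 0" if "k < n" for k
      using degree_a[of k j] assms that by (intro coeff_eq_0) simp
    then show ?thesis
      by (simp add: coeff_sum)
  qed
  finally show ?thesis .
qed

lemma sum_a_diag: "(\<Sum>i<n. a i i) = pderiv \<phi>"
  using pderiv_char_poly[OF A] by (simp add: \<phi>_def a_diag)

text \<open>
  Differentiating \<open>K * adj K = \<phi> * I\<close> and multiplying by \<open>adj K\<close> from the left gives
  \<open>(adj K)\<^sup>2 + \<phi> * (adj K)' = \<phi>' * adj K\<close>. The claim is the trace of this equation, since the trace
  of \<open>adj K\<close> is \<open>\<phi>'\<close>.
\<close>

lemma sum_a_square: "(\<Sum>i<n. \<Sum>j<n. (a i j)\<^sup>2) = (pderiv \<phi>)\<^sup>2 - \<phi> * pderiv (pderiv \<phi>)"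
proof -
  have rec: "(\<Sum>k<n. K $$ (i, k) * pderiv (a k j)) = (if i = j then pderiv \<phi> else 0) - a i j"
    if "i < n" "j < n" for i j
  proof -
    have "pderiv (pCons 0 (a i j)) = pderiv ((\<Sum>k<n. smult (A $$ (i, k)) (a k j)) + (if i = j then \<phi> else 0))"
      using that by (simp only: a_rec)
    then have "a i j + pCons 0 (pderiv (a i j)) =
        (\<Sum>k<n. smult (A $$ (i, k)) (pderiv (a k j))) + (if i = j then pderiv \<phi> else 0)"
      by (simp add: pderiv_pCons pderiv_add pderiv_sum pderiv_smult split: if_splits)
    then show ?thesis
      using that by (simp only: K_apply)
  qed
  have diag: "\<phi> * pderiv (a j j) = a j j * pderiv \<phi> - (\<Sum>i<n. (a j i)\<^sup>2)" if j: "j < n" for j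
  proof -
    have "\<phi> * pderiv (a j j) = (\<Sum>i<n. a j i * (\<Sum>k<n. K $$ (i, k) * pderiv (a k j)))"
      using adj_adj[OF K j j, of "\<lambda>k. pderiv (a k j)"] by (simp add: a_def det_K)
    also have "\<dots> = (\<Sum>i<n. a j i * ((if i = j then pderiv \<phi> else 0) - a i j))"
      using j by (intro sum.cong) (simp_all add: rec)
    also have "\<dots> = (\<Sum>i<n. (if i = j then a j j * pderiv \<phi> else 0) - (a j i)\<^sup>2)"
      using j by (intro sum.cong) (auto simp: a_sym algebra_simps power2_eq_square)
    finally show ?thesis
      using j by (simp add: sum_subtractf)
  qed
  have "\<phi> * pderiv (pderiv \<phi>) = (\<Sum>j<n. \<phi> * pderiv (a j j))"
    by (simp add: pderiv_sum sum_distrib_left flip: sum_a_diag)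
  also have "\<dots> = (\<Sum>j<n. a j j * pderiv \<phi> - (\<Sum>i<n. (a j i)\<^sup>2))"
    by (intro sum.cong) (auto simp: diag)
  also have "\<dots> = (pderiv \<phi>)\<^sup>2 - (\<Sum>j<n. \<Sum>i<n. (a j i)\<^sup>2)"
    by (simp add: sum_subtractf power2_eq_square sum_a_diag flip: sum_distrib_right)
  finally show ?thesis by simp
qed

text \<open>
  In the quadratic form of \<open>A\<close> the diagonal terms are zero and the others occur twice.
\<close>

lemma red_quadratic_form:
  "red (\<Sum>i<n. v i * (\<Sum>j<n. K $$ (i, j) * v j)) = X * (\<Sum>i<n. red (v i))\<^sup>2"
proof -
  have "(\<Sum>i<n. \<Sum>j<n. v i * (K $$ (i, j) * v j)) =
      (\<Sum>i<n. v i * (K $$ (i, i) * v i)) + 2 * (\<Sum>i<n. \<Sum>j<i. v i * (K $$ (i, j) * v j))"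
    by (rule sum_symmetric) (simp add: K_sym mult_ac)
  then have "red (\<Sum>i<n. v i * (\<Sum>j<n. K $$ (i, j) * v j)) = red (\<Sum>i<n. v i * (K $$ (i, i) * v i))"
    by (simp add: sum_distrib_left)
  also have "(\<Sum>i<n. v i * (K $$ (i, i) * v i)) = (\<Sum>i<n. [:0, 1:] * (v i)\<^sup>2)"
    by (intro sum.cong) (simp_all add: K_index A_diag power2_eq_square)
  also have "red \<dots> = X * (\<Sum>i<n. red (v i))\<^sup>2"
    by (simp add: X_def bit_poly_square_sum sum_distrib_left)
  finally show ?thesis .
qed

text \<open>
  The quadratic form of \<open>K\<close> at column \<open>j\<close> of its adjugate, which \<open>K\<close> maps to a multiple of a unit
  vector.
\<close>

lemma red_row_square:
  assumes j: "j < n"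
  shows "red \<phi> * red (a j j) = X * (red (row j))\<^sup>2"
proof -
  have "(\<Sum>i<n. a i j * (\<Sum>k<n. K $$ (i, k) * a k j)) = (\<Sum>i<n. if i = j then a j j * \<phi> else 0)"
    using j by (intro sum.cong) (auto simp: K_a)
  also have "\<dots> = \<phi> * a j j"
    using j by simp
  finally have "red (\<phi> * a j j) = X * (\<Sum>i<n. red (a i j))\<^sup>2"
    using red_quadratic_form[of "\<lambda>i. a i j"] by simp
  then show ?thesis
    using j by (simp flip: red_sum add: sum_a_left)
qed

lemma num_eq: "num = pderiv \<phi> + 2 * (\<Sum>i<n. \<Sum>j<i. a i j)"
  unfolding num_def row_def using sum_symmetric[of n a] by (simp add: a_sym sum_a_diag)

end

section \<open>Matrices with the same deck and constant terms of equal parity\<close>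

context hollow_symmetric
begin

text \<open>
  Modulo 2 the matrix \<open>A\<close> agrees with the skew-symmetric integer matrix \<open>B\<close> that has the same entries
  above the diagonal, and the characteristic polynomial of \<open>B\<close> is even or odd like \<open>x ^ n\<close>,
  since \<open>- B\<close> is the transpose of \<open>B\<close>.
\<close>

lemma even_coeff_\<phi>:
  assumes "k \<le> n" "odd (n - k)"
  shows "even (coeff \<phi> k)"
proof -
  define B where "B = mat n n (\<lambda>(i, j). if i < j then A $$ (i, j) else - A $$ (i, j))"
  have B: "B \<in> carrier_mat n n"
    by (simp add: B_def)
  have skew: "B $$ (i, j) = - B $$ (j, i)" if "i < n" "j < n" for i j
    using that A_sym[of i j] A_diag[of i] by (auto simp: B_def)
  let ?KB = "char_poly_matrix B"
  have KB: "?KB \<in> carrier_mat n n"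
    using B by simp
  have "map_mat (\<lambda>p. p \<circ>\<^sub>p [:0, - 1:]) ?KB = (- 1) \<cdot>\<^sub>m transpose_mat ?KB"
  proof (rule eq_matI)
    fix i j assume "i < dim_row ((- 1) \<cdot>\<^sub>m transpose_mat ?KB)" "j < dim_col ((- 1) \<cdot>\<^sub>m transpose_mat ?KB)"
    then have ij: "i < n" "j < n"
      using KB by auto
    then show "map_mat (\<lambda>p. p \<circ>\<^sub>p [:0, - 1:]) ?KB $$ (i, j) = ((- 1) \<cdot>\<^sub>m transpose_mat ?KB) $$ (i, j)"
      using B skew[of i j] by (auto simp: char_poly_matrix_def pcompose_pCons)
  qed (use KB in auto)
  then have "char_poly B \<circ>\<^sub>p [:0, - 1:] = (- 1) ^ n * char_poly B"
    using KB det_transpose[OF KB] comm_ring_hom.hom_det[OF pcompose_hom.comm_ring_hom_axioms, of "[:0, - 1:]" ?KB]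
    by (simp add: char_poly_def)
  then have "coeff (char_poly B \<circ>\<^sub>p [:0, - 1:]) k = coeff ((- 1) ^ n * char_poly B) k"
    by simp
  then have zero: "coeff (char_poly B) k = 0"
    using assms by (auto simp: coeff_pcompose_linear minus_one_power_iff split: if_splits)
  have "map_mat of_int A = (map_mat of_int B :: bit mat)"
    using A by (auto simp: B_def of_int_bit intro!: eq_matI)
  moreover have "char_poly (map_mat of_int A :: bit mat) = red \<phi>"
    unfolding red_def \<phi>_def by (rule of_int_hom.char_poly_hom[OF A])
  moreover have "char_poly (map_mat of_int B :: bit mat) = red (char_poly B)"
    unfolding red_def by (rule of_int_hom.char_poly_hom[OF B])
  ultimately have "red \<phi> = red (char_poly B)"
    by simp
  then have "even (coeff \<phi> k) \<longleftrightarrow> even (coeff (char_poly B) k)"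
    by (metis coeff_red of_bool_eq_iff)
  then show ?thesis
    using zero by simp
qed

text \<open>
  The number of walks of length \<open>k\<close> that start at \<open>i\<close>.
\<close>

primrec walks :: "nat \<Rightarrow> nat \<Rightarrow> int" where
  "walks 0 i = 1"
| "walks (Suc k) i = (\<Sum>j<n. A $$ (i, j) * walks k j)"

lemma degree_row: "i < n \<Longrightarrow> degree (row i) \<le> n - 1"
  unfolding row_def by (rule degree_sum_le) (use degree_a in auto)

text \<open>
  The generating function of \<open>walks\<close> is \<open>row i / \<phi>\<close>, expanded at infinity.
\<close>

lemma coeff_row:
  assumes "k < n" "i < n"
  shows "coeff (row i) (n - 1 - k) = (\<Sum>l\<le>k. coeff \<phi> (n - k + l) * walks l i)"
  using assms
proof (induction k arbitrary: i)
  case 0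
  have "coeff (row j) n = 0" if "j < n" for j
    using degree_row[of j] that by (intro coeff_eq_0) simp
  moreover have "coeff (row i) (n - 1) = coeff (pCons 0 (row i)) n"
    using 0 by (cases n) simp_all
  ultimately show ?case
    using 0 by (simp add: row_rec coeff_sum lead_\<phi>)
next
  case (Suc k)
  have *: "n - 1 - k = Suc (n - 1 - Suc k)"
    using Suc.prems by auto
  have "coeff (row i) (n - 1 - Suc k) = coeff (pCons 0 (row i)) (n - 1 - k)"
    unfolding * by simp
  also have "\<dots> = (\<Sum>j<n. A $$ (i, j) * (\<Sum>l\<le>k. coeff \<phi> (n - k + l) * walks l j)) + coeff \<phi> (n - Suc k)"
    using Suc by (simp add: row_rec coeff_sum)
  also have "(\<Sum>j<n. A $$ (i, j) * (\<Sum>l\<le>k. coeff \<phi> (n - k + l) * walks l j)) =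
      (\<Sum>j<n. \<Sum>l\<le>k. coeff \<phi> (n - k + l) * (A $$ (i, j) * walks l j))"
    by (simp add: sum_distrib_left mult_ac)
  also have "\<dots> = (\<Sum>l\<le>k. coeff \<phi> (n - k + l) * walks (Suc l) i)"
    by (subst sum.swap) (simp add: sum_distrib_left)
  also have "\<dots> = (\<Sum>l\<le>k. coeff \<phi> (n - Suc k + Suc l) * walks (Suc l) i)"
    using Suc.prems by (intro sum.cong) (auto simp: Suc_diff_Suc)
  finally show ?case
    by (simp add: sum.atMost_Suc_shift del: walks.simps(2) sum.atMost_Suc)
qed

definition half :: "int poly" where "half = (\<Sum>i<n. \<Sum>j<i. a i j)"

lemma num_half: "num = pderiv \<phi> + 2 * half"
  by (simp add: num_eq half_def)

definition half_square :: "int poly" where "half_square = (\<Sum>i<n. \<Sum>j<i. (a i j)\<^sup>2)"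

lemma red_half_square: "(red half)\<^sup>2 = red half_square"
  by (simp add: half_def half_square_def bit_poly_square_sum)

lemma two_half_square:
  "(\<Sum>i<n. (a i i)\<^sup>2) + 2 * half_square = (pderiv \<phi>)\<^sup>2 - \<phi> * pderiv (pderiv \<phi>)"
  unfolding half_square_def sum_a_square[symmetric]
  by (rule sum_symmetric[symmetric]) (simp add: a_sym)

end

locale same_deck = G: hollow_symmetric A n + H: hollow_symmetric B n
  for A B :: "int mat" and n :: nat +
  assumes deck: "\<And>i. i < n \<Longrightarrow> char_poly (mat_delete A i i) = char_poly (mat_delete B i i)"
begin

lemma a_diag_eq: "i < n \<Longrightarrow> G.a i i = H.a i i"
  by (simp add: G.a_diag H.a_diag deck)

lemma pderiv_\<phi>: "pderiv G.\<phi> = pderiv H.\<phi>"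
  by (simp add: a_diag_eq flip: G.sum_a_diag H.sum_a_diag)

lemma \<phi>_diff: "G.\<phi> = H.\<phi> + [:coeff G.\<phi> 0 - coeff H.\<phi> 0:]"
proof -
  have "pderiv (G.\<phi> - H.\<phi>) = 0"
    by (simp add: pderiv_diff pderiv_\<phi>)
  then have "degree (G.\<phi> - H.\<phi>) = 0"
    by (simp add: pderiv_eq_0_iff)
  then have "G.\<phi> - H.\<phi> = [:coeff (G.\<phi> - H.\<phi>) 0:]"
    by (metis degree_0_id)
  then show ?thesis
    by (simp add: algebra_simps)
qed

context
  assumes parity: "even (coeff G.\<phi> 0 - coeff H.\<phi> 0)"
begin

lemma red_\<phi>: "red G.\<phi> = red H.\<phi>"
  by (subst \<phi>_diff) (use parity in \<open>simp add: of_int_bit\<close>)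

text \<open>
  In \<open>\<phi> * a j j = X * (row j)\<^sup>2\<close> everything but \<open>row j\<close> is the same for \<open>G\<close> and \<open>H\<close>, and square roots
  are unique in characteristic 2.
\<close>

lemma red_row: "i < n \<Longrightarrow> red (G.row i) = red (H.row i)"
  using G.red_row_square[of i] H.red_row_square[of i]
  by (simp add: red_\<phi> a_diag_eq bit_poly_square_eq_iff)

text \<open>
  In \<open>coeff_row\<close> the top summand is \<open>walks k i\<close> itself, because \<open>\<phi>\<close> is monic; the other ones involve
  shorter walks.
\<close>

lemma walks_parity:
  assumes "k < n" "i < n"
  shows "(of_int (G.walks k i) :: bit) = of_int (H.walks k i)"
  using assms
proof (induction k rule: less_induct)
  case (less k)
  have red_coeff: "(of_int (coeff p l) :: bit) = coeff (red p) l" for p l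
    by (simp add: coeff_red of_int_bit)
  have lower: "(of_int (\<Sum>l<k. coeff G.\<phi> (n - k + l) * G.walks l i) :: bit) =
      of_int (\<Sum>l<k. coeff H.\<phi> (n - k + l) * H.walks l i)"
    unfolding of_int_sum of_int_mult red_coeff red_\<phi>
    using less by (intro sum.cong) auto
  have "(\<Sum>l\<le>k. f l) = f k + (\<Sum>l<k. f l)" for f :: "nat \<Rightarrow> int"
    by (simp add: lessThan_Suc_atMost[symmetric] add.commute)
  note split = this
  have "coeff (G.row i) (n - 1 - k) = G.walks k i + (\<Sum>l<k. coeff G.\<phi> (n - k + l) * G.walks l i)"
    "coeff (H.row i) (n - 1 - k) = H.walks k i + (\<Sum>l<k. coeff H.\<phi> (n - k + l) * H.walks l i)"
    using less.prems by (simp_all only: G.coeff_row H.coeff_row split) (simp_all add: G.lead_\<phi> H.lead_\<phi>)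
  moreover have "(of_int (coeff (G.row i) (n - 1 - k)) :: bit) = of_int (coeff (H.row i) (n - 1 - k))"
    by (simp add: red_coeff red_row less.prems)
  ultimately show ?case
    using lower by simp
qed

text \<open>
  The two sums of squares differ by a multiple of the second derivative of \<open>\<phi>\<close>, which is zero
  modulo 2. So they agree modulo 2, and therefore so do the sums \<open>half\<close>.
\<close>

lemma num_cong_4: "\<exists>g. G.num = H.num + 4 * g"
proof -
  obtain \<epsilon> where \<epsilon>: "coeff G.\<phi> 0 - coeff H.\<phi> 0 = 2 * \<epsilon>"
    by (rule evenE[OF parity])
  have "2 * G.half_square = 2 * (H.half_square - smult \<epsilon> (pderiv (pderiv H.\<phi>)))"
  proof -
    have "G.\<phi> = H.\<phi> + 2 * [:\<epsilon>:]"
      using \<phi>_diff \<epsilon> by (simp add: numeral_poly)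
    then have "G.\<phi> * pderiv (pderiv G.\<phi>) =
        H.\<phi> * pderiv (pderiv H.\<phi>) + 2 * smult \<epsilon> (pderiv (pderiv H.\<phi>))"
      by (subst pderiv_\<phi>) (simp add: algebra_simps)
    moreover have "(\<Sum>i<n. (G.a i i)\<^sup>2) = (\<Sum>i<n. (H.a i i)\<^sup>2)"
      by (simp add: a_diag_eq)
    ultimately show ?thesis
      using G.two_half_square H.two_half_square by (simp add: pderiv_\<phi> algebra_simps)
  qed
  then have "G.half_square = H.half_square - smult \<epsilon> (pderiv (pderiv H.\<phi>))"
    by (simp only: mult_cancel_left) simp
  then have "red G.half_square = red H.half_square"
    by (simp add: red_pderiv)
  then have "red G.half = red H.half"
    by (simp add: bit_poly_square_eq_iff flip: G.red_half_square H.red_half_square)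
  then obtain g where "G.half = H.half + 2 * g"
    by (auto simp: red_eq_iff)
  then have "G.num = H.num + 4 * g"
    by (simp add: G.num_half H.num_half pderiv_\<phi>)
  then show ?thesis ..
qed

end

end

section \<open>The adjugate modulo 2 in even dimension\<close>

definition mat_apply :: "nat \<Rightarrow> (nat \<Rightarrow> nat \<Rightarrow> bit) \<Rightarrow> (nat \<Rightarrow> bit poly) \<Rightarrow> nat \<Rightarrow> bit poly" where
  "mat_apply n A v i = (\<Sum>j<n. smult (A i j) (v j))"

text \<open>
  The formulas below for sums of products come from this symmetry, with \<open>u\<close> and \<open>v\<close> chosen among the vectors
  whose image under \<open>A\<close> is known.
\<close>

lemma mat_apply_adjoint:
  assumes "\<And>i j. i < n \<Longrightarrow> j < n \<Longrightarrow> A i j = A j i"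
  shows "(\<Sum>i<n. u i * mat_apply n A v i) = (\<Sum>i<n. v i * mat_apply n A u i)"
proof -
  have "(\<Sum>i<n. u i * mat_apply n A v i) = (\<Sum>i<n. \<Sum>j<n. smult (A i j) (u i * v j))"
    by (simp add: mat_apply_def sum_distrib_left)
  also have "\<dots> = (\<Sum>j<n. \<Sum>i<n. smult (A i j) (u i * v j))"
    by (rule sum.swap)
  also have "\<dots> = (\<Sum>i<n. v i * mat_apply n A u i)"
    using assms by (simp add: mat_apply_def sum_distrib_left mult.commute)
  finally show ?thesis .
qed

text \<open>
  The entries of \<open>A\<close> are bits and hence equal to their squares.
\<close>

lemma mat_apply_square: "(mat_apply n A v i)\<^sup>2 = mat_apply n A (\<lambda>j. (v j)\<^sup>2) i"
  by (simp add: mat_apply_def bit_poly_square_sum smult_square_bit)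

lemma pderiv_mat_apply: "pderiv (mat_apply n A v i) = mat_apply n A (\<lambda>j. pderiv (v j)) i"
  by (simp add: mat_apply_def pderiv_sum pderiv_smult)

text \<open>
  What is left of a graph with \<open>n = 2 * m\<close> vertices. As explained at the beginning, \<open>q\<close>, \<open>r\<close> and \<open>s\<close>
  describe the adjugate of \<open>K\<close> modulo 2, and \<open>g\<close>, \<open>h\<close> and \<open>f\<close> are the second binary digits of
  \<open>\<phi>\<close>, \<open>num\<close> and the diagonal entries \<open>a i i\<close>.
  The assumptions on \<open>mat_apply n A\<close> express \<open>K * adj K = \<phi> * I\<close> and its row sums; the sums over \<open>r\<close> and \<open>s\<close> express that the row sums
  of \<open>adj K\<close> are \<open>q * r i\<close> and that \<open>num\<close> is even. Assumption \<open>jacobi\<close> is the difference of Jacobi's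
  identities modulo 4 for \<open>K\<close> and \<open>K + J\<close>; assumption \<open>num\<close> is the diagonal case of the formula for
  the adjugate of \<open>K + J\<close>, modulo 4.
\<close>

locale reduced_graph =
  fixes n m :: nat and A :: "nat \<Rightarrow> nat \<Rightarrow> bit" and q g h :: "bit poly"
    and r f :: "nat \<Rightarrow> bit poly" and s :: "nat \<Rightarrow> nat \<Rightarrow> bit poly"
  assumes m: "2 \<le> m"
    and A_sym: "\<And>i j. i < n \<Longrightarrow> j < n \<Longrightarrow> A i j = A j i"
    and s_sym: "\<And>i j. i < n \<Longrightarrow> j < n \<Longrightarrow> s i j = s j i"
    and deg_q: "degree q = m" and lead_q: "coeff q m = 1"
    and deg_r: "\<And>i. i < n \<Longrightarrow> degree (r i) < m"
    and lead_r: "\<And>i. i < n \<Longrightarrow> coeff (r i) (m - 1) = 1"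
    and deg_g: "degree g < 2 * m" and deg_h: "degree h < 2 * m"
    and deg_f: "\<And>i. i < n \<Longrightarrow> degree (f i) < 2 * m - 1"
    and lead_f: "\<And>i. i < n \<Longrightarrow> coeff (f i) (2 * m - 2) = coeff (r i) (m - 2)"
    and apply_r: "\<And>i. i < n \<Longrightarrow> mat_apply n A r i = X * r i + q"
    and sum_r: "(\<Sum>i<n. r i) = 0"
    and apply_s: "\<And>i j. i < n \<Longrightarrow> j < n \<Longrightarrow>
      mat_apply n A (\<lambda>k. s k j) i = X * r j + X * s i j + (if i = j then q else 0)"
    and sum_s: "\<And>i. i < n \<Longrightarrow> (\<Sum>j<n. s i j) = r i"
    and jacobi: "\<And>i j. i < n \<Longrightarrow> j < n \<Longrightarrow>
      q\<^sup>2 dvd f i * (r j)\<^sup>2 + f j * (r i)\<^sup>2 + h * (s i j)\<^sup>2 + q * r i * r j * s i j"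
    and num: "\<And>i. i < n \<Longrightarrow> q\<^sup>2 dvd (r i)\<^sup>2 * (g + X * h)"
begin

lemma sum_s': "j < n \<Longrightarrow> (\<Sum>i<n. s i j) = r j"
  using sum_s[of j] s_sym by (metis (no_types, lifting) lessThan_iff sum.cong)

lemma sum_r_square: "(\<Sum>i<n. (r i)\<^sup>2) = 0"
  using sum_r by (simp flip: bit_poly_square_sum)

lemma apply_r_square: "i < n \<Longrightarrow> mat_apply n A (\<lambda>j. (r j)\<^sup>2) i = X\<^sup>2 * (r i)\<^sup>2 + q\<^sup>2"
  by (simp add: apply_r bit_poly_square_add power_mult_distrib flip: mat_apply_square)

lemma apply_s_square:
  "i < n \<Longrightarrow> j < n \<Longrightarrow> mat_apply n A (\<lambda>k. (s k j)\<^sup>2) i =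
     X\<^sup>2 * (r j)\<^sup>2 + X\<^sup>2 * (s i j)\<^sup>2 + (if i = j then q\<^sup>2 else 0)"
  by (simp add: apply_s bit_poly_square_add power_mult_distrib flip: mat_apply_square)

text \<open>
  Pairing \<open>(r i)\<^sup>2\<close> with \<open>A r\<close> yields the factor \<open>X\<close>, and pairing \<open>r i\<close> with \<open>A r\<^sup>2\<close> the factor \<open>X\<^sup>2\<close>.
  The next two lemmas come from the same trick.
\<close>

lemma sum_r_cube: "(\<Sum>i<n. (r i)^3) = 0"
proof -
  have "(\<Sum>i<n. (r i)\<^sup>2 * mat_apply n A r i) = (\<Sum>i<n. r i * mat_apply n A (\<lambda>j. (r j)\<^sup>2) i)"
    by (rule mat_apply_adjoint) (rule A_sym)
  moreover have "(\<Sum>i<n. (r i)\<^sup>2 * mat_apply n A r i) = X * (\<Sum>i<n. (r i)^3)"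
  proof -
    have "(\<Sum>i<n. (r i)\<^sup>2 * mat_apply n A r i) = (\<Sum>i<n. X * (r i)^3 + q * (r i)\<^sup>2)"
      by (rule sum.cong) (simp_all add: apply_r algebra_simps power2_eq_square power3_eq_cube)
    then show ?thesis
      by (simp add: sum.distrib sum_r_square flip: sum_distrib_left)
  qed
  moreover have "(\<Sum>i<n. r i * mat_apply n A (\<lambda>j. (r j)\<^sup>2) i) = X\<^sup>2 * (\<Sum>i<n. (r i)^3)"
  proof -
    have "(\<Sum>i<n. r i * mat_apply n A (\<lambda>j. (r j)\<^sup>2) i) = (\<Sum>i<n. X\<^sup>2 * (r i)^3 + q\<^sup>2 * r i)"
      by (rule sum.cong)
         (simp_all add: apply_r_square, simp_all add: distrib_left power2_eq_square power3_eq_cube mult_ac)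
    then show ?thesis
      by (simp add: sum.distrib sum_r flip: sum_distrib_left)
  qed
  ultimately have "X * (\<Sum>i<n. (r i)^3) = X\<^sup>2 * (\<Sum>i<n. (r i)^3)"
    by simp
  then have "(X + X\<^sup>2) * (\<Sum>i<n. (r i)^3) = 0"
    by (simp only: distrib_right bit_poly_add_self)
  then show ?thesis
    using X_plus_X_square by simp
qed

lemma sum_r_square_s:
  assumes j: "j < n"
  shows "(X + X\<^sup>2) * (\<Sum>i<n. (r i)\<^sup>2 * s i j) = q * (r j)\<^sup>2 + q\<^sup>2 * r j"
proof -
  have "(\<Sum>i<n. (r i)\<^sup>2 * mat_apply n A (\<lambda>k. s k j) i) =
      (\<Sum>i<n. s i j * mat_apply n A (\<lambda>j. (r j)\<^sup>2) i)"
    by (rule mat_apply_adjoint) (rule A_sym)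
  moreover have "(\<Sum>i<n. (r i)\<^sup>2 * mat_apply n A (\<lambda>k. s k j) i) =
      X * (\<Sum>i<n. (r i)\<^sup>2 * s i j) + q * (r j)\<^sup>2"
  proof -
    have "(\<Sum>i<n. (r i)\<^sup>2 * mat_apply n A (\<lambda>k. s k j) i) =
      (\<Sum>i<n. X * r j * (r i)\<^sup>2 + X * ((r i)\<^sup>2 * s i j) + (if i = j then q * (r j)\<^sup>2 else 0))"
      using j by (intro sum.cong) (simp_all add: apply_s algebra_simps)
    then show ?thesis
      using j by (simp add: sum.distrib sum_r_square flip: sum_distrib_left)
  qed
  moreover have "(\<Sum>i<n. s i j * mat_apply n A (\<lambda>j. (r j)\<^sup>2) i) =
      X\<^sup>2 * (\<Sum>i<n. (r i)\<^sup>2 * s i j) + q\<^sup>2 * r j"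
  proof -
    have "(\<Sum>i<n. s i j * mat_apply n A (\<lambda>j. (r j)\<^sup>2) i) =
      (\<Sum>i<n. X\<^sup>2 * ((r i)\<^sup>2 * s i j) + q\<^sup>2 * s i j)"
      using j by (intro sum.cong) (simp_all add: apply_r_square algebra_simps)
    then show ?thesis
      using j by (simp add: sum.distrib sum_s' flip: sum_distrib_left)
  qed
  ultimately show ?thesis
    by (smt (verit) add.commute add.left_commute bit_poly_add_cancel distrib_right)
qed

lemma sum_r_s_square:
  assumes j: "j < n"
  shows "(X + X\<^sup>2) * (\<Sum>i<n. r i * (s i j)\<^sup>2) = q * (r j)\<^sup>2 + q\<^sup>2 * r j"
proof -
  have "(\<Sum>i<n. r i * mat_apply n A (\<lambda>k. (s k j)\<^sup>2) i) = (\<Sum>i<n. (s i j)\<^sup>2 * mat_apply n A r i)"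
    by (rule mat_apply_adjoint) (rule A_sym)
  moreover have "(\<Sum>i<n. r i * mat_apply n A (\<lambda>k. (s k j)\<^sup>2) i) =
      X\<^sup>2 * (\<Sum>i<n. r i * (s i j)\<^sup>2) + q\<^sup>2 * r j"
  proof -
    have "(\<Sum>i<n. r i * mat_apply n A (\<lambda>k. (s k j)\<^sup>2) i) =
      (\<Sum>i<n. X\<^sup>2 * (r j)\<^sup>2 * r i + X\<^sup>2 * (r i * (s i j)\<^sup>2) + (if i = j then q\<^sup>2 * r j else 0))"
      using j by (intro sum.cong) (simp_all add: apply_s_square algebra_simps)
    then show ?thesis
      using j by (simp add: sum.distrib sum_r flip: sum_distrib_left)
  qed
  moreover have "(\<Sum>i<n. (s i j)\<^sup>2 * mat_apply n A r i) =
      X * (\<Sum>i<n. r i * (s i j)\<^sup>2) + q * (r j)\<^sup>2"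
  proof -
    have "(\<Sum>i<n. (s i j)\<^sup>2 * mat_apply n A r i) =
      (\<Sum>i<n. X * (r i * (s i j)\<^sup>2) + q * (s i j)\<^sup>2)"
      using j by (intro sum.cong) (simp_all add: apply_r algebra_simps)
    then show ?thesis
      using j by (simp add: sum.distrib sum_s' flip: sum_distrib_left bit_poly_square_sum)
  qed
  ultimately show ?thesis
    by (smt (verit) add.commute add.left_commute bit_poly_add_cancel distrib_right)
qed

text \<open>
  Here the column of \<open>s\<close> is paired with the derivative of \<open>r\<close>.
\<close>

lemma sum_r_s:
  assumes j: "j < n"
  shows "(\<Sum>i<n. r i * s i j) = pderiv (q * r j)"
proof -
  have "(\<Sum>i<n. pderiv (r i) * mat_apply n A (\<lambda>k. s k j) i) =
      (\<Sum>i<n. s i j * mat_apply n A (\<lambda>j. pderiv (r j)) i)"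
    by (rule mat_apply_adjoint) (rule A_sym)
  moreover have "(\<Sum>i<n. pderiv (r i) * mat_apply n A (\<lambda>k. s k j) i) =
      X * (\<Sum>i<n. pderiv (r i) * s i j) + q * pderiv (r j)"
  proof -
    have "(\<Sum>i<n. pderiv (r i) * mat_apply n A (\<lambda>k. s k j) i) =
      (\<Sum>i<n. X * r j * pderiv (r i) + X * (pderiv (r i) * s i j) +
         (if i = j then q * pderiv (r j) else 0))"
      using j by (intro sum.cong) (simp_all add: apply_s algebra_simps)
    moreover have "(\<Sum>i<n. pderiv (r i)) = 0"
      using sum_r by (metis pderiv_0 pderiv_sum)
    ultimately show ?thesis
      using j by (simp add: sum.distrib flip: sum_distrib_left)
  qed
  moreover have "(\<Sum>i<n. s i j * mat_apply n A (\<lambda>j. pderiv (r j)) i) =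
      X * (\<Sum>i<n. pderiv (r i) * s i j) + (\<Sum>i<n. r i * s i j) + pderiv q * r j"
  proof -
    have "(\<Sum>i<n. s i j * mat_apply n A (\<lambda>j. pderiv (r j)) i) =
      (\<Sum>i<n. X * (pderiv (r i) * s i j) + r i * s i j + pderiv q * s i j)"
      using j
      by (intro sum.cong)
         (simp_all add: apply_r pderiv_add pderiv_mult pderiv_pCons algebra_simps flip: pderiv_mat_apply)
    then show ?thesis
      using j by (simp add: sum.distrib sum_s' flip: sum_distrib_left)
  qed
  ultimately have "q * pderiv (r j) = (\<Sum>i<n. r i * s i j) + pderiv q * r j"
    by (simp only: add.assoc add_left_cancel)
  then show ?thesis
    by (simp add: pderiv_mult add.commute add.left_commute mult.commute)
qed

text \<open>
  The coefficient vectors of \<open>r\<close>, as constant polynomials. Comparing coefficients in \<open>apply_r\<close>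
  shows that \<open>A\<close> acts on them as a shift, up to multiples of the all-ones vector.
\<close>

definition rc :: "nat \<Rightarrow> nat \<Rightarrow> bit poly" where
  "rc l i = [:coeff (r i) l:]"

lemma coeff_apply_r:
  assumes "i < n"
  shows "(\<Sum>j<n. A i j * coeff (r j) l) = (if l = 0 then 0 else coeff (r i) (l - 1)) + coeff q l"
proof -
  have "(\<Sum>j<n. A i j * coeff (r j) l) = coeff (mat_apply n A r i) l"
    by (simp add: mat_apply_def coeff_sum)
  then show ?thesis
    using assms by (simp add: apply_r coeff_X_mult)
qed

lemma apply_rc:
  assumes "i < n"
  shows "mat_apply n A (rc l) i = (if l = 0 then 0 else rc (l - 1) i) + [:coeff q l:]"
proof -
  have "mat_apply n A (rc l) i = [:\<Sum>j<n. A i j * coeff (r j) l:]"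
    unfolding mat_apply_def rc_def by (rule poly_eqI) (simp add: coeff_sum coeff_pCons split: nat.splits)
  also have "\<dots> = [:(if l = 0 then 0 else coeff (r i) (l - 1)) + coeff q l:]"
    by (simp only: coeff_apply_r[OF assms])
  also have "\<dots> = (if l = 0 then 0 else rc (l - 1) i) + [:coeff q l:]"
    by (simp add: rc_def)
  finally show ?thesis .
qed

lemma sum_rc: "(\<Sum>i<n. rc l i) = 0"
proof -
  have "(\<Sum>i<n. rc l i) = [:coeff (\<Sum>i<n. r i) l:]"
    unfolding rc_def by (rule poly_eqI) (simp add: coeff_sum coeff_pCons split: nat.splits)
  then show ?thesis by (simp add: sum_r)
qed

lemma rc_top: "i < n \<Longrightarrow> rc (m - Suc 0) i = 1"
  using lead_r by (simp add: rc_def one_pCons)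

lemma rc_adjoint:
  "(\<Sum>i<n. rc l i * mat_apply n A (rc k) i) = (\<Sum>i<n. rc k i * mat_apply n A (rc l) i)"
  by (rule mat_apply_adjoint) (rule A_sym)

lemma sum_rc_apply:
  "(\<Sum>i<n. rc l i * mat_apply n A (rc k) i) = (if k = 0 then 0 else (\<Sum>i<n. rc l i * rc (k - 1) i))"
proof -
  have "(\<Sum>i<n. rc l i * mat_apply n A (rc k) i) =
      (\<Sum>i<n. (if k = 0 then 0 else rc l i * rc (k - 1) i) + [:coeff q k:] * rc l i)"
    by (intro sum.cong) (simp_all add: apply_rc algebra_simps)
  then show ?thesis
    by (simp add: sum.distrib sum_rc del: mult_pCons_left flip: sum_distrib_left)
qed

text \<open>
  The vectors \<open>rc l\<close> are orthogonal to the all-ones vector, so moving \<open>A\<close> from one factor to the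
  other lowers one index and raises the other one. At index 0 the shift ends with 0.
\<close>

lemma rc_isotropic: "(\<Sum>i<n. rc l i * rc k i) = 0"
proof (induction k arbitrary: l)
  case 0
  show ?case
    using rc_adjoint[of "Suc l" 0] by (simp add: sum_rc_apply mult.commute)
next
  case (Suc k)
  show ?case
    using rc_adjoint[of "Suc l" "Suc k"] Suc.IH[of "Suc l"]
    by (simp add: sum_rc_apply mult.commute)
qed

lemma coeff_isotropic: "(\<Sum>i<n. coeff (r i) l * coeff (r i) k) = 0"
proof -
  have "coeff (\<Sum>i<n. rc l i * rc k i) 0 = 0"
    by (simp only: rc_isotropic coeff_0)
  then show ?thesis
    by (simp only: coeff_sum rc_def coeff_mult_0 coeff_pCons_0)
qed

lemma sum_rc_r_square: "(\<Sum>i<n. rc l i * (r i)\<^sup>2) = 0"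
proof (rule poly_eqI)
  fix k
  have "coeff (\<Sum>i<n. rc l i * (r i)\<^sup>2) k =
      (if even k then \<Sum>i<n. coeff (r i) l * coeff (r i) (k div 2) else 0)"
    by (simp only: rc_def coeff_sum coeff_bit_poly_square mult_pCons_left mult_zero_left
        pCons_0_0 add_0_right coeff_smult mult_zero_right sum.neutral_const split: if_split) simp
  then show "coeff (\<Sum>i<n. rc l i * (r i)\<^sup>2) k = coeff 0 k"
    by (simp only: coeff_isotropic if_cancel coeff_0)
qed

definition S :: "nat \<Rightarrow> nat \<Rightarrow> bit poly" where
  "S l j = (\<Sum>i<n. rc l i * (s i j)\<^sup>2)"

text \<open>
  The shift of the coefficient vectors, paired with the squares of a column of \<open>s\<close>.
\<close>

lemma S_rec:
  assumes j: "j < n"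
  shows "S l j = X\<^sup>2 * S (Suc l) j + [:coeff q (Suc l):] * (r j)\<^sup>2 + q\<^sup>2 * rc (Suc l) j"
proof -
  have "(\<Sum>i<n. rc (Suc l) i * mat_apply n A (\<lambda>k. (s k j)\<^sup>2) i) =
      (\<Sum>i<n. (s i j)\<^sup>2 * mat_apply n A (rc (Suc l)) i)"
    by (rule mat_apply_adjoint) (rule A_sym)
  moreover have "(\<Sum>i<n. rc (Suc l) i * mat_apply n A (\<lambda>k. (s k j)\<^sup>2) i) =
      X\<^sup>2 * S (Suc l) j + q\<^sup>2 * rc (Suc l) j"
  proof -
    have "(\<Sum>i<n. rc (Suc l) i * mat_apply n A (\<lambda>k. (s k j)\<^sup>2) i) =
      (\<Sum>i<n. X\<^sup>2 * (r j)\<^sup>2 * rc (Suc l) i + X\<^sup>2 * (rc (Suc l) i * (s i j)\<^sup>2) +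
        (if i = j then q\<^sup>2 * rc (Suc l) j else 0))"
      using j by (intro sum.cong) (simp_all add: apply_s_square algebra_simps)
    then show ?thesis
      using j by (simp add: S_def sum.distrib sum_rc flip: sum_distrib_left)
  qed
  moreover have "(\<Sum>i<n. (s i j)\<^sup>2 * mat_apply n A (rc (Suc l)) i) =
      S l j + [:coeff q (Suc l):] * (r j)\<^sup>2"
  proof -
    have "(\<Sum>i<n. (s i j)\<^sup>2 * mat_apply n A (rc (Suc l)) i) =
      (\<Sum>i<n. rc l i * (s i j)\<^sup>2 + [:coeff q (Suc l):] * (s i j)\<^sup>2)"
      using j by (intro sum.cong) (simp_all add: apply_rc algebra_simps)
    then show ?thesis
      using j by (simp add: S_def sum.distrib sum_s' del: mult_pCons_left
          flip: sum_distrib_left bit_poly_square_sum)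
  qed
  ultimately have "X\<^sup>2 * S (Suc l) j + q\<^sup>2 * rc (Suc l) j = S l j + [:coeff q (Suc l):] * (r j)\<^sup>2"
    by simp
  then show ?thesis
    by (metis (no_types, lifting) add.assoc add.commute bit_poly_add_cancel)
qed

text \<open>
  The intermediate values in the Horner scheme for \<open>q\<^sup>2\<close>, which is \<open>q\<close> evaluated at \<open>X\<^sup>2\<close>. The start
  value is the leading coefficient of \<open>q\<close>.
\<close>

primrec horner :: "nat \<Rightarrow> bit poly" where
  "horner 0 = 1"
| "horner (Suc k) = X\<^sup>2 * horner k + [:coeff q (m - 1 - k):]"

text \<open>
  Modulo \<open>q\<close>, \<open>S_rec\<close> is the recursion of the Horner scheme. It starts with \<open>S (m - 1) j\<close>, which is
  \<open>(r j)\<^sup>2\<close> because the weights \<open>rc (m - 1) i\<close> are all 1.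
\<close>

lemma S_horner:
  assumes j: "j < n" and "k < m"
  shows "q dvd S (m - 1 - k) j + (r j)\<^sup>2 * horner k"
  using \<open>k < m\<close>
proof (induction k)
  case 0
  have "S (m - 1) j = (r j)\<^sup>2"
    using j rc_top by (simp add: S_def sum_s' flip: bit_poly_square_sum)
  then show ?case by simp
next
  case (Suc k)
  let ?l = "m - 1 - Suc k"
  have l: "Suc ?l = m - 1 - k"
    using Suc.prems by simp
  have rec: "S ?l j = X\<^sup>2 * S (m - 1 - k) j + [:coeff q (m - 1 - k):] * (r j)\<^sup>2 +
      q\<^sup>2 * rc (m - 1 - k) j"
    using S_rec[OF j, of ?l] by (simp only: l)
  have "S ?l j + (r j)\<^sup>2 * horner (Suc k) =
     X\<^sup>2 * (S (m - 1 - k) j + (r j)\<^sup>2 * horner k) + q * (q * rc (m - 1 - k) j)"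
    unfolding rec horner.simps
    by (simp add: distrib_left mult_ac add_ac power2_eq_square del: mult_pCons_left mult_pCons_right)
  then show ?case
    using Suc by (simp del: horner.simps)
qed

definition \<Gamma> :: "nat \<Rightarrow> bit poly" where
  "\<Gamma> l = (\<Sum>j<n. rc l j * f j)"

text \<open>
  Assumption \<open>jacobi\<close>, weighted with \<open>rc l j\<close> and summed over \<open>j\<close>.
\<close>

lemma \<Gamma>_horner:
  assumes i: "i < n" and k: "k < m"
  shows "q dvd (r i)\<^sup>2 * (\<Gamma> (m - 1 - k) + h * horner k)"
proof -
  let ?l = "m - 1 - k"
  have "q\<^sup>2 dvd (\<Sum>j<n. rc ?l j *
      (f i * (r j)\<^sup>2 + f j * (r i)\<^sup>2 + h * (s i j)\<^sup>2 + q * r i * r j * s i j))"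
    using i jacobi by (intro dvd_sum dvd_mult) auto
  also have "\<dots> = (\<Sum>j<n. f i * (rc ?l j * (r j)\<^sup>2) + (r i)\<^sup>2 * (rc ?l j * f j) +
      h * (rc ?l j * (s j i)\<^sup>2) + q * (r i * rc ?l j * r j * s i j))"
    using i by (intro sum.cong) (simp_all add: algebra_simps s_sym)
  also have "\<dots> = (r i)\<^sup>2 * \<Gamma> ?l + h * S ?l i + q * (\<Sum>j<n. r i * rc ?l j * r j * s i j)"
    by (simp add: sum.distrib sum_rc_r_square \<Gamma>_def S_def flip: sum_distrib_left)
  finally have "q dvd \<dots>"
    by (meson dvd_power dvd_trans pos2)
  then have "q dvd (r i)\<^sup>2 * \<Gamma> ?l + h * S ?l i"
    by (simp add: dvd_add_left_iff)
  moreover have "q dvd h * (S ?l i + (r i)\<^sup>2 * horner k)"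
    using S_horner[OF i k] by simp
  ultimately have "q dvd ((r i)\<^sup>2 * \<Gamma> ?l + h * S ?l i) + h * (S ?l i + (r i)\<^sup>2 * horner k)"
    by (rule dvd_add)
  also have "\<dots> = (r i)\<^sup>2 * (\<Gamma> ?l + h * horner k)"
    by (simp add: algebra_simps)
  finally show ?thesis .
qed

text \<open>
  By \<open>lead_f\<close> the top coefficients of \<open>f\<close> form a coefficient vector of \<open>r\<close>, which is orthogonal
  to the weights. So \<open>\<Gamma> l\<close> has smaller degree than the \<open>f j\<close>.
\<close>

lemma degree_\<Gamma>: "degree (\<Gamma> l) < 2 * m - 2"
proof (rule degree_less_if_coeff_0)
  show "0 < 2 * m - 2" using m by simp
  fix k assume k: "2 * m - 2 \<le> k"
  have "coeff (\<Gamma> l) k = (\<Sum>j<n. coeff (r j) l * coeff (f j) k)"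
    by (simp add: \<Gamma>_def rc_def coeff_sum)
  also have "\<dots> = 0"
  proof (cases "k = 2 * m - 2")
    case True
    then have "(\<Sum>j<n. coeff (r j) l * coeff (f j) k) = (\<Sum>j<n. coeff (r j) l * coeff (r j) (m - 2))"
      by (intro sum.cong) (simp_all only: lead_f lessThan_iff)
    then show ?thesis
      by (simp only: coeff_isotropic)
  next
    case False
    then have "j < n \<Longrightarrow> coeff (f j) k = 0" for j
      using k deg_f[of j] by (intro coeff_eq_0) auto
    then show ?thesis by simp
  qed
  finally show "coeff (\<Gamma> l) k = 0" .
qed

definition \<eta> :: "bit poly" where
  "\<eta> = (\<Sum>j<n. r j * f j)"

text \<open>
  Assumption \<open>jacobi\<close>, weighted with \<open>r j\<close> and summed over \<open>j\<close>.
\<close>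

lemma \<eta>_num:
  assumes i: "i < n"
  shows "q\<^sup>2 dvd (r i)\<^sup>2 * ((X + X\<^sup>2) * \<eta> + q * h)"
proof -
  let ?W = "\<Sum>j<n. (r j)\<^sup>2 * s j i" and ?W' = "\<Sum>j<n. r j * (s j i)\<^sup>2"
  have "q\<^sup>2 dvd (\<Sum>j<n. r j *
      (f i * (r j)\<^sup>2 + f j * (r i)\<^sup>2 + h * (s i j)\<^sup>2 + q * r i * r j * s i j))"
    using i jacobi by (intro dvd_sum dvd_mult) auto
  also have "\<dots> = (\<Sum>j<n. f i * (r j)^3 + (r i)\<^sup>2 * (r j * f j) +
      h * (r j * (s j i)\<^sup>2) + q * r i * ((r j)\<^sup>2 * s j i))"
    using i
    by (intro sum.cong) (simp_all add: distrib_left s_sym power2_eq_square power3_eq_cube mult_ac)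
  also have "\<dots> = (r i)\<^sup>2 * \<eta> + h * ?W' + q * r i * ?W"
    by (simp add: sum.distrib sum_r_cube \<eta>_def flip: sum_distrib_left)
  finally have "q\<^sup>2 dvd (X + X\<^sup>2) * ((r i)\<^sup>2 * \<eta> + h * ?W' + q * r i * ?W)"
    by (rule dvd_mult)
  also have "\<dots> = (X + X\<^sup>2) * ((r i)\<^sup>2 * \<eta>) + h * ((X + X\<^sup>2) * ?W') + q * r i * ((X + X\<^sup>2) * ?W)"
    by (simp add: distrib_left mult_ac)
  also have "\<dots> = (r i)\<^sup>2 * ((X + X\<^sup>2) * \<eta> + q * h) +
      q\<^sup>2 * (h * r i + r i * (r i)\<^sup>2 + q * r i * r i)"
    unfolding sum_r_square_s[OF i] sum_r_s_square[OF i]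
    by (simp add: distrib_left power2_eq_square mult_ac add_ac)
  finally show ?thesis
    by (simp add: dvd_add_left_iff)
qed

text \<open>
  Assumption \<open>jacobi\<close>, summed over \<open>j\<close>.
\<close>

lemma sum_f_num:
  assumes i: "i < n"
  shows "q\<^sup>2 dvd (r i)\<^sup>2 * ((\<Sum>j<n. f j) + h + q * pderiv q)"
proof -
  have "q\<^sup>2 dvd (\<Sum>j<n.
      (f i * (r j)\<^sup>2 + f j * (r i)\<^sup>2 + h * (s i j)\<^sup>2 + q * r i * r j * s i j))"
    using i jacobi by (intro dvd_sum) auto
  also have "\<dots> = (\<Sum>j<n. f i * (r j)\<^sup>2 + (r i)\<^sup>2 * f j + h * (s j i)\<^sup>2 + q * r i * (r j * s j i))"
    using i by (intro sum.cong) (simp_all add: algebra_simps s_sym)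
  also have "\<dots> = (r i)\<^sup>2 * (\<Sum>j<n. f j) + h * (r i)\<^sup>2 + q * r i * pderiv (q * r i)"
    using i by (simp add: sum.distrib sum_r sum_r_s sum_s' flip: sum_distrib_left bit_poly_square_sum)
  also have "\<dots> = (r i)\<^sup>2 * ((\<Sum>j<n. f j) + h + q * pderiv q) + q\<^sup>2 * (r i * pderiv (r i))"
    by (simp add: distrib_left pderiv_mult power2_eq_square mult_ac add_ac)
  finally show ?thesis
    by (simp add: dvd_add_left_iff)
qed

end

section \<open>Two such matrices whose determinants differ in parity\<close>

text \<open>
  The first premise writes 1 as a combination of \<open>c\<close> and the entries of \<open>u\<close>.
\<close>

lemma dvd_if_dvd_bezout:
  assumes "1 = c + p * u i + mat_apply n A u i" "D dvd c" "i < n"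
    and "\<And>j. j < n \<Longrightarrow> D dvd u j * z"
  shows "D dvd z"
proof -
  have "z = (c + p * u i + mat_apply n A u i) * z"
    using assms(1) by simp
  also have "\<dots> = c * z + p * (u i * z) + (\<Sum>j<n. smult (A i j) (u j * z))"
    by (simp add: mat_apply_def distrib_right sum_distrib_right mult.assoc)
  finally have z: "z = \<dots>" .
  have "D dvd c * z" "D dvd p * (u i * z)"
    using assms(2-4) by auto
  moreover have "D dvd (\<Sum>j<n. smult (A i j) (u j * z))"
    using assms(4) by (auto intro!: dvd_sum dvd_smult)
  ultimately show ?thesis
    by (subst z) (intro dvd_add)
qed

lemma const_multiple_if_degree_le:
  fixes p D :: "bit poly"
  assumes "D dvd p" "degree p \<le> degree D" "D \<noteq> 0"
  obtains c where "p = [:c:] * D"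
proof -
  obtain k where k: "p = D * k"
    using assms(1) by blast
  have "degree k = 0"
  proof (cases "k = 0")
    case False
    then show ?thesis
      using assms(2,3) k by (simp add: degree_mult_eq)
  qed simp
  then obtain c where "k = [:c:]"
    by (metis degree_0_id)
  then show ?thesis
    using that k by (simp add: mult.commute)
qed

lemma eq_0_if_dvd_degree_less:
  fixes p D :: "bit poly"
  assumes "D dvd p" "degree p < degree D"
  shows "p = 0"
  using assms dvd_imp_degree_le[of D p] by (cases "p = 0") auto

text \<open>
  Two graphs with the same deck, hence with the same \<open>r\<close> and \<open>f\<close>. The constant term of \<open>\<phi>\<close> is odd
  for the one with index 1 and even for the one with index 0. The relation between \<open>g1\<close> and \<open>g0\<close>
  is the second binary digit of the fact that the two polynomials \<open>\<phi>\<close> differ by a constant: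
  if \<open>Q\<close> lifts \<open>q0\<close> then \<open>Q + 1\<close> lifts \<open>q1\<close>, and its square is \<open>Q\<^sup>2 + 2 Q + 1\<close>.
\<close>

locale coupled_graphs =
  G: reduced_graph n m A1 q1 g1 h1 r f s1 + H: reduced_graph n m A0 q0 g0 h0 r f s0
  for n m :: nat and r f :: "nat \<Rightarrow> bit poly"
    and A1 q1 g1 h1 s1 A0 q0 g0 h0 s0 +
  fixes \<epsilon> :: bit
  assumes n_pos: "0 < n"
    and q1: "q1 = q0 + 1" and q0_0: "coeff q0 0 = 0"
    and g1: "g1 = g0 + q0 + [:\<epsilon>:]"
begin

text \<open>
  Since \<open>A1 r = X r + q1 = X r + q0 + 1\<close>, the adjacency matrix of one graph shows that \<open>r\<close> generates
  the unit ideal modulo the polynomial \<open>q\<close> of the other one.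
\<close>

lemma bezout0: "i < n \<Longrightarrow> 1 = q0 + X * r i + mat_apply n A1 r i"
  by (simp add: G.apply_r q1 add_ac)

lemma bezout0_square: "i < n \<Longrightarrow> 1 = q0\<^sup>2 + X\<^sup>2 * (r i)\<^sup>2 + mat_apply n A1 (\<lambda>j. (r j)\<^sup>2) i"
  by (simp add: G.apply_r_square q1 add_ac bit_poly_square_add)

lemma bezout1_square: "i < n \<Longrightarrow> 1 = q1\<^sup>2 + X\<^sup>2 * (r i)\<^sup>2 + mat_apply n A0 (\<lambda>j. (r j)\<^sup>2) i"
  by (simp add: H.apply_r_square q1 add_ac bit_poly_square_add)

text \<open>
  The factors \<open>(r j)\<^sup>2\<close> in the divisibilities obtained so far can therefore be removed.
\<close>

lemma cancel0:
  assumes "\<And>j. j < n \<Longrightarrow> D dvd (r j)\<^sup>2 * z" "D dvd q0\<^sup>2"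
  shows "D dvd z"
  using dvd_if_dvd_bezout[OF bezout0_square[OF n_pos] assms(2) n_pos assms(1)] .

lemma cancel1:
  assumes "\<And>j. j < n \<Longrightarrow> D dvd (r j)\<^sup>2 * z" "D dvd q1\<^sup>2"
  shows "D dvd z"
  using dvd_if_dvd_bezout[OF bezout1_square[OF n_pos] assms(2) n_pos assms(1)] .

definition M :: "bit poly" where
  "M = q0 * q1"

lemma M_eq: "M = q0\<^sup>2 + q0"
  unfolding M_def by (simp add: q1 distrib_left power2_eq_square)

lemma q0_neq_0: "q0 \<noteq> 0" and q1_neq_0: "q1 \<noteq> 0"
  using H.deg_q G.deg_q H.m by auto

lemma M_neq_0: "M \<noteq> 0"
  using q0_neq_0 q1_neq_0 by (simp add: M_def)

lemma degree_M: "degree M = 2 * m"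
  using q0_neq_0 q1_neq_0 by (simp add: M_def degree_mult_eq H.deg_q G.deg_q)

text \<open>
  The factors \<open>q0\<close> and \<open>q1\<close> of \<open>M\<close> are coprime, because their difference is 1.
\<close>

lemma M_dvd:
  assumes "q0 dvd z" "q1 dvd z"
  shows "M dvd z"
proof -
  obtain a b where a: "z = q0 * a" and b: "z = q1 * b"
    using assms by blast
  have "z = q1 * z + q0 * z"
    by (simp add: q1 distrib_right add_ac)
  also have "\<dots> = q1 * (q0 * a) + q0 * (q1 * b)"
    by (simp only: a[symmetric] b[symmetric])
  also have "\<dots> = M * (a + b)"
    by (simp add: M_def distrib_left mult_ac)
  finally show ?thesis by simp
qed

lemma coeff_q1: "0 < k \<Longrightarrow> coeff q1 k = coeff q0 k"
  by (simp add: q1)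

lemma horner_eq: "k < m \<Longrightarrow> G.horner k = H.horner k"
  by (induction k) (simp_all add: coeff_q1)

lemma degree_horner: "degree (H.horner k) = 2 * k" "H.horner k \<noteq> 0"
proof (induction k)
  case (Suc k)
  have "degree (X\<^sup>2 * H.horner k) = 2 * Suc k"
    using Suc by (simp add: degree_mult_eq degree_power_eq)
  moreover have "degree (H.horner (Suc k)) = degree (X\<^sup>2 * H.horner k)"
    using calculation by (simp add: degree_add_eq_left)
  ultimately show "degree (H.horner (Suc k)) = 2 * Suc k" by simp
  then show "H.horner (Suc k) \<noteq> 0" by auto
qed simp_all

lemma degree_\<eta>: "degree H.\<eta> \<le> 3 * m - 3"
  unfolding H.\<eta>_def
proof (rule degree_sum_le)
  fix j assume j: "j \<in> {..<n}"
  have "degree (r j * f j) \<le> degree (r j) + degree (f j)"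
    by (rule degree_mult_le)
  then show "degree (r j * f j) \<le> 3 * m - 3"
    using H.deg_r[of j] H.deg_f[of j] j by simp
qed simp

text \<open>
  By \<open>\<eta>_num\<close> both \<open>q0\<close> and \<open>q1\<close> divide \<open>(X + X\<^sup>2) * \<eta>\<close>, and the quotient \<open>t\<close> by \<open>M\<close> is congruent to
  \<open>h0\<close> modulo \<open>q0\<close> and to \<open>h1\<close> modulo \<open>q1\<close>. So \<open>\<Gamma>_horner\<close>, in which both graphs have the same \<open>\<Gamma>\<close>
  and the same Horner values, says that \<open>\<Gamma> (m - 1 - k)\<close> is \<open>t * horner k\<close> modulo \<open>M\<close>. The degree
  bound on \<open>\<Gamma>\<close> makes this an equality for every \<open>k\<close>, by induction. For \<open>k = m - 1\<close> the
  right-hand side has degree at least \<open>2 * m - 2\<close> unless \<open>t = 0\<close>.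
\<close>

lemma h_eq_0_mod_q: "q0 dvd h0" "q1 dvd h1" "H.\<Gamma> (m - 1) = 0"
proof -
  let ?E = "(X + X\<^sup>2) * H.\<eta>"
  have E0: "q0\<^sup>2 dvd ?E + q0 * h0"
    using H.\<eta>_num by (rule cancel0) auto
  have E1: "q1\<^sup>2 dvd ?E + q1 * h1"
    using G.\<eta>_num by (rule cancel1) auto
  have "q0 dvd ?E" "q1 dvd ?E"
    using E0 E1 by (meson dvd_add_left_iff dvd_power dvd_trans dvd_triv_left pos2)+
  then have "M dvd ?E"
    by (rule M_dvd)
  then obtain t where t: "?E = M * t" by blast
  have deg_t: "degree t < m"
  proof (cases "t = 0")
    case False
    have "degree ?E \<le> 2 + (3 * m - 3)"
      using degree_mult_le[of "X + X\<^sup>2" H.\<eta>] degree_\<eta> X_plus_X_square(2) by linarith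
    moreover have "degree ?E = 2 * m + degree t"
      using False M_neq_0 by (simp add: t degree_mult_eq degree_M)
    ultimately show ?thesis
      using H.m by linarith
  qed (use H.m in simp)
  have t0: "q0 dvd t + h0"
  proof -
    have "q0\<^sup>2 dvd M * t + q0 * h0"
      using E0 by (simp only: t)
    also have "M * t + q0 * h0 = q0 * (q1 * t + h0)"
      by (simp add: M_def distrib_left mult_ac)
    finally have "q0 * q0 dvd q0 * (q1 * t + h0)"
      by (simp only: power2_eq_square)
    then have "q0 dvd q1 * t + h0"
      using q0_neq_0 by simp
    also have "q1 * t + h0 = q0 * t + (t + h0)"
      by (simp add: q1 distrib_right add_ac)
    finally show ?thesis
      by (simp only: dvd_add_right_iff dvd_triv_left)
  qed
  have t1: "q1 dvd t + h1"
  proof -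
    have "q1\<^sup>2 dvd M * t + q1 * h1"
      using E1 by (simp only: t)
    also have "M * t + q1 * h1 = q1 * (q0 * t + h1)"
      by (simp add: M_def distrib_left mult_ac)
    finally have "q1 * q1 dvd q1 * (q0 * t + h1)"
      by (simp only: power2_eq_square)
    then have "q1 dvd q0 * t + h1"
      using q1_neq_0 by simp
    also have "q0 * t + h1 = q1 * t + (t + h1)"
      by (simp add: q1 distrib_right add_ac)
    finally show ?thesis
      by (simp only: dvd_add_right_iff dvd_triv_left)
  qed
  have mod_M: "M dvd H.\<Gamma> (m - 1 - k) + t * H.horner k" if k: "k < m" for k
  proof (rule M_dvd)
    have "q0 dvd H.\<Gamma> (m - 1 - k) + h0 * H.horner k"
      using H.\<Gamma>_horner[OF _ k] by (rule cancel0) auto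
    moreover have "q0 dvd (t + h0) * H.horner k"
      using t0 by simp
    ultimately have "q0 dvd (H.\<Gamma> (m - 1 - k) + h0 * H.horner k) + (t + h0) * H.horner k"
      by (rule dvd_add)
    then show "q0 dvd H.\<Gamma> (m - 1 - k) + t * H.horner k"
      by (simp add: distrib_right add_ac)
  next
    have "q1 dvd H.\<Gamma> (m - 1 - k) + h1 * H.horner k"
      using G.\<Gamma>_horner[OF _ k, unfolded horner_eq[OF k]] by (rule cancel1) auto
    moreover have "q1 dvd (t + h1) * H.horner k"
      using t1 by simp
    ultimately have "q1 dvd (H.\<Gamma> (m - 1 - k) + h1 * H.horner k) + (t + h1) * H.horner k"
      by (rule dvd_add)
    then show "q1 dvd H.\<Gamma> (m - 1 - k) + t * H.horner k"
      by (simp add: distrib_right add_ac)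
  qed
  have eq: "H.\<Gamma> (m - 1 - k) = t * H.horner k" if "k < m" for k
    using that
  proof (induction k)
    case 0
    have "degree (H.\<Gamma> (m - 1) + t) < degree M"
      using H.degree_\<Gamma>[of "m - 1"] deg_t degree_M by (intro degree_add_less) auto
    then have "H.\<Gamma> (m - 1) + t = 0"
      using mod_M[of 0] H.m by (intro eq_0_if_dvd_degree_less[of M]) auto
    then show ?case
      by (simp add: bit_poly_add_eq_0_iff)
  next
    case (Suc k)
    let ?\<Gamma> = "H.\<Gamma> (m - 1 - Suc k)" and ?c = "[:coeff q0 (m - 1 - k):]"
    have "t * H.horner (Suc k) = X\<^sup>2 * H.\<Gamma> (m - 1 - k) + ?c * t"
      using Suc by (simp add: distrib_left mult_ac)
    moreover have "degree (X\<^sup>2 * H.\<Gamma> (m - 1 - k)) < 2 * m"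
      using degree_mult_le[of "X\<^sup>2" "H.\<Gamma> (m - 1 - k)"] H.degree_\<Gamma>[of "m - 1 - k"]
      by (simp add: degree_power_eq)
    moreover have "degree (?c * t) < 2 * m"
      using degree_mult_le[of ?c t] deg_t by simp
    ultimately have "degree (t * H.horner (Suc k)) < 2 * m"
      by (simp add: degree_add_less)
    then have "degree (?\<Gamma> + t * H.horner (Suc k)) < degree M"
      using H.degree_\<Gamma>[of "m - 1 - Suc k"] degree_M by (intro degree_add_less) auto
    then have "?\<Gamma> + t * H.horner (Suc k) = 0"
      using mod_M[of "Suc k"] Suc.prems by (intro eq_0_if_dvd_degree_less[of M]) auto
    then show ?case
      by (simp only: bit_poly_add_eq_0_iff)
  qed
  have "t = 0"
  proof (rule ccontr)
    assume "t \<noteq> 0"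
    then have "degree (H.\<Gamma> 0) = degree t + 2 * (m - 1)"
      using eq[of "m - 1"] H.m degree_horner by (simp add: degree_mult_eq)
    then show False
      using H.degree_\<Gamma>[of 0] by simp
  qed
  then show "q0 dvd h0" "q1 dvd h1" "H.\<Gamma> (m - 1) = 0"
    using t0 t1 eq[of 0] H.m by simp_all
qed

lemma dvd_poly_root: "p dvd q \<Longrightarrow> poly p a = 0 \<Longrightarrow> poly q a = 0"
  by (auto elim!: dvdE)

lemma degree_less_double:
  "degree (p :: bit poly) < m \<Longrightarrow> degree q \<le> m \<Longrightarrow> degree (p * q) < 2 * m"
  using degree_mult_le[of p q] by linarith

text \<open>
  The sum is \<open>\<Gamma> (m - 1)\<close>, since the polynomials \<open>r j\<close> are monic of degree \<open>m - 1\<close>.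
\<close>

lemma sum_f: "(\<Sum>j<n. f j) = 0"
  using h_eq_0_mod_q(3) H.rc_top by (simp add: H.\<Gamma>_def)

lemma pderiv_q1: "pderiv q1 = pderiv q0"
  by (simp add: q1 pderiv_add)

lemma degree_pderiv_less: "degree (pderiv q0) < m"
  using H.m by (intro degree_less_if_coeff_0) (auto simp: coeff_pderiv coeff_eq_0 H.deg_q)

lemma h0: "h0 = q0 * pderiv q0" and h1: "h1 = q1 * pderiv q0"
proof -
  have "q0\<^sup>2 dvd (\<Sum>j<n. f j) + h0 + q0 * pderiv q0"
    using H.sum_f_num by (rule cancel0) auto
  moreover have "degree (h0 + q0 * pderiv q0) < 2 * m"
    using degree_less_double[OF degree_pderiv_less, of q0] H.deg_q H.deg_h
    by (intro degree_add_less) (simp_all add: mult.commute)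
  ultimately have "h0 + q0 * pderiv q0 = 0"
    by (intro eq_0_if_dvd_degree_less[of "q0\<^sup>2"])
       (simp_all add: sum_f degree_power_eq q0_neq_0 H.deg_q)
  then show "h0 = q0 * pderiv q0"
    by (simp only: bit_poly_add_eq_0_iff)
  have "q1\<^sup>2 dvd (\<Sum>j<n. f j) + h1 + q1 * pderiv q1"
    using G.sum_f_num by (rule cancel1) auto
  moreover have "degree (h1 + q1 * pderiv q0) < 2 * m"
    using degree_less_double[OF degree_pderiv_less, of q1] G.deg_q G.deg_h
    by (intro degree_add_less) (simp_all add: mult.commute)
  ultimately have "h1 + q1 * pderiv q0 = 0"
    by (intro eq_0_if_dvd_degree_less[of "q1\<^sup>2"])
       (simp_all add: sum_f degree_power_eq q1_neq_0 G.deg_q pderiv_q1)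
  then show "h1 = q1 * pderiv q0"
    by (simp only: bit_poly_add_eq_0_iff)
qed

text \<open>
  By assumption \<open>num\<close> and the degrees, \<open>g + X * h\<close> is a constant times \<open>q\<^sup>2\<close> for both graphs. In the
  sum of the two equations \<open>g0\<close> cancels and \<open>q0 + X * pderiv q0\<close> remains, up to a constant.
\<close>

lemma q0_eq: "q0 = X * pderiv q0"
proof -
  have deg: "degree (g + X * h) \<le> 2 * m" if "degree g < 2 * m" "degree h < 2 * m" for g h :: "bit poly"
    using that degree_mult_le[of X h] by (intro degree_add_le) auto
  have "q0\<^sup>2 dvd g0 + X * h0"
    using H.num by (rule cancel0) auto
  then obtain \<nu>0 where \<nu>0: "g0 + X * h0 = [:\<nu>0:] * q0\<^sup>2"
    using deg[OF H.deg_g H.deg_h]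
    by (elim const_multiple_if_degree_le) (simp_all add: degree_power_eq q0_neq_0 H.deg_q)
  have "q1\<^sup>2 dvd g1 + X * h1"
    using G.num by (rule cancel1) auto
  then obtain \<nu>1 where \<nu>1: "g1 + X * h1 = [:\<nu>1:] * q1\<^sup>2"
    using deg[OF G.deg_g G.deg_h]
    by (elim const_multiple_if_degree_le) (simp_all add: degree_power_eq q1_neq_0 G.deg_q)
  have "q0 + X * pderiv q0 + [:\<epsilon>:] = (g0 + X * h0) + (g1 + X * h1)"
    by (simp add: g1 h0 h1 q1 distrib_left distrib_right add_ac mult_ac)
  also have "\<dots> = [:\<nu>0 + \<nu>1:] * q0\<^sup>2 + [:\<nu>1:]"
    unfolding \<nu>0 \<nu>1 q1 bit_poly_square_add by (simp add: smult_add_left smult_add_right add_ac)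
  finally have eq: "q0 + X * pderiv q0 + [:\<epsilon>:] = [:\<nu>0 + \<nu>1:] * q0\<^sup>2 + [:\<nu>1:]" .
  have "degree (q0 + X * pderiv q0 + [:\<epsilon>:]) < 2 * m"
    using H.deg_q H.m degree_mult_le[of X "pderiv q0"] degree_pderiv_less
    by (intro degree_add_less) auto
  then have "coeff (q0 + X * pderiv q0 + [:\<epsilon>:]) (2 * m) = 0"
    by (rule coeff_eq_0)
  moreover have "coeff ([:\<nu>0 + \<nu>1:] * q0\<^sup>2 + [:\<nu>1:]) (2 * m) = \<nu>0 + \<nu>1"
    using H.m by (simp add: coeff_bit_poly_square H.lead_q coeff_pCons split: nat.splits)
  ultimately have "\<nu>0 + \<nu>1 = 0"
    using eq by simp
  then have "q0 + X * pderiv q0 + [:\<epsilon>:] = [:\<nu>1:]"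
    using eq by simp
  moreover have "q0 + X * pderiv q0 = (q0 + X * pderiv q0 + [:\<epsilon>:]) + [:\<epsilon>:]"
    by (simp only: add.assoc bit_poly_add_self add_0_right)
  ultimately have eq: "q0 + X * pderiv q0 = [:\<nu>1 + \<epsilon>:]"
    by simp
  have "coeff (q0 + X * pderiv q0) 0 = 0"
    by (simp add: q0_0 X_def)
  then have "q0 + X * pderiv q0 = 0"
    using eq by simp
  then show ?thesis
    by (simp only: bit_poly_add_eq_0_iff)
qed

lemma coeff_q0_even:
  assumes "even k"
  shows "coeff q0 k = 0"
proof (cases k)
  case (Suc l)
  have "coeff q0 k = coeff (X * pderiv q0) k"
    using q0_eq by simp
  also have "\<dots> = of_nat k * coeff q0 k"
    by (simp add: Suc coeff_X_mult coeff_pderiv)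
  also have "\<dots> = 0"
    using assms by (simp add: of_nat_bit)
  finally show ?thesis .
qed (simp add: q0_0)

lemma odd_m: "odd m"
  using coeff_q0_even[of m] H.lead_q by auto

lemma m_ge_3: "3 \<le> m"
  using odd_m H.m by (cases "m = 2") auto

text \<open>
  The deviation of \<open>f i\<close> from the value \<open>X\<^sup>2 * (r i)\<^sup>2 + M\<close>, which \<open>f_eq\<close> will establish.
\<close>

definition e :: "nat \<Rightarrow> bit poly" where
  "e i = f i + X\<^sup>2 * (r i)\<^sup>2 + M"

lemma div_diff_two: "(k - 2) div 2 = k div 2 - Suc 0"
  by presburger

text \<open>
  The leading terms of \<open>X\<^sup>2 * (r i)\<^sup>2\<close> and \<open>M\<close> cancel in degree \<open>2 * m\<close>, and those of \<open>f i\<close> and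
  \<open>X\<^sup>2 * (r i)\<^sup>2\<close> in degree \<open>2 * m - 2\<close>; for the latter \<open>q0\<close> must have no term of the even degree
  \<open>m - 1\<close>.
\<close>

lemma degree_e:
  assumes i: "i < n"
  shows "degree (e i) < 2 * m - 2"
proof (rule degree_less_if_coeff_0)
  show "0 < 2 * m - 2" using H.m by simp
  fix k assume k: "2 * m - 2 \<le> k"
  have r2: "coeff ((r i)\<^sup>2) (k - 2) = (if even k then coeff (r i) (k div 2 - 1) else 0)"
    using k m_ge_3 by (cases "k < 2") (simp_all add: coeff_bit_poly_square div_diff_two)
  have e: "coeff (e i) k = coeff (f i) k + (if even k then coeff (r i) (k div 2 - 1) else 0)
      + ((if even k then coeff q0 (k div 2) else 0) + coeff q0 k)"
    using k m_ge_3 unfolding e_def M_eq coeff_add coeff_X_square_mult r2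
    by (cases "k < 2") (simp_all add: coeff_bit_poly_square)
  have q0_k: "coeff q0 k = 0"
    using k m_ge_3 by (intro coeff_eq_0) (simp add: H.deg_q)
  consider "k = 2 * m - 2" | "k = 2 * m - 1" | "k = 2 * m" | "k > 2 * m"
    using k by linarith
  then show "coeff (e i) k = 0"
  proof cases
    case 1
    have "coeff q0 (m - 1) = 0"
      using odd_m by (intro coeff_q0_even) simp
    moreover have "k div 2 = m - 1" "k div 2 - 1 = m - 2" "even k"
      using 1 by auto
    moreover have "coeff (f i) k = coeff (r i) (m - 2)"
      using H.lead_f[OF i] 1 by simp
    ultimately show ?thesis
      by (simp add: e q0_k)
  next
    case 2
    then have "odd k" using H.m by simp
    moreover have "coeff (f i) k = 0"
      using H.deg_f[OF i] 2 by (intro coeff_eq_0) simp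
    ultimately show ?thesis
      by (simp add: e q0_k)
  next
    case 3
    then have "k div 2 - 1 = m - 1" "k div 2 = m" "even k"
      by auto
    moreover have "coeff (f i) k = 0"
      using H.deg_f[OF i] 3 by (intro coeff_eq_0) simp
    ultimately show ?thesis
      using H.lead_r[OF i] H.lead_q by (simp add: e q0_k)
  next
    case 4
    have "coeff (f i) k = 0"
      using H.deg_f[OF i] 4 by (intro coeff_eq_0) simp
    moreover have "coeff (r i) (k div 2 - 1) = 0" if "even k"
      using H.deg_r[OF i] 4 that by (intro coeff_eq_0) (auto elim!: evenE)
    moreover have "coeff q0 (k div 2) = 0" if "even k"
      using 4 that by (intro coeff_eq_0) (auto simp: H.deg_q)
    ultimately show ?thesis
      by (simp add: e q0_k)
  qed
qed

text \<open>
  Both adjacency matrices shift the coefficient vectors, and the shifts differ by the all-ones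
  vector at index 0, because \<open>q1 = q0 + 1\<close>. So the sum of the two matrices extracts \<open>c 0\<close> from a
  linear relation. The other coefficients are shifted down to index 0 by \<open>A0\<close>.
\<close>

lemma coeff_r_independent:
  assumes "\<And>i. i < n \<Longrightarrow> (\<Sum>l<m. c l * coeff (r i) l) = 0" "l < m"
  shows "c l = 0"
  using assms
proof (induction l arbitrary: c)
  case (0 c)
  have "(\<Sum>j<n. A1 0 j * (\<Sum>l<m. c l * coeff (r j) l)) + (\<Sum>j<n. A0 0 j * (\<Sum>l<m. c l * coeff (r j) l)) = 0"
    using 0 by simp
  have swap: "(\<Sum>j<n. A 0 j * (\<Sum>l<m. c l * coeff (r j) l)) = (\<Sum>l<m. c l * (\<Sum>j<n. A 0 j * coeff (r j) l))"
    for A :: "nat \<Rightarrow> nat \<Rightarrow> bit"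
    unfolding sum_distrib_left by (subst sum.swap) (simp only: mult_ac)
  have "0 = (\<Sum>l<m. c l * (\<Sum>j<n. A1 0 j * coeff (r j) l)) + (\<Sum>l<m. c l * (\<Sum>j<n. A0 0 j * coeff (r j) l))"
    using 0 by (simp flip: swap)
  also have "\<dots> = (\<Sum>l<m. c l * ((\<Sum>j<n. A1 0 j * coeff (r j) l) + (\<Sum>j<n. A0 0 j * coeff (r j) l)))"
    by (simp only: sum.distrib distrib_left)
  also have "\<dots> = (\<Sum>l<m. c l * (coeff q1 l + coeff q0 l))"
  proof (rule sum.cong)
    fix l
    have "(a + x) + (a + y) = x + y" for a x y :: bit
      by (cases a; cases x; cases y) simp_all
    then show "c l * ((\<Sum>j<n. A1 0 j * coeff (r j) l) + (\<Sum>j<n. A0 0 j * coeff (r j) l)) =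
        c l * (coeff q1 l + coeff q0 l)"
      by (simp only: G.coeff_apply_r[OF n_pos] H.coeff_apply_r[OF n_pos])
  qed simp
  also have "\<dots> = (\<Sum>l<m. if l = 0 then c 0 else 0)"
    by (rule sum.cong) (auto simp: q1)
  also have "\<dots> = c 0"
    using H.m by simp
  finally show ?case by simp
next
  case (Suc k c)
  \<comment> \<open>The relation obtained by applying \<open>A0\<close>. The all-ones vectors that the shift produces are
    absorbed into the top coefficient vector, which is the all-ones vector.\<close>
  define c' where "c' l = (if l = m - 1 then \<Sum>l<m. c l * coeff q0 l else c (Suc l))" for l
  have "(\<Sum>l<m. c' l * coeff (r i) l) = 0" if i: "i < n" for i
  proof -
    obtain m' where m': "m = Suc m'"
      using H.m by (cases m) auto
    have "0 = (\<Sum>j<n. A0 i j * (\<Sum>l<m. c l * coeff (r j) l))"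
      using Suc.prems by simp
    also have "\<dots> = (\<Sum>l<m. c l * (\<Sum>j<n. A0 i j * coeff (r j) l))"
      unfolding sum_distrib_left by (subst sum.swap) (simp only: mult_ac)
    also have "\<dots> = (\<Sum>l<m. c l * ((if l = 0 then 0 else coeff (r i) (l - 1)) + coeff q0 l))"
      by (simp only: H.coeff_apply_r[OF i])
    also have "\<dots> = (\<Sum>l<m. c l * (if l = 0 then 0 else coeff (r i) (l - 1))) + (\<Sum>l<m. c l * coeff q0 l)"
      by (simp only: sum.distrib distrib_left)
    also have "(\<Sum>l<m. c l * (if l = 0 then 0 else coeff (r i) (l - 1))) = (\<Sum>l<m'. c (Suc l) * coeff (r i) l)"
      unfolding m' by (subst sum.lessThan_Suc_shift) simp
    also have "(\<Sum>l<m. c l * coeff q0 l) = c' m' * coeff (r i) m'"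
      using H.lead_r[OF i] m' by (simp add: c'_def)
    also have "(\<Sum>l<m'. c (Suc l) * coeff (r i) l) = (\<Sum>l<m'. c' l * coeff (r i) l)"
      using m' by (intro sum.cong) (auto simp: c'_def)
    also have "(\<Sum>l<m'. c' l * coeff (r i) l) + c' m' * coeff (r i) m' = (\<Sum>l<m. c' l * coeff (r i) l)"
      by (simp only: m' sum.lessThan_Suc)
    finally show ?thesis by simp
  qed
  then have "c' k = 0"
    using Suc by simp
  then show ?case
    using Suc.prems by (simp add: c'_def split: if_splits)
qed

lemma r_square_eq: "i < n \<Longrightarrow> (r i)\<^sup>2 = (\<Sum>l<m. H.rc l i * X ^ (2 * l))"
proof (rule poly_eqI)
  fix k assume i: "i < n"
  have Xp: "coeff (X ^ j) k = (if k = j then 1 else 0)" for j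
    by (metis X_def coeff_monom monom_altdef smult_1_left)
  have "coeff (\<Sum>l<m. H.rc l i * X ^ (2 * l)) k = (\<Sum>l<m. if k = 2 * l then coeff (r i) l else 0)"
    by (simp add: coeff_sum H.rc_def Xp if_distrib cong: if_cong)
  also have "\<dots> = (if even k then coeff (r i) (k div 2) else 0)"
  proof (cases "even k")
    case True
    then obtain l where k: "k = 2 * l" by blast
    have "coeff (r i) l = 0" if "\<not> l < m"
      using that H.deg_r[OF i] by (intro coeff_eq_0) simp
    then show ?thesis
      by (simp add: k)
  next
    case False
    then have "k \<noteq> 2 * l" for l by auto
    with False show ?thesis by simp
  qed
  finally show "coeff ((r i)\<^sup>2) k = coeff (\<Sum>l<m. H.rc l i * X ^ (2 * l)) k"
    by (simp add: coeff_bit_poly_square)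
qed

text \<open>
  This is assumption \<open>jacobi\<close> modulo \<open>q0\<close> and modulo \<open>q1\<close>, where the terms with \<open>h\<close> vanish by
  \<open>h_eq_0_mod_q\<close>.
\<close>

lemma e_cross: "i < n \<Longrightarrow> j < n \<Longrightarrow> M dvd e i * (r j)\<^sup>2 + e j * (r i)\<^sup>2"
proof (rule M_dvd)
  assume ij: "i < n" "j < n"
  have expand: "e i * (r j)\<^sup>2 + e j * (r i)\<^sup>2 =
      (f i * (r j)\<^sup>2 + f j * (r i)\<^sup>2) + M * ((r i)\<^sup>2 + (r j)\<^sup>2)"
    by (simp add: e_def distrib_left distrib_right mult_ac add_ac)
  have "q0 dvd (f i * (r j)\<^sup>2 + f j * (r i)\<^sup>2) + (h0 * (s0 i j)\<^sup>2 + q0 * r i * r j * s0 i j)"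
    using H.jacobi[OF ij] unfolding add.assoc power2_eq_square by (rule dvd_mult_left)
  moreover have "q0 dvd h0 * (s0 i j)\<^sup>2 + q0 * r i * r j * s0 i j"
    using h_eq_0_mod_q(1) by (auto simp: mult.assoc)
  ultimately have "q0 dvd f i * (r j)\<^sup>2 + f j * (r i)\<^sup>2"
    by (simp only: dvd_add_left_iff)
  then show "q0 dvd e i * (r j)\<^sup>2 + e j * (r i)\<^sup>2"
    unfolding expand by (simp add: M_def mult.assoc)
  have "q1 dvd (f i * (r j)\<^sup>2 + f j * (r i)\<^sup>2) + (h1 * (s1 i j)\<^sup>2 + q1 * r i * r j * s1 i j)"
    using G.jacobi[OF ij] unfolding add.assoc power2_eq_square by (rule dvd_mult_left)
  moreover have "q1 dvd h1 * (s1 i j)\<^sup>2 + q1 * r i * r j * s1 i j"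
    using h_eq_0_mod_q(2) by (auto simp: mult.assoc)
  ultimately have "q1 dvd f i * (r j)\<^sup>2 + f j * (r i)\<^sup>2"
    by (simp only: dvd_add_left_iff)
  then show "q1 dvd e i * (r j)\<^sup>2 + e j * (r i)\<^sup>2"
    unfolding expand by (simp add: M_def mult.left_commute[of q0] mult.assoc)
qed

text \<open>
  The vectors \<open>e\<close> and \<open>r\<^sup>2\<close> are proportional modulo \<open>D\<close> by \<open>e_cross\<close>, and the factor is found by
  writing 1 as a combination of the entries of \<open>r\<^sup>2\<close>.
\<close>

lemma e_proportional_mod:
  assumes "1 = c + X\<^sup>2 * (r 0)\<^sup>2 + mat_apply n A (\<lambda>j. (r j)\<^sup>2) 0" "D dvd c" "D dvd M"
  obtains w where "\<And>i. i < n \<Longrightarrow> D dvd e i + w * (r i)\<^sup>2"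
proof
  fix i assume i: "i < n"
  let ?w = "X\<^sup>2 * e 0 + mat_apply n A e 0"
  have cross: "D dvd e i * (r j)\<^sup>2 + e j * (r i)\<^sup>2" if "j < n" for j
    using e_cross[OF i that] assms(3) dvd_trans by blast
  have "e i = e i * (c + X\<^sup>2 * (r 0)\<^sup>2 + mat_apply n A (\<lambda>j. (r j)\<^sup>2) 0)"
    using assms(1) by simp
  also have "\<dots> = c * e i + X\<^sup>2 * (e i * (r 0)\<^sup>2) + (\<Sum>j<n. smult (A 0 j) (e i * (r j)\<^sup>2))"
    by (simp add: mat_apply_def distrib_left sum_distrib_left mult_ac)
  finally have expand: "c * e i + X\<^sup>2 * (e i * (r 0)\<^sup>2) + (\<Sum>j<n. smult (A 0 j) (e i * (r j)\<^sup>2)) = e i"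
    by (rule sym)
  have "e i + ?w * (r i)\<^sup>2 =
      c * e i + X\<^sup>2 * (e i * (r 0)\<^sup>2) + (\<Sum>j<n. smult (A 0 j) (e i * (r j)\<^sup>2)) + ?w * (r i)\<^sup>2"
    by (simp only: expand)
  also have "\<dots> = c * e i + X\<^sup>2 * (e i * (r 0)\<^sup>2 + e 0 * (r i)\<^sup>2) +
      (\<Sum>j<n. smult (A 0 j) (e i * (r j)\<^sup>2 + e j * (r i)\<^sup>2))"
  proof -
    have w: "?w * (r i)\<^sup>2 = X\<^sup>2 * (e 0 * (r i)\<^sup>2) + (\<Sum>j<n. smult (A 0 j) (e j * (r i)\<^sup>2))"
      by (simp only: mat_apply_def distrib_right sum_distrib_right mult_smult_left mult.assoc)
    show ?thesis
      unfolding w by (simp only: smult_add_right sum.distrib distrib_left add_ac)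
  qed
  finally have eq: "e i + ?w * (r i)\<^sup>2 = \<dots>" .
  have "D dvd (\<Sum>j<n. smult (A 0 j) (e i * (r j)\<^sup>2 + e j * (r i)\<^sup>2))"
    using cross by (auto intro!: dvd_sum dvd_smult)
  then show "D dvd e i + ?w * (r i)\<^sup>2"
    unfolding eq by (intro dvd_add dvd_mult2[OF assms(2)] dvd_mult[OF cross[OF n_pos]])
qed

text \<open>
  The factors modulo \<open>q0\<close> and modulo \<open>q1\<close> are joined by the Chinese remainder theorem.
\<close>

lemma e_proportional:
  obtains w where "\<And>i. i < n \<Longrightarrow> M dvd e i + w * (r i)\<^sup>2"
proof -
  have dvd0: "q0 dvd q0\<^sup>2" "q0 dvd M" and dvd1: "q1 dvd q1\<^sup>2" "q1 dvd M"
    by (simp_all add: M_def power2_eq_square)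
  obtain w0 where w0: "\<And>i. i < n \<Longrightarrow> q0 dvd e i + w0 * (r i)\<^sup>2"
    by (rule e_proportional_mod[OF bezout0_square[OF n_pos] dvd0]) (rule that)
  obtain w1 where w1: "\<And>i. i < n \<Longrightarrow> q1 dvd e i + w1 * (r i)\<^sup>2"
    by (rule e_proportional_mod[OF bezout1_square[OF n_pos] dvd1]) (rule that)
  show thesis
  proof
    fix i assume i: "i < n"
    \<comment> \<open>Since \<open>q1 = q0 + 1\<close>, the coefficient \<open>q1\<close> is 1 modulo \<open>q0\<close>, and vice versa.\<close>
    let ?w = "q1 * w0 + q0 * w1"
    show "M dvd e i + ?w * (r i)\<^sup>2"
    proof (rule M_dvd)
      have eq0: "e i + ?w * (r i)\<^sup>2 = (e i + w0 * (r i)\<^sup>2) + q0 * ((w0 + w1) * (r i)\<^sup>2)"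
        by (simp add: q1 distrib_left distrib_right mult_ac add_ac)
      show "q0 dvd e i + ?w * (r i)\<^sup>2"
        unfolding eq0 using w0[OF i] by (rule dvd_add) simp
      have q0: "q0 = q1 + 1"
        by (simp add: q1)
      have eq1: "e i + ?w * (r i)\<^sup>2 = (e i + w1 * (r i)\<^sup>2) + q1 * ((w0 + w1) * (r i)\<^sup>2)"
        by (subst q0) (simp add: distrib_left distrib_right mult_ac add_ac)
      show "q1 dvd e i + ?w * (r i)\<^sup>2"
        unfolding eq1 using w1[OF i] by (rule dvd_add) simp
    qed
  qed
qed

text \<open>
  Let \<open>w\<close> be the factor between \<open>r\<^sup>2\<close> and \<open>e\<close> modulo \<open>M\<close>, and let \<open>p l\<close> be the remainder of
  \<open>w * X ^ (2 * l)\<close> modulo \<open>M\<close>. Expanding \<open>(r i)\<^sup>2\<close> gives \<open>e i = (\<Sum>l<m. coeff (r i) l * p l)\<close>. Since the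
  coefficient vectors are independent, \<open>degree_e\<close> bounds the degree of every \<open>p l\<close> by \<open>2 * m - 3\<close>. Hence
  multiplication by \<open>X\<^sup>2\<close> never requires a reduction, so \<open>p (m - 1) = X ^ (2 * (m - 1)) * p 0\<close>,
  which violates the bound unless \<open>p 0 = 0\<close>.
\<close>

lemma f_eq: "i < n \<Longrightarrow> f i = X\<^sup>2 * (r i)\<^sup>2 + M"
proof -
  obtain w where w: "\<And>i. i < n \<Longrightarrow> M dvd e i + w * (r i)\<^sup>2"
    by (rule e_proportional) (rule that)
  define p where "p l = (w * X ^ (2 * l)) mod M" for l
  have deg_p: "degree (p l) < degree M" for l
    using degree_mod_less[OF M_neq_0, of "w * X ^ (2 * l)"] degree_M H.m by (auto simp: p_def)
  have p: "M dvd w * X ^ (2 * l) + p l" for l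
    unfolding p_def by (metis bit_poly_diff dvd_minus_mod)
  have e_eq: "e i = (\<Sum>l<m. H.rc l i * p l)" if i: "i < n" for i
  proof -
    have "M dvd (\<Sum>l<m. H.rc l i * (w * X ^ (2 * l) + p l))"
      using p by (auto intro!: dvd_sum)
    also have "\<dots> = w * (r i)\<^sup>2 + (\<Sum>l<m. H.rc l i * p l)"
      by (simp add: r_square_eq[OF i] distrib_left sum.distrib sum_distrib_left mult_ac)
    finally have "M dvd (e i + w * (r i)\<^sup>2) + (w * (r i)\<^sup>2 + (\<Sum>l<m. H.rc l i * p l))"
      using w[OF i] by (rule dvd_add[rotated])
    then have "M dvd e i + (\<Sum>l<m. H.rc l i * p l)"
      by (simp add: add.assoc)
    moreover have "degree (\<Sum>l<m. H.rc l i * p l) < degree M"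
    proof (rule degree_sum_less)
      fix l
      have "degree (H.rc l i * p l) \<le> degree (p l)"
        using degree_mult_le[of "H.rc l i" "p l"] by (simp add: H.rc_def)
      then show "degree (H.rc l i * p l) < degree M"
        using deg_p[of l] by simp
    qed (use degree_M H.m in simp)
    moreover have "degree (e i) < degree M"
      using degree_e[OF i] degree_M by simp
    ultimately have "e i + (\<Sum>l<m. H.rc l i * p l) = 0"
      by (intro eq_0_if_dvd_degree_less[of M] degree_add_less)
    then show ?thesis
      by (simp only: bit_poly_add_eq_0_iff)
  qed
  have deg_p': "degree (p l) < 2 * m - 2" if l: "l < m" for l
  proof (rule degree_less_if_coeff_0)
    fix k assume k: "2 * m - 2 \<le> k"
    have "(\<Sum>l<m. coeff (p l) k * coeff (r i) l) = 0" if i: "i < n" for i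
    proof -
      have "(\<Sum>l<m. coeff (p l) k * coeff (r i) l) = coeff (e i) k"
        by (simp add: e_eq[OF i] coeff_sum H.rc_def mult.commute)
      also have "\<dots> = 0"
        using degree_e[OF i] k by (intro coeff_eq_0) simp
      finally show ?thesis .
    qed
    then show "coeff (p l) k = 0"
      using l by (rule coeff_r_independent)
  qed (use H.m in simp)
  have p_eq: "p l = X ^ (2 * l) * p 0" if "l < m" for l
    using that
  proof (induction l)
    case (Suc l)
    have "p (Suc l) = (X\<^sup>2 * (w * X ^ (2 * l))) mod M"
      by (simp add: p_def power2_eq_square mult_ac)
    also have "\<dots> = (X\<^sup>2 * p l) mod M"
      by (simp add: p_def mod_mult_right_eq)
    also have "\<dots> = X\<^sup>2 * p l"
      using degree_mult_le[of "X\<^sup>2" "p l"] deg_p'[of l] Suc.prems degree_M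
      by (intro mod_poly_less) (simp add: degree_power_eq)
    finally show ?case
      using Suc by (simp add: power2_eq_square mult_ac)
  qed simp
  have "p 0 = 0"
  proof (rule ccontr)
    assume "p 0 \<noteq> 0"
    then have "degree (p (m - 1)) = 2 * (m - 1) + degree (p 0)"
      using p_eq[of "m - 1"] H.m by (simp add: degree_mult_eq degree_power_eq)
    then show False
      using deg_p'[of "m - 1"] H.m by simp
  qed
  then have "p l = 0" if "l < m" for l
    using p_eq[OF that] by simp
  then have "e i = 0" if "i < n" for i
    using e_eq[OF that] by simp
  moreover assume "i < n"
  ultimately have "e i = 0" by simp
  then show ?thesis
    unfolding e_def by (simp only: add.assoc bit_poly_add_eq_0_iff)
qed

text \<open>
  With the values of \<open>f\<close> and \<open>h0\<close> now known, assumption \<open>jacobi\<close> is divisible by \<open>q0\<close> as a whole.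
\<close>

lemma jacobi_div_q0:
  assumes ij: "i < n" "j < n"
  shows "q0 dvd (r i)\<^sup>2 + (r j)\<^sup>2 + pderiv q0 * (s0 i j)\<^sup>2 + r i * r j * s0 i j"
proof -
  have "q0\<^sup>2 dvd f i * (r j)\<^sup>2 + f j * (r i)\<^sup>2 + h0 * (s0 i j)\<^sup>2 + q0 * r i * r j * s0 i j"
    by (rule H.jacobi[OF ij])
  also have "\<dots> = q0\<^sup>2 * ((r i)\<^sup>2 + (r j)\<^sup>2) +
      q0 * ((r i)\<^sup>2 + (r j)\<^sup>2 + pderiv q0 * (s0 i j)\<^sup>2 + r i * r j * s0 i j)"
    unfolding f_eq[OF ij(1)] f_eq[OF ij(2)] h0 M_eq
    by (simp add: distrib_left distrib_right mult_ac add_ac)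
  finally have "q0 * q0 dvd q0 * ((r i)\<^sup>2 + (r j)\<^sup>2 + pderiv q0 * (s0 i j)\<^sup>2 + r i * r j * s0 i j)"
    by (simp add: dvd_add_right_iff power2_eq_square)
  then show ?thesis
    using q0_neq_0 by simp
qed

lemma jacobi_div_q0_summed:
  assumes i: "i < n"
  shows "q0 dvd (r i)^3 + (\<Sum>j<n. (r j)\<^sup>2 * s0 j i) + pderiv q0 * (\<Sum>j<n. (s0 j i)^3) +
    r i * (\<Sum>j<n. r j * (s0 j i)\<^sup>2)"
proof -
  have "q0 dvd (\<Sum>j<n. s0 j i *
      ((r j)\<^sup>2 + (r i)\<^sup>2 + pderiv q0 * (s0 j i)\<^sup>2 + r j * r i * s0 j i))"
    using jacobi_div_q0 i by (intro dvd_sum dvd_mult) auto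
  also have "\<dots> = (\<Sum>j<n. (r i)\<^sup>2 * s0 j i + (r j)\<^sup>2 * s0 j i + pderiv q0 * (s0 j i)^3 +
      r i * (r j * (s0 j i)\<^sup>2))"
    by (intro sum.cong) (simp_all add: distrib_left power2_eq_square power3_eq_cube mult_ac add_ac)
  also have "\<dots> = (r i)^3 + (\<Sum>j<n. (r j)\<^sup>2 * s0 j i) + pderiv q0 * (\<Sum>j<n. (s0 j i)^3) +
    r i * (\<Sum>j<n. r j * (s0 j i)\<^sup>2)"
    using i by (simp add: sum.distrib H.sum_s' power2_eq_square power3_eq_cube mult.assoc
        flip: sum_distrib_left)
  finally show ?thesis .
qed

text \<open>
  By \<open>q0_eq\<close>, \<open>q0 = X * p\<^sup>2\<close> with \<open>p\<^sup>2 = pderiv q0\<close>, and \<open>m \<ge> 3\<close> makes \<open>p\<close> non-constant.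
  Modulo \<open>p\<close>, all terms but the first one vanish in \<open>X + X\<^sup>2\<close> times \<open>jacobi_div_q0_summed\<close>, so that
  \<open>p\<close> divides \<open>(X + X\<^sup>2) * (r j)^3\<close> for all \<open>j\<close>, and hence \<open>X + X\<^sup>2\<close>. So \<open>p\<close> has a root \<open>a\<close>, at which
  \<open>q0\<close> vanishes twice. As \<open>X + X\<^sup>2\<close> has only a simple root there, the sums in \<open>jacobi_div_q0_summed\<close>
  vanish at \<open>a\<close> as well, and then so does every \<open>r j\<close>, against \<open>bezout0\<close>.
\<close>

theorem contradiction: False
proof -
  obtain p where p: "pderiv q0 = p\<^sup>2"
    by (rule square_if_pderiv_eq_0[of "pderiv q0"]) simp_all
  have q0: "q0 = X * p\<^sup>2"
    using q0_eq p by simp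
  have "p \<noteq> 0"
    using q0 q0_neq_0 by auto
  then have "m = 1 + 2 * degree p"
    using H.deg_q unfolding q0 by (simp add: degree_mult_eq degree_power_eq)
  then have deg_p: "0 < degree p"
    using m_ge_3 by simp
  have p_q0: "p dvd q0"
    by (simp add: q0 power2_eq_square)
  have p_d: "p dvd pderiv q0"
    by (simp only: p power2_eq_square dvd_triv_left)
  have "p dvd X + X\<^sup>2"
  proof (rule dvd_if_dvd_bezout)
    show "1 = q0 ^ 4 + X ^ 4 * (r 0) ^ 4 + mat_apply n A1 (\<lambda>j. (r j) ^ 4) 0"
    proof -
      have "1 = (q0\<^sup>2 + X\<^sup>2 * (r 0)\<^sup>2 + mat_apply n A1 (\<lambda>j. (r j)\<^sup>2) 0)\<^sup>2"
        using bezout0_square[OF n_pos] by simp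
      then show ?thesis
        by (simp add: bit_poly_square_add power_mult_distrib mat_apply_square flip: power_mult)
    qed
    show "p dvd q0 ^ 4"
      using p_q0 by (meson dvd_power dvd_trans zero_less_numeral)
    fix j assume j: "j < n"
    let ?W = "\<Sum>i<n. (r i)\<^sup>2 * s0 i j" and ?W' = "\<Sum>i<n. r i * (s0 i j)\<^sup>2"
    have W: "p dvd (X + X\<^sup>2) * ?W" "p dvd (X + X\<^sup>2) * ?W'"
      unfolding H.sum_r_square_s[OF j] H.sum_r_s_square[OF j]
      using p_q0 by (simp_all add: power2_eq_square)
    have "p dvd (X + X\<^sup>2) * ((r j)^3 + ?W + pderiv q0 * (\<Sum>i<n. (s0 i j)^3) + r j * ?W')"
      using jacobi_div_q0_summed[OF j] p_q0 by (meson dvd_mult dvd_trans)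
    also have "\<dots> = (X + X\<^sup>2) * (r j)^3 + ((X + X\<^sup>2) * ?W +
        (X + X\<^sup>2) * (pderiv q0 * (\<Sum>i<n. (s0 i j)^3)) + r j * ((X + X\<^sup>2) * ?W'))"
      by (simp add: distrib_left mult_ac add_ac)
    finally have "p dvd (X + X\<^sup>2) * (r j)^3"
      using W p_d by (subst (asm) dvd_add_left_iff) (auto intro!: dvd_add)
    then have "p dvd r j * ((X + X\<^sup>2) * (r j)^3)"
      by simp
    also have "r j * ((X + X\<^sup>2) * (r j)^3) = (r j)^4 * (X + X\<^sup>2)"
      by (simp add: eval_nat_numeral mult_ac)
    finally show "p dvd (r j)^4 * (X + X\<^sup>2)" .
  qed (rule n_pos)
  then obtain z where z: "X + X\<^sup>2 = p * z"
    by blast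
  have X_root: "poly (X + X\<^sup>2) a = 0" for a
    by (cases a) (simp_all add: X_def power2_eq_square)
  \<comment> \<open>Otherwise the cofactor \<open>z\<close>, of degree at most 1, would vanish at both bits.\<close>
  have "\<exists>a. poly p a = 0"
  proof (rule ccontr)
    assume no_root: "\<nexists>a. poly p a = 0"
    then have roots: "poly z a = 0" for a
      using X_root[of a] z by (metis mult_eq_0_iff poly_mult)
    have "z \<noteq> 0"
      using z X_plus_X_square(1) by auto
    then have "degree z \<le> 1"
      using arg_cong[OF z, of degree] X_plus_X_square(2) \<open>p \<noteq> 0\<close> deg_p by (simp add: degree_mult_eq)
    then obtain a b where "z = [:a, b:]"
      by (metis One_nat_def degree1_coeffs degree_0_id le_Suc_eq le_zero_eq pCons_0_0)
    then show False
      using roots[of 0] roots[of 1] \<open>z \<noteq> 0\<close> by simp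
  qed
  then obtain a where a: "poly p a = 0" by blast
  then have "[:a, 1:] dvd p"
    using poly_eq_0_iff_dvd[of p a] by (simp add: uminus_bit_def)
  then obtain u where u: "p = [:a, 1:] * u"
    by (rule dvdE)
  have X_eq: "X + X\<^sup>2 = [:a, 1:] * [:a + 1, 1:]"
    by (cases a) (simp_all add: X_def power2_eq_square)
  have W0: "poly w a = 0" if w: "(X + X\<^sup>2) * w = q0 * (r j)\<^sup>2 + q0\<^sup>2 * r j" for w j
  proof -
    let ?t = "(r j)\<^sup>2 + q0 * r j"
    have q0_mult: "q0 * t = [:a, 1:] * ([:a, 1:] * (X * u\<^sup>2 * t))" for t
      by (simp only: q0 u power2_eq_square mult_ac)
    have "[:a, 1:] * ([:a + 1, 1:] * w) = (X + X\<^sup>2) * w"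
      by (simp only: X_eq mult.assoc)
    also have "\<dots> = q0 * ?t"
      unfolding w by (simp only: distrib_left power2_eq_square mult.assoc)
    also have "\<dots> = [:a, 1:] * ([:a, 1:] * (X * u\<^sup>2 * ?t))"
      by (rule q0_mult)
    finally have "[:a + 1, 1:] * w = [:a, 1:] * (X * u\<^sup>2 * ?t)"
      by (subst (asm) mult_left_cancel) simp_all
    then have "poly ([:a + 1, 1:] * w) a = 0"
      by simp
    then show ?thesis
      by (cases a) simp_all
  qed
  have r0: "poly (r i) a = 0" if i: "i < n" for i
  proof -
    have q0a: "poly q0 a = 0"
      using a by (simp add: q0 power2_eq_square)
    have da: "poly (pderiv q0) a = 0"
      using a by (simp only: p power2_eq_square poly_mult mult_zero_left)
    have "poly ((r i)^3 + (\<Sum>j<n. (r j)\<^sup>2 * s0 j i) + pderiv q0 * (\<Sum>j<n. (s0 j i)^3) +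
        r i * (\<Sum>j<n. r j * (s0 j i)\<^sup>2)) a = 0"
      using dvd_poly_root[OF jacobi_div_q0_summed[OF i] q0a] .
    then have "poly ((r i)^3) a = 0"
      using W0[OF H.sum_r_square_s[OF i]] W0[OF H.sum_r_s_square[OF i]] da
      by (simp only: poly_add poly_mult mult_zero_left mult_zero_right add_0_right)
    then show ?thesis
      by simp
  qed
  have "poly 1 a = poly (q0 + X * r 0 + mat_apply n A1 r 0) a"
    using bezout0[OF n_pos] by simp
  also have "\<dots> = 0"
    using r0 n_pos a by (simp add: q0 mat_apply_def poly_sum)
  finally show False by simp
qed

end

section \<open>Reading the adjugate identities modulo 4\<close>

definition halve :: "int poly \<Rightarrow> int poly" where
  "halve p = map_poly (\<lambda>c. c div 2) p"

lemma coeff_halve: "coeff (halve p) k = coeff p k div 2"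
  by (simp add: halve_def coeff_map_poly)

lemma two_halve:
  assumes "red p = 0"
  shows "2 * halve p = p"
proof (rule poly_eqI)
  fix k
  have "even (coeff p k)"
    using arg_cong[OF assms, of "\<lambda>t. coeff t k"] by (simp add: coeff_red split: if_splits)
  then show "coeff (2 * halve p) k = coeff p k"
    by (simp add: two_mult_poly coeff_halve)
qed

lemma bit_poly_add_swap: "a + b = c + d \<Longrightarrow> a + c = b + (d :: bit poly)"
  by (metis add.commute add.left_commute bit_poly_add_cancel)

lemma neq_0_if_coeff: "coeff p k = 1 \<Longrightarrow> p \<noteq> (0 :: 'a :: zero_neq_one poly)"
  by auto

text \<open>
  Jacobi's identity in the form in which it arises from \<open>P = Q\<^sup>2 + 2 \<gamma>\<close> in place of the determinant,
  diagonal entries \<open>y R\<^sup>2 + 2 F\<close> and off-diagonal entries \<open>y R R' + Q S + 2 w\<close>. Modulo 2 it is trivial;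
  half of the difference of its sides is the claim.
\<close>

lemma jacobi_mod_4:
  fixes y Q R R' S F F' \<gamma> u w :: "int poly"
  assumes "(y * R\<^sup>2 + 2 * F) * (y * R'\<^sup>2 + 2 * F') - (y * R * R' + Q * S + 2 * w)\<^sup>2 = (Q\<^sup>2 + 2 * \<gamma>) * (S\<^sup>2 + 2 * u)"
  shows "(red Q)\<^sup>2 dvd red y * (red F' * (red R)\<^sup>2 + red F * (red R')\<^sup>2)
    + red y * red Q * red R * red R' * red S + red \<gamma> * (red S)\<^sup>2"
proof -
  \<comment> \<open>Half of the two sides of the assumption, after \<open>y\<^sup>2 * R\<^sup>2 * R'\<^sup>2\<close> is cancelled and
    \<open>Q\<^sup>2 * S\<^sup>2\<close> is brought to the left.\<close>
  let ?l = "y * (F' * R\<^sup>2 + F * R'\<^sup>2) + 2 * (F * F') - Q\<^sup>2 * S\<^sup>2 - y * Q * R * R' * S - 2 * (w\<^sup>2 + w * (y * R * R' + Q * S))"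
  let ?r = "\<gamma> * S\<^sup>2 + Q\<^sup>2 * u + 2 * (\<gamma> * u)"
  have "2 * ?l = 2 * ?r"
    using assms by (simp add: power2_eq_square algebra_simps)
  then have "?l = ?r"
    by (simp only: mult_cancel_left) simp
  then have "red ?l = red ?r"
    by simp
  then have "(red y * (red F' * (red R)\<^sup>2 + red F * (red R')\<^sup>2) + red y * red Q * red R * red R' * red S)
      + (red Q)\<^sup>2 * (red S)\<^sup>2 = red \<gamma> * (red S)\<^sup>2 + (red Q)\<^sup>2 * red u"
    by (simp only: red_add red_mult red_diff red_power red_two mult_zero_left add_0_left add_0_right add_ac)
  then have "red y * (red F' * (red R)\<^sup>2 + red F * (red R')\<^sup>2)
    + red y * red Q * red R * red R' * red S + red \<gamma> * (red S)\<^sup>2 = (red Q)\<^sup>2 * ((red S)\<^sup>2 + red u)"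
    unfolding distrib_left[of "(red Q)\<^sup>2"] by (rule bit_poly_add_swap)
  then show ?thesis
    by (rule dvdI)
qed

context hollow_symmetric
begin

text \<open>
  The trace of \<open>A\<close> is zero, and so are the traces of its principal submatrices. In terms of the
  adjugate: the coefficient of \<open>\<phi>\<close> equals that of each \<open>a i i\<close>, while by \<open>sum_a_diag\<close> the sum of these
  \<open>n\<close> coefficients is only \<open>n - 1\<close> times the coefficient of \<open>\<phi>\<close>.
\<close>

lemma coeff_\<phi>_subtop:
  assumes "2 \<le> n"
  shows "coeff \<phi> (n - 1) = 0"
    and "i < n \<Longrightarrow> coeff (a i i) (n - 2) = 0"
proof -
  have rec: "coeff (a i i) (n - 2) = coeff \<phi> (n - 1)" if i: "i < n" for i
  proof -
    have "coeff (a i i) (n - 2) = coeff (pCons 0 (a i i)) (n - 1)"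
    proof -
      have "n - 1 = Suc (n - 2)"
        using assms by simp
      then show ?thesis
        by (simp only: coeff_pCons_Suc)
    qed
    also have "\<dots> = (\<Sum>k<n. A $$ (i, k) * coeff (a k i) (n - 1)) + coeff \<phi> (n - 1)"
      using i by (simp add: a_rec coeff_sum)
    also have "(\<Sum>k<n. A $$ (i, k) * coeff (a k i) (n - 1)) = 0"
    proof (rule sum.neutral, rule ballI)
      fix k assume "k \<in> {..<n}"
      then show "A $$ (i, k) * coeff (a k i) (n - 1) = 0"
        using i A_diag[of i] degree_a_off_diag[of k i] by (cases "k = i") auto
    qed
    finally show ?thesis by simp
  qed
  have "(\<Sum>i<n. coeff (a i i) (n - 2)) = coeff (pderiv \<phi>) (n - 2)"
    by (simp add: coeff_sum flip: sum_a_diag)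
  moreover have "Suc (n - 2) = n - 1"
    using assms by simp
  ultimately have "int n * coeff \<phi> (n - 1) = int (n - 1) * coeff \<phi> (n - 1)"
    by (simp add: rec coeff_pderiv del: of_nat_Suc)
  then show *: "coeff \<phi> (n - 1) = 0"
    using assms by (simp add: of_nat_diff)
  show "i < n \<Longrightarrow> coeff (a i i) (n - 2) = 0"
    using * by (simp add: rec)
qed

lemma degree_num: "0 < n \<Longrightarrow> degree num < n"
proof -
  assume "0 < n"
  have "degree num \<le> n - 1"
    unfolding num_def by (rule degree_sum_le) (use degree_row in auto)
  then show ?thesis using \<open>0 < n\<close> by simp
qed

definition b :: "nat \<Rightarrow> nat \<Rightarrow> int poly" where "b i j = adj (add_ones K) i j"

lemma det_add_ones_K: "det (add_ones K) = \<phi> + num"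
  by (simp add: det_add_ones[OF K] det_K num_def row_def a_def)

lemma coeff_\<phi>_num: "0 < n \<Longrightarrow> coeff (\<phi> + num) n = 1"
  using degree_num by (simp add: lead_\<phi> coeff_eq_0)

lemma \<phi>_num_neq_0: "0 < n \<Longrightarrow> \<phi> + num \<noteq> 0"
  by (rule neq_0_if_coeff[OF coeff_\<phi>_num])

lemma \<phi>_b:
  assumes "i < n" "j < n"
  shows "\<phi> * b i j = (\<phi> + num) * a i j - row i * row j"
  using adj_add_ones[OF K K_sym, of i j] assms \<phi>_num_neq_0
  by (simp add: b_def det_add_ones_K det_K a_def row_def)

lemma degree_b:
  assumes "i < n" "j < n"
  shows "degree (b i j) < n"
proof (cases "b i j = 0")
  case False
  have "degree ((\<phi> + num) * a i j) \<le> n + (n - 1)"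
  proof -
    have "degree (\<phi> + num) \<le> n"
      using degree_num degree_\<phi> assms by (intro degree_add_le) simp_all
    then show ?thesis
      using degree_mult_le[of "\<phi> + num" "a i j"] degree_a[of i j] assms by linarith
  qed
  moreover have "degree (row i * row j) \<le> n + (n - 1)"
    using degree_mult_le[of "row i" "row j"] degree_row[of i] degree_row[of j] assms by linarith
  ultimately have "degree (\<phi> * b i j) \<le> n + (n - 1)"
    using assms by (simp add: \<phi>_b degree_diff_le)
  then show ?thesis
    using False \<phi>_neq_0 assms by (simp add: degree_mult_eq degree_\<phi>)
qed (use assms in simp)

lemma jacobi_a:
  assumes "i < n" "j < n"
  obtains d where "\<phi> * d = a i i * a j j - (a i j)\<^sup>2"
proof -
  have "coeff (\<phi> + a j j) n = 1"
    using degree_a[of j j] assms by (simp add: lead_\<phi> coeff_eq_0)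
  then have "det K + adj K j j \<noteq> 0"
    using neq_0_if_coeff by (auto simp only: det_K a_def)
  from jacobi_complementary_minor[OF K assms this] that show thesis
    using a_sym[OF assms] by (auto simp: det_K a_def power2_eq_square)
qed

lemma jacobi_b:
  assumes "i < n" "j < n"
  obtains d where "(\<phi> + num) * d = b i i * b j j - (b i j)\<^sup>2"
proof -
  have N: "add_ones K \<in> carrier_mat n n"
    using K by (simp add: add_ones_def)
  have "coeff (\<phi> + num + b j j) n = 1"
    using degree_b[of j j] assms coeff_\<phi>_num by (simp add: coeff_eq_0)
  then have "det (add_ones K) + adj (add_ones K) j j \<noteq> 0"
    using neq_0_if_coeff by (auto simp only: det_add_ones_K b_def)
  moreover have "adj (add_ones K) j i = adj (add_ones K) i j"
    by (rule adj_symmetric[OF N]) (use K assms in \<open>auto simp: add_ones_def K_sym\<close>)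
  ultimately show thesis
    using jacobi_complementary_minor[OF N assms] that
    by (auto simp: det_add_ones_K b_def power2_eq_square)
qed

end

lemma monic_square_subtop:
  fixes R :: "'a :: comm_ring_1 poly"
  assumes "degree R \<le> Suc l" "coeff R (Suc l) = 1"
  shows "coeff (R\<^sup>2) (Suc (2 * l)) = 2 * coeff R l"
proof -
  define T where "T = R - monom 1 (Suc l)"
  have T: "degree T \<le> l"
  proof (rule degree_le, intro allI impI)
    fix k assume "l < k"
    then show "coeff T k = 0"
      using assms by (cases "k = Suc l") (simp_all add: T_def coeff_eq_0)
  qed
  have "R\<^sup>2 = monom 1 (Suc l + Suc l) + 2 * (monom 1 (Suc l) * T) + T\<^sup>2"
    by (simp add: T_def power2_eq_square algebra_simps mult_monom)
  moreover have "coeff (T\<^sup>2) (Suc (2 * l)) = 0"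
    using degree_mult_le[of T T] T by (intro coeff_eq_0) (simp add: power2_eq_square)
  moreover have "coeff (2 * (monom 1 (Suc l) * T)) (Suc (2 * l)) = 2 * coeff R l"
  proof -
    have "coeff (monom 1 (Suc l) * T) (Suc (2 * l)) = coeff T l"
      by (simp add: coeff_monom_mult)
    moreover have "coeff T l = coeff R l"
      by (simp add: T_def)
    ultimately show ?thesis
      by (simp only: mult_2[of "_ :: 'a poly"] mult_2[of "_ :: 'a"] coeff_add)
  qed
  ultimately show ?thesis
    by simp
qed

lemma coeff_square_double:
  fixes R :: "'a :: comm_semiring_1 poly"
  assumes "degree R \<le> l"
  shows "coeff (R\<^sup>2) (2 * l) = (coeff R l)\<^sup>2"
  using coeff_mult_degree_sum[of R R] assms degree_mult_le[of R R]
  by (cases "degree R = l") (auto simp: power2_eq_square mult_2 coeff_eq_0)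

lemma degree_less_if:
  assumes "degree p \<le> k" "coeff p k = 0" "0 < k"
  shows "degree p < k"
  using assms by (metis le_neq_implies_less leading_coeff_0_iff degree_0)

definition XZ :: "int poly" where
  "XZ = [:0, 1:]"

lemma red_XZ [simp]: "red XZ = X"
  by (simp add: XZ_def X_def)

lemma bit_poly_solve: "x = u + v + w \<Longrightarrow> v = u + x + (w :: bit poly)"
  by (simp add: add_ac)

text \<open>
  The matrix \<open>A\<close> together with the square roots \<open>q\<close> and \<open>r\<close>, and with the second binary digits \<open>F\<close> of
  the deck. The latter are parameters so that two matrices with the same deck can share them.
\<close>

locale even_hollow_symmetric = hollow_symmetric A n for A :: "int mat" and n :: nat +
  fixes m :: nat and q :: "bit poly" and r :: "nat \<Rightarrow> bit poly" and F :: "nat \<Rightarrow> int poly"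
  assumes n: "n = 2 * m" and m: "2 \<le> m"
    and red_\<phi>: "red \<phi> = q\<^sup>2"
    and a_diag_lift: "\<And>i. i < n \<Longrightarrow> a i i = XZ * (lift (r i))\<^sup>2 + 2 * F i"
begin

lemma red_a_diag: "i < n \<Longrightarrow> red (a i i) = X * (r i)\<^sup>2"
  by (simp add: a_diag_lift)

lemma q_neq_0: "q \<noteq> 0"
proof -
  have "coeff (red \<phi>) n = 1"
    by (simp add: coeff_red lead_\<phi>)
  then show ?thesis
    using neq_0_if_coeff red_\<phi> by fastforce
qed

lemma degree_q: "degree q = m" and lead_q: "coeff q m = 1"
proof -
  have "coeff (q\<^sup>2) n = 1"
    by (simp add: coeff_red lead_\<phi> flip: red_\<phi>)
  then show lead: "coeff q m = 1"
    by (simp add: n coeff_bit_poly_square)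
  have "degree (q\<^sup>2) \<le> n"
    using degree_red_le[of \<phi>] by (simp add: red_\<phi> degree_\<phi>)
  then have "degree q \<le> m"
    by (simp add: n degree_power_eq q_neq_0)
  then show "degree q = m"
    using lead by (metis le_degree le_antisym zero_neq_one)
qed

lemma degree_r: "i < n \<Longrightarrow> degree (r i) < m"
  and lead_r: "i < n \<Longrightarrow> coeff (r i) (m - 1) = 1"
proof -
  assume i: "i < n"
  have k: "n - 1 = Suc (2 * (m - 1))"
    using n m by simp
  have "coeff (X * (r i)\<^sup>2) (n - 1) = 1"
    using i lead_a_diag[OF i] by (simp add: coeff_red flip: red_a_diag)
  then show lead: "coeff (r i) (m - 1) = 1"
    unfolding k by (simp add: X_def coeff_bit_poly_square)
  then have "r i \<noteq> 0"
    by (rule neq_0_if_coeff)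
  have "degree (X * (r i)\<^sup>2) \<le> n - 1"
    using degree_red_le[of "a i i"] i by (simp add: red_a_diag degree_a_diag)
  then show "degree (r i) < m"
    using \<open>r i \<noteq> 0\<close> m n by (simp add: degree_mult_eq degree_power_eq)
qed

lemma red_row:
  assumes "i < n"
  shows "red (row i) = q * r i"
proof -
  have "X * (red (row i))\<^sup>2 = X * (q * r i)\<^sup>2"
    using red_row_square[OF assms] assms by (simp add: red_\<phi> red_a_diag power_mult_distrib mult_ac)
  then have "(red (row i))\<^sup>2 = (q * r i)\<^sup>2"
    by simp
  then show ?thesis
    by (simp only: bit_poly_square_eq_iff)
qed

lemma red_num: "red num = 0"
  by (simp add: num_half red_pderiv red_\<phi>)

definition s :: "nat \<Rightarrow> nat \<Rightarrow> bit poly" where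
  "s i j = (X * r i * r j + red (a i j)) div q"

text \<open>
  Jacobi's identity says that \<open>(X * r i * r j + red (a i j))\<^sup>2\<close> is \<open>q\<^sup>2\<close> times some polynomial. That
  polynomial has derivative 0 and hence is a square.
\<close>

lemma red_a:
  assumes "i < n" "j < n"
  shows "red (a i j) = X * r i * r j + q * s i j"
proof -
  obtain d where d: "\<phi> * d = a i i * a j j - (a i j)\<^sup>2"
    using jacobi_a[OF assms] .
  have d: "(X * r i * r j + red (a i j))\<^sup>2 = q\<^sup>2 * red d"
    using arg_cong[OF d, of red] assms
    by (simp add: red_\<phi> red_a_diag bit_poly_square_add power_mult_distrib power2_eq_square[of X] mult_ac)
  have "pderiv (q\<^sup>2 * red d) = 0"
    unfolding d[symmetric] by (rule pderiv_bit_poly_square)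
  then have "pderiv (red d) = 0"
    using q_neq_0 by (simp add: pderiv_mult)
  then obtain t where "red d = t\<^sup>2"
    by (rule square_if_pderiv_eq_0)
  with d have "X * r i * r j + red (a i j) = q * t"
    by (simp add: bit_poly_square_eq_iff flip: power_mult_distrib)
  moreover from this have "s i j = t"
    using q_neq_0 by (simp add: s_def)
  ultimately show ?thesis
    by (metis bit_poly_add_cancel)
qed

lemma s_sym: "i < n \<Longrightarrow> j < n \<Longrightarrow> s i j = s j i"
  by (simp add: s_def a_sym mult_ac)

lemma q_cancel: "q * u = q * v \<Longrightarrow> u = v"
  using q_neq_0 by simp

lemma sum_r: "(\<Sum>i<n. r i) = 0"
proof -
  have "red num = (\<Sum>i<n. q * r i)"
    unfolding num_def red_sum by (intro sum.cong) (simp_all add: red_row)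
  then have "q * (\<Sum>i<n. r i) = 0"
    by (simp add: red_num sum_distrib_left)
  then show ?thesis
    using q_neq_0 by simp
qed

abbreviation A_mod_2 :: "nat \<Rightarrow> nat \<Rightarrow> bit" where
  "A_mod_2 i j \<equiv> of_int (A $$ (i, j))"

lemma red_apply: "red (\<Sum>k<n. smult (A $$ (i, k)) (v k)) = mat_apply n A_mod_2 (\<lambda>k. red (v k)) i"
  by (simp add: mat_apply_def)

lemma red_pCons_0: "red (pCons 0 p) = X * red p"
  by (simp add: X_def)

lemma mat_apply_mult_left: "mat_apply n M (\<lambda>k. c * v k) i = c * mat_apply n M v i"
  by (simp add: mat_apply_def sum_distrib_left)

lemma mat_apply_add: "mat_apply n M (\<lambda>k. u k + v k) i = mat_apply n M u i + mat_apply n M v i"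
  by (simp add: mat_apply_def smult_add_right sum.distrib)

lemma mat_apply_cong: "(\<And>k. k < n \<Longrightarrow> u k = v k) \<Longrightarrow> mat_apply n M u i = mat_apply n M v i"
  by (simp add: mat_apply_def)

lemma apply_r:
  assumes i: "i < n"
  shows "mat_apply n A_mod_2 r i = X * r i + q"
proof -
  have "X * (q * r i) = mat_apply n A_mod_2 (\<lambda>k. red (row k)) i + q\<^sup>2"
    using arg_cong[OF row_rec[OF i], of red] i by (simp only: red_pCons_0 red_add red_apply red_\<phi> red_row)
  also have "mat_apply n A_mod_2 (\<lambda>k. red (row k)) i = mat_apply n A_mod_2 (\<lambda>k. q * r k) i"
    by (rule mat_apply_cong) (rule red_row)
  finally have "q * (X * r i) = q * (mat_apply n A_mod_2 r i + q)"
    by (simp add: mat_apply_mult_left power2_eq_square algebra_simps)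
  then have "X * r i = mat_apply n A_mod_2 r i + q"
    by (rule q_cancel)
  then show ?thesis
    by (simp add: add.commute add.left_commute)
qed

lemma apply_s:
  assumes "i < n" "j < n"
  shows "mat_apply n A_mod_2 (\<lambda>k. s k j) i = X * r j + X * s i j + (if i = j then q else 0)"
proof -
  have "X * red (a i j) = mat_apply n A_mod_2 (\<lambda>k. red (a k j)) i + (if i = j then q\<^sup>2 else 0)"
    using arg_cong[OF a_rec[OF assms], of red] unfolding red_pCons_0 red_add red_apply
    by (simp only: if_distrib[of red] red_\<phi> red_0)
  also have "mat_apply n A_mod_2 (\<lambda>k. red (a k j)) i = mat_apply n A_mod_2 (\<lambda>k. X * r j * r k + q * s k j) i"
    using assms by (intro mat_apply_cong) (simp add: red_a mult_ac)
  also have "\<dots> = X * r j * (X * r i + q) + q * mat_apply n A_mod_2 (\<lambda>k. s k j) i"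
    using assms by (simp only: mat_apply_add mat_apply_mult_left apply_r)
  finally have e: "X * (X * r i * r j) + q * (X * s i j) = X * (X * r i * r j) +
      q * (X * r j + mat_apply n A_mod_2 (\<lambda>k. s k j) i + (if i = j then q else 0))"
    using assms by (simp add: red_a power2_eq_square algebra_simps)
  have "X * s i j = X * r j + mat_apply n A_mod_2 (\<lambda>k. s k j) i + (if i = j then q else 0)"
    by (rule q_cancel) (use e in \<open>simp only: add_left_cancel\<close>)
  then show ?thesis
    by (rule bit_poly_solve)
qed

lemma sum_s:
  assumes i: "i < n"
  shows "(\<Sum>j<n. s i j) = r i"
proof -
  have "q * r i = (\<Sum>j<n. X * r i * r j + q * s i j)"
    unfolding red_row[OF i, symmetric] row_def red_sum using i by (intro sum.cong) (simp_all add: red_a)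
  also have "\<dots> = q * (\<Sum>j<n. s i j)"
    by (simp add: sum.distrib sum_r flip: sum_distrib_left)
  finally show ?thesis
    by (rule q_cancel[symmetric])
qed

end

lemma jacobi_difference_identity:
  fixes y :: "bit poly"
  shows "(y * (f' * a + f * b) + y * c + g * d) + ((y + 1) * (k' * a + k * b) + (y + 1) * c + (g + h) * d)
    = (f * b + f' * a + h * d + c) + (y + 1) * ((f + k) * b + (f' + k') * a)"
  by (simp add: algebra_simps)

context even_hollow_symmetric
begin

definition \<gamma> :: "int poly" where "\<gamma> = halve (\<phi> - (lift q)\<^sup>2)"
definition \<eta> :: "int poly" where "\<eta> = halve num"

lemma \<phi>_lift: "\<phi> = (lift q)\<^sup>2 + 2 * \<gamma>"
  using two_halve[of "\<phi> - (lift q)\<^sup>2"] by (simp add: \<gamma>_def red_\<phi>)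

lemma num_lift: "num = 2 * \<eta>"
  using two_halve[of num] by (simp add: \<eta>_def red_num)

lemma s_diag: "i < n \<Longrightarrow> s i i = 0"
  using red_a[of i i] q_neq_0 by (simp add: red_a_diag power2_eq_square mult.assoc)

text \<open>
  Since \<open>num\<close> is even, the entries of the two adjugates differ by the product of two row sums,
  divided by \<open>\<phi>\<close>.
\<close>

lemma red_b:
  assumes "i < n" "j < n"
  shows "red (b i j) = (X + 1) * r i * r j + q * s i j"
proof -
  have "q\<^sup>2 * red (b i j) = q\<^sup>2 * ((X + 1) * r i * r j + q * s i j)"
    using arg_cong[OF \<phi>_b[OF assms], of red] assms
    by (simp add: red_\<phi> red_num red_a red_row algebra_simps power2_eq_square)
  then show ?thesis
    using q_neq_0 by simp
qed

definition F' :: "nat \<Rightarrow> int poly" where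
  "F' i = halve (b i i - (XZ - 1) * (lift (r i))\<^sup>2)"

lemma b_diag_lift:
  assumes "i < n"
  shows "b i i = (XZ - 1) * (lift (r i))\<^sup>2 + 2 * F' i"
proof -
  have "red (b i i - (XZ - 1) * (lift (r i))\<^sup>2) = 0"
    using assms by (simp add: red_b s_diag power2_eq_square mult.assoc)
  from two_halve[OF this] show ?thesis
    by (simp add: F'_def)
qed

lemma obtain_lift:
  assumes "red p = red p'"
  obtains u where "p = p' + 2 * u"
  using assms unfolding red_eq_iff by blast

lemma jacobi_K:
  assumes "i < n" "j < n"
  shows "q\<^sup>2 dvd X * (red (F j) * (r i)\<^sup>2 + red (F i) * (r j)\<^sup>2) + X * (q * r i * r j * s i j) + red \<gamma> * (s i j)\<^sup>2"
proof -
  let ?R = "\<lambda>i. lift (r i)" and ?S = "lift (s i j)"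
  obtain d where d: "\<phi> * d = a i i * a j j - (a i j)\<^sup>2"
    using jacobi_a[OF assms] .
  have "q\<^sup>2 * red d = q\<^sup>2 * (s i j)\<^sup>2"
    using arg_cong[OF d, of red] assms
    by (simp add: red_\<phi> red_a_diag red_a bit_poly_square_add power_mult_distrib power2_eq_square[of X] mult_ac)
  then have "red d = red (?S\<^sup>2)"
    using q_neq_0 by simp
  then obtain u where u: "d = ?S\<^sup>2 + 2 * u"
    by (rule obtain_lift)
  have "red (a i j) = red (XZ * ?R i * ?R j + lift q * ?S)"
    using assms by (simp add: red_a)
  then obtain w where w: "a i j = XZ * ?R i * ?R j + lift q * ?S + 2 * w"
    by (rule obtain_lift)
  have "(XZ * (?R i)\<^sup>2 + 2 * F i) * (XZ * (?R j)\<^sup>2 + 2 * F j)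
      - (XZ * ?R i * ?R j + lift q * ?S + 2 * w)\<^sup>2 = ((lift q)\<^sup>2 + 2 * \<gamma>) * (?S\<^sup>2 + 2 * u)"
    using d unfolding u w a_diag_lift[OF assms(1)] a_diag_lift[OF assms(2)] \<phi>_lift by (rule sym)
  from jacobi_mod_4[OF this] show ?thesis
    by (simp add: mult.assoc)
qed

text \<open>
  The same for \<open>K + J\<close>. In its adjugate the factor \<open>X\<close> is replaced by \<open>X + 1\<close>, by \<open>red_b\<close>.
\<close>

lemma jacobi_K_J:
  assumes "i < n" "j < n"
  shows "q\<^sup>2 dvd (X + 1) * (red (F' j) * (r i)\<^sup>2 + red (F' i) * (r j)\<^sup>2) + (X + 1) * (q * r i * r j * s i j)
    + (red \<gamma> + red \<eta>) * (s i j)\<^sup>2"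
proof -
  let ?R = "\<lambda>i. lift (r i)" and ?S = "lift (s i j)" and ?y = "XZ - 1"
  have y: "red ?y = X + 1"
    by simp
  obtain d where d: "(\<phi> + num) * d = b i i * b j j - (b i j)\<^sup>2"
    using jacobi_b[OF assms] .
  have "q\<^sup>2 * red d = ((X + 1) * r i * r i) * ((X + 1) * r j * r j) + ((X + 1) * r i * r j + q * s i j)\<^sup>2"
    using arg_cong[OF d, of red] assms by (simp add: red_\<phi> red_num red_b s_diag)
  also have "\<dots> = q\<^sup>2 * (s i j)\<^sup>2"
    unfolding bit_poly_square_add by (simp add: power2_eq_square mult_ac)
  finally have "red d = red (?S\<^sup>2)"
    using q_neq_0 by simp
  then obtain u where u: "d = ?S\<^sup>2 + 2 * u"
    by (rule obtain_lift)
  have "red (b i j) = red (?y * ?R i * ?R j + lift q * ?S)"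
    using assms by (simp only: red_b red_add red_mult red_lift y)
  then obtain w where w: "b i j = ?y * ?R i * ?R j + lift q * ?S + 2 * w"
    by (rule obtain_lift)
  have \<phi>_num: "\<phi> + num = (lift q)\<^sup>2 + 2 * (\<gamma> + \<eta>)"
    using \<phi>_lift num_lift by (simp add: algebra_simps)
  have "(?y * (?R i)\<^sup>2 + 2 * F' i) * (?y * (?R j)\<^sup>2 + 2 * F' j)
      - (?y * ?R i * ?R j + lift q * ?S + 2 * w)\<^sup>2 = ((lift q)\<^sup>2 + 2 * (\<gamma> + \<eta>)) * (?S\<^sup>2 + 2 * u)"
    using d unfolding u w b_diag_lift[OF assms(1)] b_diag_lift[OF assms(2)] \<phi>_num by (rule sym)
  from jacobi_mod_4[OF this] show ?thesis
    unfolding y by (simp add: mult.assoc)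
qed

text \<open>
  The diagonal case of \<open>\<phi>_b\<close>, modulo 4. It makes the sums \<open>F i + F' i\<close> proportional to \<open>(r i)\<^sup>2\<close>.
\<close>

lemma num_diag:
  assumes "i < n"
  shows "q\<^sup>2 * (red (F i) + red (F' i)) = (r i)\<^sup>2 * (red \<gamma> + X * red \<eta>)"
proof -
  let ?R = "lift (r i)" and ?Q = "lift q"
  have "red (row i) = red (?Q * ?R)"
    using assms by (simp add: red_row)
  then obtain \<rho> where \<rho>: "row i = ?Q * ?R + 2 * \<rho>"
    by (rule obtain_lift)
  have "(?Q\<^sup>2 + 2 * \<gamma>) * ((XZ - 1) * ?R\<^sup>2 + 2 * F' i) =
      (?Q\<^sup>2 + 2 * \<gamma> + 2 * \<eta>) * (XZ * ?R\<^sup>2 + 2 * F i) - (?Q * ?R + 2 * \<rho>) * (?Q * ?R + 2 * \<rho>)"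
    using \<phi>_b[OF assms assms] unfolding \<rho> b_diag_lift[OF assms] a_diag_lift[OF assms] num_lift \<phi>_lift .
  then have "2 * (?Q\<^sup>2 * F' i - \<gamma> * ?R\<^sup>2 + 2 * (\<gamma> * F' i)) =
      2 * (?Q\<^sup>2 * F i + \<eta> * XZ * ?R\<^sup>2 + 2 * (\<gamma> * F i + \<eta> * F i - \<rho> * ?Q * ?R - \<rho> * \<rho>))"
    by (simp add: power2_eq_square algebra_simps)
  then have "?Q\<^sup>2 * F' i - \<gamma> * ?R\<^sup>2 + 2 * (\<gamma> * F' i) =
      ?Q\<^sup>2 * F i + \<eta> * XZ * ?R\<^sup>2 + 2 * (\<gamma> * F i + \<eta> * F i - \<rho> * ?Q * ?R - \<rho> * \<rho>)"
    by (simp only: mult_cancel_left) simp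
  from arg_cong[OF this, of red]
  have "q\<^sup>2 * red (F' i) + red \<gamma> * (r i)\<^sup>2 = q\<^sup>2 * red (F i) + red \<eta> * X * (r i)\<^sup>2"
    by simp
  from bit_poly_add_swap[OF this] show ?thesis
    by (simp add: algebra_simps)
qed

lemma num_dvd: "i < n \<Longrightarrow> q\<^sup>2 dvd (r i)\<^sup>2 * (red \<gamma> + X * red \<eta>)"
  using num_diag by (metis dvd_triv_left)

text \<open>
  In the sum of \<open>jacobi_K\<close> and \<open>jacobi_K_J\<close> the unknown \<open>\<gamma>\<close> cancels, and by \<open>num_diag\<close> so do the terms
  with \<open>F i + F' i\<close>.
\<close>

lemma jacobi_difference:
  assumes ij: "i < n" "j < n"
  shows "q\<^sup>2 dvd red (F i) * (r j)\<^sup>2 + red (F j) * (r i)\<^sup>2 + red \<eta> * (s i j)\<^sup>2 + q * r i * r j * s i j"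
proof -
  let ?t = "\<lambda>i. red (F i) + red (F' i)"
  have "q\<^sup>2 * (?t i * (r j)\<^sup>2) = (r i)\<^sup>2 * (red \<gamma> + X * red \<eta>) * (r j)\<^sup>2"
    using num_diag[OF ij(1)] by (simp only: mult.assoc[symmetric])
  also have "\<dots> = (r j)\<^sup>2 * (red \<gamma> + X * red \<eta>) * (r i)\<^sup>2"
    by (simp only: mult_ac)
  also have "\<dots> = q\<^sup>2 * (?t j * (r i)\<^sup>2)"
    using num_diag[OF ij(2)] by (simp only: mult.assoc[symmetric])
  finally have cross: "?t i * (r j)\<^sup>2 = ?t j * (r i)\<^sup>2"
    using q_neq_0 by simp
  from dvd_add[OF jacobi_K[OF ij] jacobi_K_J[OF ij]] show ?thesis
    unfolding jacobi_difference_identity cross by simp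
qed

lemma degree_halve: "degree (halve p) \<le> degree p"
  by (rule degree_le) (simp add: coeff_halve coeff_eq_0)

lemma degree_red_less: "degree p < k \<Longrightarrow> degree (red p) < k"
  using degree_red_le[of p] by simp

lemma degree_\<gamma>: "degree (red \<gamma>) < 2 * m"
proof -
  have Q: "degree (lift q) \<le> m" "coeff (lift q) m = 1"
    using degree_lift[of q] by (simp_all add: degree_q coeff_lift lead_q)
  have "degree ((lift q)\<^sup>2) \<le> 2 * m"
    using degree_mult_le[of "lift q" "lift q"] Q by (simp add: power2_eq_square)
  then have "degree (\<phi> - (lift q)\<^sup>2) \<le> 2 * m"
    by (simp add: degree_diff_le degree_\<phi> n)
  moreover have "coeff (\<phi> - (lift q)\<^sup>2) (2 * m) = 0"
    using lead_\<phi> coeff_square_double[OF Q(1)] Q(2) by (simp add: n)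
  ultimately have "degree (\<phi> - (lift q)\<^sup>2) < 2 * m"
    using m by (intro degree_less_if) simp_all
  then show ?thesis
    using degree_halve[of "\<phi> - (lift q)\<^sup>2"] by (intro degree_red_less) (simp add: \<gamma>_def)
qed

lemma degree_\<eta>: "degree (red \<eta>) < 2 * m"
proof (rule degree_red_less)
  have "degree num < n"
    using m n by (intro degree_num) simp
  then show "degree \<eta> < 2 * m"
    using degree_halve[of num] unfolding \<eta>_def n[symmetric] by simp
qed

text \<open>
  The coefficient of \<open>a i i\<close> in degree \<open>2 * m - 2\<close> is zero, whereas that of \<open>x * (lift (r i))\<^sup>2\<close> is twice
  the second coefficient of \<open>lift (r i)\<close>.
\<close>

lemma F_bounds:
  assumes i: "i < n"
  shows "degree (red (F i)) < 2 * m - 1"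
    and "coeff (red (F i)) (2 * m - 2) = coeff (r i) (m - 2)"
proof -
  obtain l where l: "m = Suc (Suc l)"
    using m by (metis Suc_le_D numeral_2_eq_2 Suc_le_mono)
  let ?R = "lift (r i)"
  have R: "degree ?R \<le> Suc l" "coeff ?R (Suc l) = 1"
    using degree_lift[of "r i"] degree_r[OF i] lead_r[OF i] by (simp_all add: l coeff_lift)
  have "degree (?R\<^sup>2) \<le> 2 * Suc l"
    using degree_mult_le[of ?R ?R] R by (simp add: power2_eq_square)
  then have "degree (XZ * ?R\<^sup>2) \<le> 2 * m - 1"
    by (simp add: l XZ_def degree_pCons_le)
  then have deg: "degree (2 * F i) \<le> 2 * m - 1"
    using a_diag_lift[OF i] degree_a_diag[OF i] degree_diff_le[of "a i i" "2 * m - 1" "XZ * ?R\<^sup>2"]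
    by (simp add: n)
  have "coeff (2 * F i) (2 * m - 1) = 0"
    using arg_cong[OF a_diag_lift[OF i], of "\<lambda>p. coeff p (2 * m - 1)"] lead_a_diag[OF i]
      coeff_square_double[OF R(1)] R(2) by (simp add: n l XZ_def)
  then have "degree (2 * F i) < 2 * m - 1"
    using deg m by (intro degree_less_if) simp_all
  then show "degree (red (F i)) < 2 * m - 1"
    by (intro degree_red_less) (simp add: two_mult_poly)
  have "coeff (a i i) (2 * m - 2) = 0"
    using coeff_\<phi>_subtop(2)[OF _ i] m by (simp add: n)
  then have "2 * coeff ?R l + 2 * coeff (F i) (2 * m - 2) = 0"
    using arg_cong[OF a_diag_lift[OF i], of "\<lambda>p. coeff p (2 * m - 2)"] monic_square_subtop[OF R]
    by (simp add: l two_mult_poly XZ_def)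
  then have "coeff (F i) (2 * m - 2) = - coeff ?R l"
    by simp
  then show "coeff (red (F i)) (2 * m - 2) = coeff (r i) (m - 2)"
    by (simp add: coeff_red coeff_lift l)
qed

lemma reduced_graph:
  "reduced_graph n m A_mod_2 q (red \<gamma>) (red \<eta>) r (\<lambda>i. red (F i)) s"
proof
  show "2 \<le> m" by (rule m)
  show "degree q = m" "coeff q m = 1" by (rule degree_q lead_q)+
  show "degree (red \<gamma>) < 2 * m" "degree (red \<eta>) < 2 * m"
    by (rule degree_\<gamma> degree_\<eta>)+
  show "(\<Sum>i<n. r i) = 0" by (rule sum_r)
  fix i assume i: "i < n"
  show "degree (r i) < m" "coeff (r i) (m - 1) = 1"
    using i by (rule degree_r lead_r)+
  show "degree (red (F i)) < 2 * m - 1" "coeff (red (F i)) (2 * m - 2) = coeff (r i) (m - 2)"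
    using i by (rule F_bounds)+
  show "mat_apply n A_mod_2 r i = X * r i + q" "(\<Sum>j<n. s i j) = r i"
    "q\<^sup>2 dvd (r i)\<^sup>2 * (red \<gamma> + X * red \<eta>)"
    using i by (rule apply_r sum_s num_dvd)+
  fix j assume j: "j < n"
  show "A_mod_2 i j = A_mod_2 j i" using i j by (simp add: A_sym)
  show "s i j = s j i" using i j by (rule s_sym)
  show "mat_apply n A_mod_2 (\<lambda>k. s k j) i = X * r j + X * s i j + (if i = j then q else 0)"
    using i j by (rule apply_s)
  show "q\<^sup>2 dvd red (F i) * (r j)\<^sup>2 + red (F j) * (r i)\<^sup>2 + red \<eta> * (s i j)\<^sup>2 + q * r i * r j * s i j"
    using i j by (rule jacobi_difference)
qed

end

section \<open>The parity of the constant term\<close>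

context hollow_symmetric
begin

text \<open>
  The coefficients of odd degree are even.
\<close>

lemma red_\<phi>_square:
  assumes "even n"
  obtains q where "red \<phi> = q\<^sup>2"
proof -
  have "red (pderiv \<phi>) = 0"
  proof (rule poly_eqI)
    fix k
    have "even (coeff (pderiv \<phi>) k)"
    proof (cases "odd k \<or> n < Suc k")
      case True
      then show ?thesis
        by (auto simp: coeff_pderiv degree_\<phi> coeff_eq_0 simp del: of_nat_Suc)
    next
      case False
      then have "odd (n - Suc k)" "Suc k \<le> n"
        using assms by auto
      then show ?thesis
        by (simp add: coeff_pderiv even_coeff_\<phi> del: of_nat_Suc)
    qed
    then show "coeff (red (pderiv \<phi>)) k = coeff 0 k"
      by (simp add: coeff_red)
  qed
  then have "pderiv (red \<phi>) = 0"
    by (simp add: red_pderiv)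
  then show thesis
    by (rule square_if_pderiv_eq_0) (rule that)
qed

text \<open>
  Differentiating \<open>red_row_square\<close> shows that the square of the row sum is \<open>q\<^sup>2\<close> times the derivative of
  the diagonal entry, and that derivative is itself a square.
\<close>

lemma red_a_diag_square:
  assumes \<phi>: "red \<phi> = q\<^sup>2" and i: "i < n"
  shows "\<exists>t. red (a i i) = X * t\<^sup>2"
proof -
  have "red \<phi> \<noteq> 0"
    by (rule neq_0_if_coeff[of _ n]) (simp add: coeff_red lead_\<phi>)
  then have q: "q \<noteq> 0"
    using \<phi> by auto
  have row: "q\<^sup>2 * red (a i i) = X * (red (row i))\<^sup>2"
    using red_row_square[OF i] by (simp add: \<phi>)
  from arg_cong[OF row, of pderiv]
  have deriv: "q\<^sup>2 * pderiv (red (a i i)) = (red (row i))\<^sup>2"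
    by (simp add: pderiv_mult)
  obtain t where "pderiv (red (a i i)) = t\<^sup>2"
    by (rule square_if_pderiv_eq_0) (rule pderiv_pderiv_bit)
  with deriv row have "q\<^sup>2 * red (a i i) = q\<^sup>2 * (X * t\<^sup>2)"
    by (metis mult.left_commute)
  then show ?thesis
    using q by auto
qed

end

context same_deck
begin

text \<open>
  If the constant terms had different parities, the two matrices would form an instance of
  \<open>coupled_graphs\<close>.
\<close>

lemma odd_const_transfer:
  assumes "3 \<le> n" and odd_G: "odd (coeff G.\<phi> 0)"
  shows "odd (coeff H.\<phi> 0)"
proof
  assume even_H: "even (coeff H.\<phi> 0)"
  have "even n"
    using G.even_coeff_\<phi>[of 0] odd_G by auto
  then obtain m where n: "n = 2 * m"
    by (rule evenE)
  then have m: "2 \<le> m"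
    using assms(1) by simp
  obtain q where q: "red H.\<phi> = q\<^sup>2"
    using H.red_\<phi>_square[OF \<open>even n\<close>] .
  obtain r where r: "\<And>i. i < n \<Longrightarrow> red (H.a i i) = X * (r i)\<^sup>2"
    using H.red_a_diag_square[OF q] by metis
  define F where "F i = halve (H.a i i - XZ * (lift (r i))\<^sup>2)" for i
  have F: "H.a i i = XZ * (lift (r i))\<^sup>2 + 2 * F i" if "i < n" for i
    using two_halve[of "H.a i i - XZ * (lift (r i))\<^sup>2"] r[OF that] by (simp add: F_def)
  have "odd (coeff G.\<phi> 0 - coeff H.\<phi> 0)"
    using odd_G even_H by simp
  then obtain z where z: "coeff G.\<phi> 0 - coeff H.\<phi> 0 = 2 * z + 1"
    by (rule oddE)
  have \<phi>_G: "G.\<phi> = H.\<phi> + 1 + 2 * [:z:]"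
    by (subst \<phi>_diff) (simp add: z one_pCons numeral_poly)
  then have "red G.\<phi> = (q + 1)\<^sup>2"
    by (simp add: q bit_poly_square_add)
  then interpret GE: even_hollow_symmetric A n m "q + 1" r F
    by unfold_locales (simp_all add: n m F a_diag_eq)
  interpret HE: even_hollow_symmetric B n m q r F
    by unfold_locales (simp_all add: n m q F)
  have q_0: "coeff q 0 = 0"
    using arg_cong[OF q, of "\<lambda>p. coeff p 0"] even_H by (simp add: coeff_red coeff_bit_poly_square)
  have "lift (q + 1) = lift q + 1"
  proof (rule poly_eqI)
    fix k
    show "coeff (lift (q + 1)) k = coeff (lift q + 1) k"
      using q_0 by (cases k) (simp_all add: coeff_lift)
  qed
  then have "2 * GE.\<gamma> = 2 * (HE.\<gamma> - lift q + [:z:])"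
    using GE.\<phi>_lift HE.\<phi>_lift \<phi>_G by (simp add: power2_eq_square algebra_simps)
  then have "GE.\<gamma> = HE.\<gamma> - lift q + [:z:]"
    by (simp only: mult_cancel_left) simp
  then have "red GE.\<gamma> = red HE.\<gamma> + q + [:of_int z:]"
    by simp
  then show False
    using coupled_graphs.contradiction[OF coupled_graphs.intro[OF GE.reduced_graph HE.reduced_graph
        coupled_graphs_axioms.intro]] q_0 assms(1) by auto
qed

end

theorem (in same_deck) const_parity:
  assumes "3 \<le> n"
  shows "even (coeff G.\<phi> 0 - coeff H.\<phi> 0)"
proof -
  interpret swap: same_deck B A n
    by unfold_locales (simp add: deck)
  show ?thesis
    using odd_const_transfer[OF assms] swap.odd_const_transfer[OF assms] by auto
qed

section \<open>Graphs\<close>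

context hollow_symmetric
begin

text \<open>
  The characteristic matrix of the complement is \<open>- (K + J)\<close> after the substitution of \<open>- 1 - x\<close> for \<open>x\<close>.
\<close>

lemma char_poly_complement:
  assumes A': "A' \<in> carrier_mat n n"
    and entries: "\<And>i j. i < n \<Longrightarrow> j < n \<Longrightarrow> A' $$ (i, j) = (if i = j then 0 else 1 - A $$ (i, j))"
  shows "char_poly A' = (- 1) ^ n * ((\<phi> + num) \<circ>\<^sub>p [:- 1, - 1:])"
proof -
  have N: "add_ones K \<in> carrier_mat n n"
    using K by (simp add: add_ones_def)
  let ?N = "map_mat (\<lambda>p. p \<circ>\<^sub>p [:- 1, - 1:]) (add_ones K)"
  have "char_poly_matrix A' = (- 1) \<cdot>\<^sub>m ?N"
  proof (rule eq_matI)
    fix i j assume "i < dim_row ((- 1) \<cdot>\<^sub>m ?N)" "j < dim_col ((- 1) \<cdot>\<^sub>m ?N)"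
    then have ij: "i < n" "j < n"
      using N by auto
    then have "add_ones K $$ (i, j) = (if i = j then [:0, 1:] else 0) - [:A $$ (i, j):] + 1"
      using K by (simp add: add_ones_def K_index)
    then show "char_poly_matrix A' $$ (i, j) = ((- 1) \<cdot>\<^sub>m ?N) $$ (i, j)"
      using ij N A' A_diag[of i]
      by (auto simp: char_poly_matrix_def entries pcompose_pCons pcompose_diff pcompose_add one_pCons)
  qed (use A' N in \<open>auto simp: char_poly_matrix_def\<close>)
  then have "char_poly A' = (- 1) ^ n * det ?N"
    using N by (simp add: char_poly_def)
  also have "det ?N = det (add_ones K) \<circ>\<^sub>p [:- 1, - 1:]"
    by (rule comm_ring_hom.hom_det[OF pcompose_hom.comm_ring_hom_axioms])
  finally show ?thesis
    by (simp add: det_add_ones_K)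
qed

lemma walks_eq:
  assumes "i < n"
  shows "((A ^\<^sub>m k) *\<^sub>v vec n (\<lambda>_. 1)) $ i = walks k i"
  using assms
proof (induction k arbitrary: i)
  case 0
  then show ?case
    using A by simp
next
  case (Suc k)
  have pow: "A ^\<^sub>m k \<in> carrier_mat n n" for k
    by (rule pow_carrier_mat[OF A])
  have "A ^\<^sub>m Suc k = A * A ^\<^sub>m k" for k
  proof (induction k)
    case 0
    then show ?case
      using A by simp
  next
    case (Suc k)
    have "A ^\<^sub>m Suc (Suc k) = A * A ^\<^sub>m k * A"
      using Suc by simp
    also have "\<dots> = A * (A ^\<^sub>m k * A)"
      by (rule assoc_mult_mat[OF A pow A])
    finally show ?case by simp
  qed
  then have "(A ^\<^sub>m Suc k) *\<^sub>v vec n (\<lambda>_. 1) = A *\<^sub>v ((A ^\<^sub>m k) *\<^sub>v vec n (\<lambda>_. 1))"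
    using assoc_mult_mat_vec[OF A pow] by simp
  moreover have "(A *\<^sub>v v) $ i = (\<Sum>j<n. A $$ (i, j) * v $ j)" if "v \<in> carrier_vec n" for v
    using that A Suc.prems by (simp add: scalar_prod_def atLeast0LessThan)
  moreover have "(A ^\<^sub>m k) *\<^sub>v vec n (\<lambda>_. 1) \<in> carrier_vec n"
    by (rule mult_mat_vec_carrier[OF pow]) simp
  ultimately show ?case
    using Suc.IH by (simp del: pow_mat.simps)
qed

end

context same_deck
begin

lemma char_poly_complement_cong:
  assumes n: "3 \<le> n"
    and A': "A' \<in> carrier_mat n n"
      "\<And>i j. i < n \<Longrightarrow> j < n \<Longrightarrow> A' $$ (i, j) = (if i = j then 0 else 1 - A $$ (i, j))"
    and B': "B' \<in> carrier_mat n n"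
      "\<And>i j. i < n \<Longrightarrow> j < n \<Longrightarrow> B' $$ (i, j) = (if i = j then 0 else 1 - B $$ (i, j))"
  obtains \<delta> g where "char_poly A' = char_poly B' + [:2 * \<delta>:] + 4 * g"
proof -
  obtain \<epsilon> where \<epsilon>: "coeff G.\<phi> 0 - coeff H.\<phi> 0 = 2 * \<epsilon>"
    using const_parity[OF n] by (rule evenE)
  obtain g where g: "G.num = H.num + 4 * g"
    using num_cong_4[OF const_parity[OF n]] by blast
  have "G.\<phi> = H.\<phi> + [:2 * \<epsilon>:]"
    using \<phi>_diff \<epsilon> by simp
  then have "char_poly A' = (- 1) ^ n * ((H.\<phi> + [:2 * \<epsilon>:] + (H.num + 4 * g)) \<circ>\<^sub>p [:- 1, - 1:])"
    by (simp add: G.char_poly_complement[OF A'] g)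
  also have "(H.\<phi> + [:2 * \<epsilon>:] + (H.num + 4 * g)) \<circ>\<^sub>p [:- 1, - 1:] =
      (H.\<phi> + H.num) \<circ>\<^sub>p [:- 1, - 1:] + [:2 * \<epsilon>:] + 4 * (g \<circ>\<^sub>p [:- 1, - 1:])"
    by (simp add: pcompose_add pcompose_mult pcompose_pCons pcompose_smult numeral_poly)
  finally have "char_poly A' = char_poly B' + (- 1) ^ n * [:2 * \<epsilon>:] + 4 * ((- 1) ^ n * (g \<circ>\<^sub>p [:- 1, - 1:]))"
    by (simp add: H.char_poly_complement[OF B'] algebra_simps)
  moreover have "(- 1) ^ n * [:2 * \<epsilon>:] = [:2 * ((- 1) ^ n * \<epsilon>):]"
    by (simp add: minus_one_power_iff)
  ultimately show thesis
    using that by metis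
qed

end

lemma adjacency_matrix_carrier:
  "verts G = {1..n} \<Longrightarrow> adjacency_matrix G \<in> carrier_mat n n"
  by (simp add: adjacency_matrix_def Let_def)

lemma hollow_symmetric_adjacency_matrix:
  fixes G :: "(nat, 'b) pre_digraph"
  assumes "graph G" and verts: "verts G = {1..n}"
  shows "hollow_symmetric (adjacency_matrix G) n"
proof -
  interpret graph G by fact
  show ?thesis
  proof
    show "adjacency_matrix G \<in> carrier_mat n n"
      by (rule adjacency_matrix_carrier[OF verts])
    show "adjacency_matrix G $$ (i, j) = adjacency_matrix G $$ (j, i)" if "i < n" "j < n" for i j
      using that sym_arcs by (auto simp: adjacency_matrix_index[OF verts] symmetric_def sym_def)
    show "adjacency_matrix G $$ (i, i) = 0" if "i < n" for i
    proof -
      have "(Suc i, Suc i) \<notin> arcs_ends G"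
        using no_loops by (fastforce simp: arcs_ends_conv)
      then show ?thesis
        using that by (simp add: adjacency_matrix_index[OF verts])
    qed
  qed
qed

lemma adjacency_matrix_del_vert:
  fixes G :: "(nat, 'b) pre_digraph"
  assumes verts: "verts G = {1..n}" and i: "i < n"
  shows "adjacency_matrix (pre_digraph.del_vert G (Suc i)) = mat_delete (adjacency_matrix G) i i"
proof -
  let ?D = "pre_digraph.del_vert G (Suc i)"
  have verts_D: "verts ?D = {1..n} - {Suc i}"
    using verts by (simp add: pre_digraph.verts_del_vert)
  have card_D: "card (verts ?D) = n - 1"
    using i by (simp add: verts_D)
  let ?vs = "map (\<lambda>k. Suc (insert_index i k)) [0..<n - 1]"
  have "sorted_wrt (<) ?vs"
    unfolding sorted_wrt_map by (rule sorted_wrt_mono_rel[OF _ sorted_wrt_upt]) (auto simp: insert_index_def)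
  moreover have "set ?vs = {1..n} - {Suc i}"
  proof
    show "set ?vs \<subseteq> {1..n} - {Suc i}"
      using i by (auto simp: insert_index_def split: if_splits)
    show "{1..n} - {Suc i} \<subseteq> set ?vs"
    proof
      fix v assume v: "v \<in> {1..n} - {Suc i}"
      let ?k = "if v \<le> i then v - 1 else v - 2"
      have "v = Suc (insert_index i ?k)" "?k < n - 1"
        using v i by (auto simp: insert_index_def)
      then show "v \<in> set ?vs"
        unfolding set_map set_upt by (intro image_eqI[of v _ ?k]) simp_all
    qed
  qed
  ultimately have vs: "sorted_list_of_set ({1..n} - {Suc i}) = ?vs"
    using i by (intro sorted_list_of_set_unique[THEN iffD1]) auto
  show ?thesis
  proof (rule eq_matI)
    fix k l assume "k < dim_row (mat_delete (adjacency_matrix G) i i)" "l < dim_col (mat_delete (adjacency_matrix G) i i)"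
    then have kl: "k < n - 1" "l < n - 1"
      using adjacency_matrix_carrier[OF verts] by (auto simp: mat_delete_def)
    then have ins: "insert_index i k < n" "insert_index i l < n"
      by (auto simp: insert_index_def)
    have entry_D: "adjacency_matrix ?D $$ (k, l) =
        (if (Suc (insert_index i k), Suc (insert_index i l)) \<in> arcs_ends ?D then 1 else 0)"
      unfolding adjacency_matrix_def Let_def card_D unfolding verts_D vs using kl by simp
    have "(Suc (insert_index i k), Suc (insert_index i l)) \<in> arcs_ends ?D \<longleftrightarrow>
        (Suc (insert_index i k), Suc (insert_index i l)) \<in> arcs_ends G"
      by (auto simp: arcs_ends_conv pre_digraph.del_vert_simps insert_index_def image_iff split: if_splits)
    moreover have "mat_delete (adjacency_matrix G) i i $$ (k, l) = adjacency_matrix G $$ (insert_index i k, insert_index i l)"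
      using kl adjacency_matrix_carrier[OF verts] by (auto simp: mat_delete_def insert_index_def)
    ultimately show "adjacency_matrix ?D $$ (k, l) = mat_delete (adjacency_matrix G) i i $$ (k, l)"
      using entry_D ins by (simp only: adjacency_matrix_index[OF verts])
  qed (use card_D adjacency_matrix_carrier[OF verts] in \<open>auto simp: adjacency_matrix_def Let_def\<close>)
qed

lemma adjacency_matrix_complement:
  fixes G :: "(nat, 'b) pre_digraph"
  assumes "graph G" and verts: "verts G = {1..n}" and "i < n" "j < n"
  shows "adjacency_matrix (complement G) $$ (i, j) = (if i = j then 0 else 1 - adjacency_matrix G $$ (i, j))"
proof -
  have "verts (complement G) = {1..n}"
    using verts by (simp add: complement_def)
  then show ?thesis
    using assms by (auto simp: adjacency_matrix_index arcs_ends_conv complement_def image_iff)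
qed

lemma walk_matrix_index:
  fixes G :: "(nat, 'b) pre_digraph"
  assumes "graph G" and verts: "verts G = {1..n}" and "i < n" "j < n"
  shows "walk_matrix G $$ (i, j) = hollow_symmetric.walks (adjacency_matrix G) n j i"
proof -
  interpret hollow_symmetric "adjacency_matrix G" n
    by (rule hollow_symmetric_adjacency_matrix) fact+
  have "card (verts G) = n"
    using verts by simp
  then show ?thesis
    using walks_eq[OF assms(3), of j] assms by (simp add: walk_matrix_def Let_def mat_of_cols_index)
qed

theorem theorem8:
  fixes G :: "(nat, 'b) pre_digraph" and H :: "(nat, 'c) pre_digraph" and n :: nat
  assumes "n \<ge> 3"
    and "graph G" and "verts G = {1..n}"
    and "graph H" and "verts H = {1..n}"
    and "\<And>i. i \<in> {1..n} \<Longrightarrow>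
      graph_char_poly (pre_digraph.del_vert G i) = graph_char_poly (pre_digraph.del_vert H i)"
  shows "[poly (graph_char_poly G) 0 = poly (graph_char_poly H) 0] (mod 2)
    \<and> [poly (graph_char_poly (complement G)) 0 = poly (graph_char_poly (complement H)) 0] (mod 2)
    \<and> (\<forall>i<n. \<forall>j<n. [walk_matrix G $$ (i, j) = walk_matrix H $$ (i, j)] (mod 2))
    \<and> (\<forall>j\<in>{1..n}. [coeff (graph_char_poly (complement G)) j
                     = coeff (graph_char_poly (complement H)) j] (mod 4))"
proof -
  let ?A = "adjacency_matrix G" and ?B = "adjacency_matrix H"
  interpret same_deck ?A ?B n
  proof (intro same_deck.intro hollow_symmetric_adjacency_matrix same_deck_axioms.intro)
    fix i assume i: "i < n"
    then show "char_poly (mat_delete ?A i i) = char_poly (mat_delete ?B i i)"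
      using assms(6)[of "Suc i"]
      by (simp add: graph_char_poly_def adjacency_matrix_del_vert[OF assms(3) i] adjacency_matrix_del_vert[OF assms(5) i])
  qed fact+
  have parity: "even (coeff G.\<phi> 0 - coeff H.\<phi> 0)"
    by (rule const_parity) fact
  have carrier: "adjacency_matrix (complement G) \<in> carrier_mat n n" "adjacency_matrix (complement H) \<in> carrier_mat n n"
    using assms(3,5) by (auto intro!: adjacency_matrix_carrier simp: complement_def)
  obtain \<delta> g where cong: "graph_char_poly (complement G) = graph_char_poly (complement H) + [:2 * \<delta>:] + 4 * g"
    unfolding graph_char_poly_def
    by (rule char_poly_complement_cong[OF assms(1) carrier(1) adjacency_matrix_complement[OF assms(2,3)]
          carrier(2) adjacency_matrix_complement[OF assms(4,5)]])
  have coeff_4: "coeff (4 * g) k = 4 * coeff g k" for k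
    by (simp add: numeral_poly)
  have "[poly (graph_char_poly G) 0 = poly (graph_char_poly H) 0] (mod 2)"
    using parity by (simp add: poly_0_coeff_0 graph_char_poly_def G.\<phi>_def H.\<phi>_def cong_iff_dvd_diff)
  moreover have "[poly (graph_char_poly (complement G)) 0 = poly (graph_char_poly (complement H)) 0] (mod 2)"
    unfolding cong by (simp add: poly_0_coeff_0 coeff_4 cong_iff_dvd_diff)
  moreover have "[walk_matrix G $$ (i, j) = walk_matrix H $$ (i, j)] (mod 2)" if "i < n" "j < n" for i j
    using walks_parity[OF parity that(2,1)] that assms
    by (simp add: walk_matrix_index of_int_bit of_bool_def cong_iff_dvd_diff split: if_splits)
  moreover have "[coeff (graph_char_poly (complement G)) j = coeff (graph_char_poly (complement H)) j] (mod 4)"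
    if "j \<in> {1..n}" for j
    using that unfolding cong by (cases j) (simp_all add: coeff_4 cong_iff_dvd_diff)
  ultimately show ?thesis
    by blast
qed

end
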